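(* There exist solutions $\psi$ of $\square_g\psi=0$ on the extremal Reissner--Nordström exterior that are smooth away from $\mathcal H^+$, have finite $T$-energy flux along $\mathcal H^+$ and along $\mathcal I^+$, and satisfy (i), and there exist such solutions satisfying (ii), where: (i) $\psi|_{\mathcal H^+}$ vanishes, while $r\psi|_{\mathcal I^+}$ satisfies $$\int_{\mathcal I^+\cap\{u\ge 0\}}(1+u)^p(\partial_u(r\psi))^2\,d\omega\,du=\infty\quad\text{if and only if } p\ge 2,$$ and $\psi$ has infinite unweighted $N$-energy flux along $\Sigma_0\cap\{r\le r_0\}$, with $r_0>M$ arbitrarily close to $M$; (ii) $r\psi|_{\mathcal I^+}$ vanishes, while $\psi|_{\mathcal H^+}$ satisfies $$\int_{\mathcal H^+\cap\{v\ge 0\}}(1+v)^p(\partial_v(r\psi))^2\,d\omega\,dv=\infty\quad\text{if and only if } p\ge 2,$$ and $\psi$ has infinite weighted $N$-energy flux along $\Sigma_0\cap\{r\ge R_0\}$, with $R_0>0$ arbitrarily large.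
   Context: Fix $M>0$ and $D(r)=(1-M/r)^2$. The extremal Reissner--Nordström (ERN) exterior is $\mathbb R_v\times[M,\infty)_r\times\mathbb S^2$ with $g=-D\,dv^2+2\,dv\,dr+r^2g_{\mathbb S^2}$; $\mathcal H^+=\{r=M\}$ is the future event horizon. Put $r_*(r)=r-M-\frac{M^2}{r-M}+2M\log\frac{r-M}{M}$ and $u=v-2r_*(r)$; for $r>M$ one has $g=-D\,du\,dv+r^2g_{\mathbb S^2}$. In $(u,v,\theta,\varphi)$ coordinates $L=\partial_v$, $\underline L=\partial_u$, and $T=L+\underline L$ is the stationary Killing field. Future null infinity $\mathcal I^+$ is the boundary $\{x=0\}$, $x=1/r$, attached in $(u,x,\theta,\varphi)$ coordinates; restriction to $\mathcal I^+$ means $\lim_{v\to\infty}$ at fixed $(u,\theta,\varphi)$. $d\omega$ is the standard volume form on the unit sphere. Let $Q_{\alpha\beta}[\psi]=\partial_\alpha\psi\,\partial_\beta\psi-\frac12 g_{\alpha\beta}\,g^{\kappa\lambda}\partial_\kappa\psi\,\partial_\lambda\psi$ and $(\mathbf J^X[\psi])_\alpha=Q_{\alpha\beta}[\psi]X^\beta$ for a vector field $X$. The $T$-energy fluxes along $\mathcal H^+$ and $\mathcal I^+$ are $\int_{\mathcal H^+}(\partial_v(r\psi))^2d\omega\,dv$ and $\int_{\mathcal I^+}(\partial_u(r\psi))^2d\omega\,du$. Hypersurface $\Sigma_0$: fix $M<r_{\mathcal H}<2M<r_{\mathcal I}<\infty$, $v_0>0$ and a piecewise smooth $h\ge0$ on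 $[M,\infty)$ with $h=0$ on $[M,r_{\mathcal H}]$, $h=2D^{-1}$ on $[r_{\mathcal I},\infty)$, and $h$ smooth with $0<h<2D^{-1}$ in between. Let $v_\Sigma(M)=v_0$, $v_\Sigma'=h$, and $\Sigma_0=\{v=v_\Sigma(r)\}$. Then $\Sigma_0\cap\{r\le r_{\mathcal H}\}$ is ingoing null, $\Sigma_0\cap\{r\ge r_{\mathcal I}\}$ is outgoing null, and the rest is spacelike. $N$ is a $T$-invariant vector field that is timelike everywhere up to and including $\mathcal H^+$ and equal to $T$ for large $r$. The unweighted $N$-energy flux along a subset of $\Sigma_0$ is the integral of $\mathbf J^N[\psi]\cdot\mathbf n\,d\mu$, where on the spacelike part $\mathbf n,d\mu$ are the unit normal and induced volume, on $\{r\le r_{\mathcal H}\}$ $\mathbf n=\underline L$, $d\mu=r^2d\omega\,du$, and on $\{r\ge r_{\mathcal I}\}$ $\mathbf n=L$, $d\mu=r^2d\omega\,dv$. The weighted $N$-energy flux along $\Sigma_0\cap\{r\ge R_0\}$ (for $R_0\ge r_{\mathcal I}$) is the unweighted flux plus $\int_{\Sigma_0\cap\{r\ge R_0\}}r^2(L(r\psi))^2d\omega\,dv$. *)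

theory Defs
  imports "HOL-Analysis.Analysis"
begin

section \<open>Smooth functions on subsets of Euclidean space\<close>

primrec C_on :: "nat \<Rightarrow> ('a::euclidean_space \<Rightarrow> real) \<Rightarrow> 'a set \<Rightarrow> bool" where
  "C_on 0 f U \<longleftrightarrow> continuous_on U f"
| "C_on (Suc k) f U \<longleftrightarrow> f differentiable_on U \<and>
     (\<forall>b\<in>Basis. C_on k (\<lambda>x. frechet_derivative f (at x) b) U)"

text \<open>For open \<open>S\<close> this is the existence and continuity of all iterated partial derivatives on
  \<open>S\<close>; for sets with boundary it is smoothness up to and including the boundary.\<close>

definition smooth_on :: "'a::euclidean_space set \<Rightarrow> ('a \<Rightarrow> real) \<Rightarrow> bool" where
  "smooth_on S f \<longleftrightarrow> (\<exists>U F. open U \<and> S \<subseteq> U \<and> (\<forall>k. C_on k F U) \<and> (\<forall>x\<in>S. f x = F x))"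


section \<open>The extremal Reissner--Nordstrom exterior\<close>

text \<open>The manifold \<open>\<real> \<times> [M,\<infinity>) \<times> S\<^sup>2\<close> with points \<open>(v, r, \<omega>)\<close> is identified with the subset
  \<open>|y| \<ge> M\<close> of \<open>\<real>\<^sup>4\<close>, with points \<open>(v, y)\<close>, by \<open>y = r \<omega>\<close>. This is a single global chart that is
  regular at the poles of the sphere. Component 1 is \<open>v\<close>, components 2, 3, 4 are \<open>y\<close>.\<close>

definition pt :: "real \<Rightarrow> real \<Rightarrow> real^3 \<Rightarrow> real^4" where
  "pt v r w = vector [v, r * w$1, r * w$2, r * w$3]"

definition rad :: "real^4 \<Rightarrow> real" where
  "rad p = sqrt ((p$2)\<^sup>2 + (p$3)\<^sup>2 + (p$4)\<^sup>2)"

definition exterior :: "real \<Rightarrow> (real^4) set" where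
  "exterior M = {p. M \<le> rad p}"

definition exterior_open :: "real \<Rightarrow> (real^4) set" where
  "exterior_open M = {p. M < rad p}"

definition Dfun :: "real \<Rightarrow> real \<Rightarrow> real" where
  "Dfun M r = (1 - M / r)\<^sup>2"

definition rstar :: "real \<Rightarrow> real \<Rightarrow> real" where
  "rstar M r = r - M - M\<^sup>2 / (r - M) + 2 * M * ln ((r - M) / M)"

text \<open>The area radius as a function of the double null coordinates, from \<open>u = v - 2 r\<^sub>*\<close>.\<close>

definition r_uv :: "real \<Rightarrow> real \<Rightarrow> real \<Rightarrow> real" where
  "r_uv M u v = inv_into {M<..} (rstar M) ((v - u) / 2)"

definition pt_uv :: "real \<Rightarrow> real \<Rightarrow> real \<Rightarrow> real^3 \<Rightarrow> real^4" where
  "pt_uv M u v w = pt v (r_uv M u v) w"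

definition dv :: "real^4" where
  "dv = axis 1 1"

definition dr :: "real^4 \<Rightarrow> real^4" where
  "dr p = (\<chi> a. if a = 1 then 0 else p$a / rad p)"

text \<open>\<open>-D dv\<^sup>2 + 2 dv dr + r\<^sup>2 g\<^bsub>S\<^sup>2\<^esub>\<close>, where \<open>r\<^sup>2 g\<^bsub>S\<^sup>2\<^esub> = |dy|\<^sup>2 - dr\<^sup>2\<close> and \<open>2 dv dr\<close> is the
  symmetric product \<open>dv \<otimes> dr + dr \<otimes> dv\<close>.\<close>

definition metric :: "real \<Rightarrow> real^4 \<Rightarrow> real^4^4" where
  "metric M p = (\<chi> a b.
     - Dfun M (rad p) * dv$a * dv$b
     + dv$a * dr p$b + dr p$a * dv$b
     + ((if a = b \<and> a \<noteq> 1 then 1 else 0) - dr p$a * dr p$b))"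

definition inv_metric :: "real \<Rightarrow> real^4 \<Rightarrow> real^4^4" where
  "inv_metric M p = matrix_inv (metric M p)"

definition gprod :: "real \<Rightarrow> real^4 \<Rightarrow> real^4 \<Rightarrow> real^4 \<Rightarrow> real" where
  "gprod M p X Y = X \<bullet> (metric M p *v Y)"

definition pd :: "4 \<Rightarrow> (real^4 \<Rightarrow> real) \<Rightarrow> real^4 \<Rightarrow> real" where
  "pd a f p = frechet_derivative f (at p) (axis a 1)"

definition vol_density :: "real \<Rightarrow> real^4 \<Rightarrow> real" where
  "vol_density M p = sqrt \<bar>det (metric M p)\<bar>"

definition box :: "real \<Rightarrow> (real^4 \<Rightarrow> real) \<Rightarrow> real^4 \<Rightarrow> real" where
  "box M f p =
     (\<Sum>a\<in>UNIV. pd a (\<lambda>q. vol_density M q * (\<Sum>b\<in>UNIV. inv_metric M q $ a $ b * pd b f q)) p)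
       / vol_density M p"


section \<open>Vector fields and energy currents\<close>

definition apply_vf :: "(real^4 \<Rightarrow> real^4) \<Rightarrow> (real^4 \<Rightarrow> real) \<Rightarrow> real^4 \<Rightarrow> real" where
  "apply_vf X f p = (\<Sum>a\<in>UNIV. X p $ a * pd a f p)"

definition T_vf :: "real^4 \<Rightarrow> real^4" where
  "T_vf p = axis 1 1"

text \<open>In the chart \<open>(v, y)\<close> the vector field \<open>\<partial>\<^sub>r\<close> (fixed \<open>v\<close> and \<open>\<omega>\<close>) is \<open>(0, y / r)\<close>.\<close>

definition R_vf :: "real^4 \<Rightarrow> real^4" where
  "R_vf p = (\<chi> a. if a = 1 then 0 else p$a / rad p)"

text \<open>\<open>L = \<partial>\<^sub>v\<close> at fixed \<open>u\<close> and \<open>Lbar = \<partial>\<^sub>u\<close> at fixed \<open>v\<close>. Since \<open>r\<^sub>* = (v - u)/2\<close> and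
  \<open>dr/dr\<^sub>* = D\<close>, one has \<open>\<partial>r/\<partial>v = D/2\<close> and \<open>\<partial>r/\<partial>u = -D/2\<close>.\<close>

definition L_vf :: "real \<Rightarrow> real^4 \<Rightarrow> real^4" where
  "L_vf M p = T_vf p + (Dfun M (rad p) / 2) *\<^sub>R R_vf p"

definition Lbar_vf :: "real \<Rightarrow> real^4 \<Rightarrow> real^4" where
  "Lbar_vf M p = - (Dfun M (rad p) / 2) *\<^sub>R R_vf p"

definition Q_tensor :: "real \<Rightarrow> (real^4 \<Rightarrow> real) \<Rightarrow> real^4 \<Rightarrow> 4 \<Rightarrow> 4 \<Rightarrow> real" where
  "Q_tensor M \<psi> p a b = pd a \<psi> p * pd b \<psi> p
     - 1/2 * metric M p $ a $ b *
       (\<Sum>k\<in>UNIV. \<Sum>l\<in>UNIV. inv_metric M p $ k $ l * pd k \<psi> p * pd l \<psi> p)"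

definition J_current :: "real \<Rightarrow> (real^4 \<Rightarrow> real^4) \<Rightarrow> (real^4 \<Rightarrow> real) \<Rightarrow> real^4 \<Rightarrow> real^4" where
  "J_current M X \<psi> p = (\<chi> a. \<Sum>b\<in>UNIV. Q_tensor M \<psi> p a b * X p $ b)"

definition N_field :: "real \<Rightarrow> (real^4 \<Rightarrow> real^4) \<Rightarrow> bool" where
  "N_field M N \<longleftrightarrow>
     (\<forall>a. smooth_on (exterior M) (\<lambda>p. N p $ a)) \<and>
     (\<forall>p\<in>exterior M. \<forall>s. N (p + s *\<^sub>R axis 1 1) = N p) \<and>
     (\<forall>p\<in>exterior M. gprod M p (N p) (N p) < 0) \<and>
     (\<exists>R. \<forall>p\<in>exterior M. R \<le> rad p \<longrightarrow> N p = T_vf p)"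


section \<open>The hypersurface and its energy fluxes\<close>

text \<open>The volume form \<open>sin \<theta> d\<theta> d\<phi>\<close>, as a measure on \<open>\<real>\<^sup>3\<close> concentrated on the unit sphere.\<close>

definition sphere_measure :: "(real^3) measure" where
  "sphere_measure =
     distr (density lborel
              (\<lambda>(\<theta>, \<phi>). ennreal (indicator ({0..pi} \<times> {0..2*pi}) (\<theta>, \<phi>) * sin \<theta>)))
           borel
           (\<lambda>(\<theta>, \<phi>). vector [sin \<theta> * cos \<phi>, sin \<theta> * sin \<phi>, cos \<theta>])"

text \<open>Piecewise smoothness only concerns the middle piece, the outer two being explicit. Jumps of
  \<open>h\<close> at \<open>rH\<close> and \<open>rI\<close> are allowed.\<close>

definition slope_function :: "real \<Rightarrow> real \<Rightarrow> real \<Rightarrow> (real \<Rightarrow> real) \<Rightarrow> bool" where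
  "slope_function M rH rI h \<longleftrightarrow>
     (\<forall>r\<in>{M..rH}. h r = 0) \<and>
     (\<forall>r\<in>{rI..}. h r = 2 / Dfun M r) \<and>
     (\<exists>k. smooth_on {rH..rI} k \<and> (\<forall>r\<in>{rH<..<rI}. h r = k r)) \<and>
     (\<forall>r\<in>{rH<..<rI}. 0 < h r \<and> h r < 2 / Dfun M r)"

definition v_Sigma :: "real \<Rightarrow> real \<Rightarrow> (real \<Rightarrow> real) \<Rightarrow> real \<Rightarrow> real" where
  "v_Sigma M v0 h r = v0 + integral {M..r} h"

text \<open>The constant value of \<open>u\<close> on the outgoing null part \<open>r \<ge> rI\<close>.\<close>

definition u_Sigma :: "real \<Rightarrow> real \<Rightarrow> real \<Rightarrow> (real \<Rightarrow> real) \<Rightarrow> real" where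
  "u_Sigma M rI v0 h = v_Sigma M v0 h rI - 2 * rstar M rI"

text \<open>The conormal \<open>d(v - v\<^sub>\<Sigma>(r))\<close> and the future-directed unit normal on the spacelike part.\<close>

definition conormal :: "(real \<Rightarrow> real) \<Rightarrow> real^4 \<Rightarrow> real^4" where
  "conormal h p = dv - h (rad p) *\<^sub>R dr p"

definition unit_normal :: "real \<Rightarrow> (real \<Rightarrow> real) \<Rightarrow> real^4 \<Rightarrow> real^4" where
  "unit_normal M h p =
     - (1 / sqrt (- (conormal h p \<bullet> (inv_metric M p *v conormal h p)))) *\<^sub>R
       (inv_metric M p *v conormal h p)"

text \<open>The induced volume is \<open>volume_factor \<cdot> dr d\<omega>\<close>: the tangent vector \<open>\<partial>\<^sub>r + h \<partial>\<^sub>v\<close> is orthogonal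
  to the spheres of radius \<open>r\<close>.\<close>

definition volume_factor :: "real \<Rightarrow> (real \<Rightarrow> real) \<Rightarrow> real^4 \<Rightarrow> real" where
  "volume_factor M h p =
     (let X = R_vf p + h (rad p) *\<^sub>R T_vf p in sqrt (gprod M p X X) * (rad p)\<^sup>2)"

text \<open>The unweighted flux along the part of \<open>\<Sigma>\<^sub>0\<close> where \<open>r \<in> S\<close>, as the sum of the contributions of
  the ingoing null, spacelike and outgoing null parts. All integrands are nonnegative, so the
  integrals are taken in \<open>[0,\<infinity>]\<close>.\<close>

definition N_flux ::
  "real \<Rightarrow> real \<Rightarrow> real \<Rightarrow> real \<Rightarrow> (real \<Rightarrow> real) \<Rightarrow> (real^4 \<Rightarrow> real^4) \<Rightarrow> (real^4 \<Rightarrow> real)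
     \<Rightarrow> real set \<Rightarrow> ennreal" where
  "N_flux M rH rI v0 h N \<psi> S =
     (\<integral>\<^sup>+u\<in>{u. r_uv M u v0 \<le> rH \<and> r_uv M u v0 \<in> S}. (\<integral>\<^sup>+w.
        (let p = pt_uv M u v0 w in
          ennreal (J_current M N \<psi> p \<bullet> Lbar_vf M p * (rad p)\<^sup>2)) \<partial>sphere_measure) \<partial>lborel)
   + (\<integral>\<^sup>+r\<in>{rH<..<rI} \<inter> S. (\<integral>\<^sup>+w.
        (let p = pt (v_Sigma M v0 h r) r w in
          ennreal (J_current M N \<psi> p \<bullet> unit_normal M h p * volume_factor M h p))
          \<partial>sphere_measure) \<partial>lborel)
   + (\<integral>\<^sup>+v\<in>{v. rI \<le> r_uv M (u_Sigma M rI v0 h) v \<and> r_uv M (u_Sigma M rI v0 h) v \<in> S}. (\<integral>\<^sup>+w.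
        (let p = pt_uv M (u_Sigma M rI v0 h) v w in
          ennreal (J_current M N \<psi> p \<bullet> L_vf M p * (rad p)\<^sup>2)) \<partial>sphere_measure) \<partial>lborel)"

text \<open>To be used for \<open>R0 \<ge> rI\<close>.\<close>

definition weighted_N_flux ::
  "real \<Rightarrow> real \<Rightarrow> real \<Rightarrow> real \<Rightarrow> (real \<Rightarrow> real) \<Rightarrow> (real^4 \<Rightarrow> real^4) \<Rightarrow> (real^4 \<Rightarrow> real)
     \<Rightarrow> real \<Rightarrow> ennreal" where
  "weighted_N_flux M rH rI v0 h N \<psi> R0 =
     N_flux M rH rI v0 h N \<psi> {R0..}
   + (\<integral>\<^sup>+v\<in>{v. R0 \<le> r_uv M (u_Sigma M rI v0 h) v}. (\<integral>\<^sup>+w.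
        (let p = pt_uv M (u_Sigma M rI v0 h) v w in
          ennreal ((rad p)\<^sup>2 * (apply_vf (L_vf M) (\<lambda>q. rad q * \<psi> q) p)\<^sup>2))
          \<partial>sphere_measure) \<partial>lborel)"


section \<open>Solutions and their restrictions to the horizon and to null infinity\<close>

text \<open>Continuity on the closed exterior is what gives the restriction to the horizon a meaning.\<close>

definition wave_solution :: "real \<Rightarrow> (real^4 \<Rightarrow> real) \<Rightarrow> bool" where
  "wave_solution M \<psi> \<longleftrightarrow>
     continuous_on (exterior M) \<psi> \<and>
     smooth_on (exterior_open M) \<psi> \<and>
     (\<forall>p\<in>exterior_open M. box M \<psi> p = 0)"

definition restr_scri :: "real \<Rightarrow> (real^4 \<Rightarrow> real) \<Rightarrow> (real \<Rightarrow> real^3 \<Rightarrow> real) \<Rightarrow> bool" where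
  "restr_scri M f F \<longleftrightarrow>
     (\<forall>u. \<forall>w\<in>sphere 0 1. ((\<lambda>v. f (pt_uv M u v w)) \<longlongrightarrow> F u w) at_top)"

text \<open>\<open>\<Phi>\<close> is the restriction of \<open>r\<psi>\<close> to null infinity, and \<open>\<Phi>'\<close> is \<open>\<partial>\<^sub>u(r\<psi>)\<close> there, both as the
  restriction of \<open>\<partial>\<^sub>u(r\<psi>)\<close> and as the tangential derivative of \<open>\<Phi>\<close>.\<close>

definition scri_trace ::
  "real \<Rightarrow> (real^4 \<Rightarrow> real) \<Rightarrow> (real \<Rightarrow> real^3 \<Rightarrow> real) \<Rightarrow> (real \<Rightarrow> real^3 \<Rightarrow> real) \<Rightarrow> bool" where
  "scri_trace M \<psi> \<Phi> \<Phi>' \<longleftrightarrow>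
     restr_scri M (\<lambda>p. rad p * \<psi> p) \<Phi> \<and>
     restr_scri M (apply_vf (Lbar_vf M) (\<lambda>p. rad p * \<psi> p)) \<Phi>' \<and>
     (\<forall>u. \<forall>w\<in>sphere 0 1. ((\<lambda>u. \<Phi> u w) has_real_derivative \<Phi>' u w) (at u))"

definition horizon_trace ::
  "real \<Rightarrow> (real^4 \<Rightarrow> real) \<Rightarrow> (real \<Rightarrow> real^3 \<Rightarrow> real) \<Rightarrow> (real \<Rightarrow> real^3 \<Rightarrow> real) \<Rightarrow> bool" where
  "horizon_trace M \<psi> \<Theta> \<Theta>' \<longleftrightarrow>
     (\<forall>v. \<forall>w\<in>sphere 0 1. \<Theta> v w = M * \<psi> (pt v M w) \<and>
        ((\<lambda>v. \<Theta> v w) has_real_derivative \<Theta>' v w) (at v))"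

definition boundary_flux :: "(real \<Rightarrow> real^3 \<Rightarrow> real) \<Rightarrow> ennreal" where
  "boundary_flux F' = (\<integral>\<^sup>+t. (\<integral>\<^sup>+w. ennreal ((F' t w)\<^sup>2) \<partial>sphere_measure) \<partial>lborel)"

definition weighted_boundary_flux :: "real \<Rightarrow> (real \<Rightarrow> real^3 \<Rightarrow> real) \<Rightarrow> ennreal" where
  "weighted_boundary_flux p F' =
     (\<integral>\<^sup>+t\<in>{0..}. (\<integral>\<^sup>+w. ennreal ((1 + t) powr p * (F' t w)\<^sup>2) \<partial>sphere_measure) \<partial>lborel)"

end

theory Submission
  imports Defs
begin

text \<open>Both solutions are spherically symmetric. For \<open>\<psi> = \<phi>(u, v) / r\<close> the wave equation reads
  \<open>\<partial>\<^sub>u\<partial>\<^sub>v\<phi> = -V \<phi>\<close>, where \<open>V = D D' / (4 r) \<ge> 0\<close> decays like \<open>|r\<^sub>*|\<^sup>-\<^sup>3\<close> at both ends. Let \<open>\<phi>\<close> vanish on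
  the future horizon \<open>u = \<infinity>\<close> and equal \<open>f(u)\<close> on the past horizon \<open>v = -\<infinity>\<close>. Integrating twice
  gives a Volterra equation in the direction of increasing \<open>r\<close>, \<open>\<phi> = f + Aop \<phi>\<close>, with a nonnegative
  kernel that only looks at later \<open>u\<close>. It is a contraction in a norm weighted by \<open>r\<^sup>2\<close>, and since
  \<open>\<phi> = r\<close> is a solution, \<open>|f| \<le> S\<close> on \<open>[u, \<infinity>)\<close> implies \<open>|\<phi>(u, r)| \<le> S r / M\<close> (\<open>sol_bound\<close>). So the
  solution exists globally, with pointwise bounds and without energy estimates. The operator commutes
  with shifts in \<open>u\<close>; hence \<open>T \<phi>\<close> is the solution with data \<open>f'\<close>, and the wave equation then supplies
  all other derivatives (\<open>tower_smooth\<close>, \<open>tower_box\<close>).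

  The derivative of \<open>\<phi>\<close> in \<open>u\<close> at constant \<open>v\<close> is \<open>f'(u)\<close> minus the integral of \<open>V \<phi>\<close> along
  \<open>u = const\<close> from the past horizon (\<open>flux_identity\<close>), and this integral is at most \<open>S / (2 M)\<close>. Take
  \<open>f\<close> to be the derivative of \<open>env\<^sup>3 logi sin (lam u)\<close>, where \<open>env\<^sup>3\<close> decays like \<open>u\<^sup>-\<^sup>3\<^sup>/\<^sup>2\<close>. Then \<open>f\<close> and
  \<open>f'\<close> are bounded by multiples of \<open>env\<^sup>3\<close>, and for a high frequency \<open>lam\<close> the derivative \<open>f'\<close> wins over
  the integral: \<open>|\<partial>\<^sub>u\<phi>|\<close> lies between two multiples of \<open>env\<^sup>3\<close> wherever \<open>|sin (lam u)| \<ge> 1/2\<close>, at null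
  infinity as well as at finite radius (\<open>rad_field'_lower\<close>). The weighted flux at null infinity is
  therefore comparable to the integral of \<open>u\<^sup>p\<^sup>-\<^sup>3\<close>, finite exactly for \<open>p < 2\<close>. A flux with respect to
  \<open>N\<close> through the ingoing cone near the horizon weighs \<open>(\<partial>\<^sub>u\<phi>)\<^sup>2\<close> with \<open>1 / D\<close>, which grows like \<open>u\<^sup>2\<close>
  there, so it diverges logarithmically (\<open>psi_i_flux_infinite\<close>).

  The second part is the first one reflected. The inversion \<open>r - M \<mapsto> M\<^sup>2 / (r - M)\<close> changes \<open>r\<^sub>*\<close> into
  \<open>-r\<^sub>*\<close> and preserves \<open>V\<close>, so \<open>\<phi>(v, u)\<close> is again a solution (\<open>tower_mirror\<close>). It exchanges the horizon
  with null infinity and \<open>L\<close> with \<open>Lbar\<close>, and it turns the weight \<open>1 / D\<close> into the weight \<open>r\<^sup>2\<close> of the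
  weighted energy.\<close>

section \<open>Integrals with a variable endpoint\<close>

text \<open>The integrands below live on \<open>r > M\<close> and need not extend continuously to the horizon; hence
  the open interval and the Lebesgue integral.\<close>

definition opint :: "real \<Rightarrow> (real \<Rightarrow> real) \<Rightarrow> real \<Rightarrow> real" where
  "opint a g r = (LBINT x:{a<..<r}. g x)"

lemma opint_integrable:
  fixes g k :: "real \<Rightarrow> real"
  assumes g: "continuous_on {a<..} g" and b: "\<And>x. a < x \<Longrightarrow> \<bar>g x\<bar> \<le> k x"
    and k: "continuous_on {a..} k"
  shows "set_integrable lborel {a<..<r} g"
proof (rule set_integrable_bound)
  have "set_integrable lborel {a..r} k"
    by (rule borel_integrable_atLeastAtMost', rule continuous_on_subset[OF k]) auto
  then show "set_integrable lborel {a<..<r} k"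
    by (rule set_integrable_subset) auto
  show "set_borel_measurable lborel {a<..<r} g"
    unfolding set_borel_measurable_def
    using borel_measurable_continuous_on_indicator[OF _ continuous_on_subset[OF g, of "{a<..<r}"]]
    by (auto simp: subset_eq)
  show "AE x in lborel. x \<in> {a<..<r} \<longrightarrow> norm (g x) \<le> norm (k x)"
  proof (rule AE_I2)
    fix x show "x \<in> {a<..<r} \<longrightarrow> norm (g x) \<le> norm (k x)"
      using b[of x] by auto
  qed
qed

lemma opint_mono:
  assumes "set_integrable lborel {a<..<r} f" "set_integrable lborel {a<..<r} g"
    and "\<And>x. a < x \<Longrightarrow> x < r \<Longrightarrow> f x \<le> g x"
  shows "opint a f r \<le> opint a g r"
  unfolding opint_def by (rule set_integral_mono) (use assms in auto)

lemma opint_abs_le: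
  assumes "set_integrable lborel {a<..<r} f" "set_integrable lborel {a<..<r} g"
    and "\<And>x. a < x \<Longrightarrow> x < r \<Longrightarrow> \<bar>f x\<bar> \<le> g x"
  shows "\<bar>opint a f r\<bar> \<le> opint a g r"
proof -
  have "opint a (\<lambda>x. - f x) r = - opint a f r"
    unfolding opint_def set_lebesgue_integral_def by simp
  moreover have "opint a f r \<le> opint a g r"
    using assms by (intro opint_mono) (auto simp: abs_le_iff)
  moreover have "opint a (\<lambda>x. - f x) r \<le> opint a g r"
    using assms by (intro opint_mono) (auto simp: abs_le_iff set_integrable_def)
  ultimately show ?thesis by linarith
qed

lemma opint_nonneg:
  assumes "\<And>x. a < x \<Longrightarrow> x < r \<Longrightarrow> 0 \<le> f x"
  shows "0 \<le> opint a f r"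
  unfolding opint_def set_lebesgue_integral_def
  by (rule integral_nonneg_AE) (use assms in \<open>auto simp: indicator_def\<close>)

lemma opint_linear:
  assumes "set_integrable lborel {a<..<r} f" "set_integrable lborel {a<..<r} g"
  shows "opint a (\<lambda>x. \<alpha> * f x + \<beta> * g x) r = \<alpha> * opint a f r + \<beta> * opint a g r"
proof -
  have "set_integrable lborel {a<..<r} (\<lambda>x. \<alpha> * f x)" "set_integrable lborel {a<..<r} (\<lambda>x. \<beta> * g x)"
    using assms by auto
  then show ?thesis
    unfolding opint_def by (simp add: set_integral_add)
qed

lemma opint_cong:
  assumes "\<And>x. a < x \<Longrightarrow> x < r \<Longrightarrow> f x = g x"
  shows "opint a f r = opint a g r"
  unfolding opint_def by (rule set_lebesgue_integral_cong) (use assms in auto)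

lemma opint_FTC:
  assumes "a \<le> r" and F: "\<And>x. a \<le> x \<Longrightarrow> (F has_real_derivative g x) (at x)"
    and g: "continuous_on {a..r} g"
  shows "opint a g r = F r - F a"
proof -
  have "opint a g r = (LBINT x:{a..r}. g x)"
    unfolding opint_def
  proof (rule set_integral_cong_set)
    have i: "set_integrable lborel {a..r} g" by (rule borel_integrable_atLeastAtMost'[OF g])
    then show "set_borel_measurable lborel {a..r} g"
      unfolding set_integrable_def set_borel_measurable_def by auto
    have "set_integrable lborel {a<..<r} g" by (rule set_integrable_subset[OF i]) auto
    then show "set_borel_measurable lborel {a<..<r} g"
      unfolding set_integrable_def set_borel_measurable_def by auto
    have "AE x in lborel. x \<noteq> a \<and> x \<noteq> r" 
      using AE_lborel_singleton[of a] AE_lborel_singleton[of r] by eventually_elim auto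
    then show "AE x in lborel. (x \<in> {a..r}) = (x \<in> {a<..<r})" by eventually_elim auto
  qed
  also have "\<dots> = F r - F a"
    unfolding set_lebesgue_integral_def
    using integral_FTC_atLeastAtMost[OF \<open>a \<le> r\<close> _ g, of F] F
    by (auto simp: has_real_derivative_iff_has_vector_derivative intro: has_vector_derivative_at_within)
  finally show ?thesis .
qed

lemma opint_has_derivative:
  assumes int: "\<And>s. set_integrable lborel {a<..<s} g" and g: "continuous_on {a<..} g" and "a < r"
  shows "(opint a g has_real_derivative g r) (at r)"
proof -
  define r1 where "r1 = (a + r) / 2"
  have r1: "a < r1" "r1 < r" using \<open>a < r\<close> by (auto simp: r1_def)
  have gc: "continuous_on {r1..r+1} g" by (rule continuous_on_subset[OF g]) (use r1 in auto)
  have eq: "opint a g s = opint a g r1 + integral {r1..s} g" if s: "s \<in> {r1<..<r+1}" for s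
  proof -
    have ic: "set_integrable lborel {r1..<s} g"
      by (rule set_integrable_subset[OF int[of s]]) (use r1 s in auto)
    have "{a<..<s} = {a<..<r1} \<union> {r1..<s}" using r1 s by auto
    then have "opint a g s = opint a g r1 + (LBINT x:{r1..<s}. g x)"
      unfolding opint_def by (simp add: set_integral_Un[OF _ int ic] ivl_disj_int)
    also have "(LBINT x:{r1..<s}. g x) = integral {r1..<s} g"
      by (rule set_borel_integral_eq_integral(2)[OF ic])
    also have "\<dots> = integral {r1..s} g"
      by (rule integral_subset_negligible, force, rule negligible_subset[of "{s}"]) auto
    finally show ?thesis .
  qed
  have "((\<lambda>s. opint a g r1 + integral {r1..s} g) has_real_derivative g r) (at r within {r1..r+1})"
    using integral_has_real_derivative[OF gc, of r] r1 by (auto intro!: derivative_eq_intros)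
  then have "((\<lambda>s. opint a g r1 + integral {r1..s} g) has_real_derivative g r) (at r)"
    by (subst (asm) at_within_Icc_at) (use r1 in auto)
  then show ?thesis
    by (rule has_field_derivative_transform_within_open[where S = "{r1<..<r+1}"])
       (use r1 eq in auto)
qed

text \<open>Dominated convergence: when the endpoint converges, the indicator functions of the intervals of
  integration converge away from the limiting endpoint.\<close>

lemma opint_continuous_param:
  fixes g :: "real \<Rightarrow> real \<Rightarrow> real"
  assumes g: "continuous_on (UNIV \<times> {a<..}) (\<lambda>(y, x). g y x)"
    and b: "\<And>y x. a < x \<Longrightarrow> \<bar>g y x\<bar> \<le> k x" and k: "continuous_on {a..} k"
  shows "continuous_on (UNIV \<times> {a<..}) (\<lambda>(y, r). opint a (g y) r)"
proof (rule continuous_on_sequentiallyI)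
  fix s :: "nat \<Rightarrow> real \<times> real" and z
  assume s: "\<forall>n. s n \<in> UNIV \<times> {a<..}" and z: "z \<in> UNIV \<times> {a<..}" and lim: "s \<longlonglongrightarrow> z"
  obtain y0 r0 where z0: "z = (y0, r0)" by (cases z)
  have l1: "(\<lambda>n. fst (s n)) \<longlonglongrightarrow> y0" and l2: "(\<lambda>n. snd (s n)) \<longlonglongrightarrow> r0"
    using tendsto_fst[OF lim] tendsto_snd[OF lim] by (auto simp: z0)
  have r0: "a < r0" using z z0 by auto
  have gy: "continuous_on {a<..} (g y)" for y
  proof -
    have "continuous_on {a<..} (\<lambda>x. (\<lambda>(y, x). g y x) (y, x))"
      by (rule continuous_on_compose2[OF g]) (auto intro!: continuous_intros)
    then show ?thesis by simp
  qed
  have "Bseq (\<lambda>n. snd (s n))" using l2 by (intro convergent_imp_Bseq) (auto simp: convergent_def)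
  then obtain R where "\<And>n. norm (snd (s n)) \<le> R" unfolding Bseq_def by blast
  then have R: "snd (s n) \<le> R" for n using abs_le_D1[of "snd (s n)" R] by simp
  have Rr: "r0 \<le> R" using R l2 by (simp add: Lim_bounded)
  let ?f = "\<lambda>y r x. indicator {a<..<r} x *\<^sub>R g y x"
  have meas: "?f y r \<in> borel_measurable lborel" for y r
    using opint_integrable[OF gy b k, of r y] unfolding set_integrable_def by auto
  have "(\<lambda>n. integral\<^sup>L lborel (?f (fst (s n)) (snd (s n)))) \<longlonglongrightarrow> integral\<^sup>L lborel (?f y0 r0)"
  proof (rule integral_dominated_convergence[where w = "\<lambda>x. indicator {a..R} x *\<^sub>R k x"])
    show "integrable lborel (\<lambda>x. indicator {a..R} x *\<^sub>R k x)"
      by (rule borel_integrable_compact) (auto intro: continuous_on_subset[OF k])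
    show "AE x in lborel. (\<lambda>n. ?f (fst (s n)) (snd (s n)) x) \<longlonglongrightarrow> ?f y0 r0 x"
    proof -
      have "AE x in lborel. x \<noteq> r0" by (rule AE_lborel_singleton)
      then show ?thesis
      proof eventually_elim
        case (elim x)
        show ?case
        proof (cases "x \<le> a")
          case True then show ?thesis by simp
        next
          case False
          have "(\<lambda>n. (\<lambda>(y, x). g y x) (fst (s n), x)) \<longlonglongrightarrow> (\<lambda>(y, x). g y x) (y0, x)"
            using g False
            by (intro continuous_on_tendsto_compose[OF g]) (auto intro!: tendsto_intros l1)
          then have gl: "(\<lambda>n. g (fst (s n)) x) \<longlonglongrightarrow> g y0 x" by simp
          consider "x < r0" | "r0 < x" using elim by linarith
          then show ?thesis
          proof cases
            case 1
            have "eventually (\<lambda>n. x < snd (s n)) sequentially" using l2 1 by (rule order_tendstoD)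
            then have ev: "eventually (\<lambda>n. ?f (fst (s n)) (snd (s n)) x = g (fst (s n)) x) sequentially"
              by eventually_elim (use False in auto)
            have "(\<lambda>n. ?f (fst (s n)) (snd (s n)) x) \<longlonglongrightarrow> g y0 x"
              by (rule tendsto_cong[THEN iffD2, OF ev gl])
            moreover have "?f y0 r0 x = g y0 x" using False 1 by simp
            ultimately show ?thesis by metis
          next
            case 2
            have "eventually (\<lambda>n. snd (s n) < x) sequentially" using l2 2 by (rule order_tendstoD)
            then have "eventually (\<lambda>n. ?f (fst (s n)) (snd (s n)) x = 0) sequentially"
              by eventually_elim auto
            then have "(\<lambda>n. ?f (fst (s n)) (snd (s n)) x) \<longlonglongrightarrow> 0" by (rule tendsto_eventually)
            moreover have "?f y0 r0 x = 0" using 2 by simp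
            ultimately show ?thesis by metis
          qed
        qed
      qed
    qed
    fix n
    show "AE x in lborel. norm (?f (fst (s n)) (snd (s n)) x) \<le> indicator {a..R} x *\<^sub>R k x"
    proof (rule AE_I2)
      fix x show "norm (?f (fst (s n)) (snd (s n)) x) \<le> indicator {a..R} x *\<^sub>R k x"
      proof (cases "a < x \<and> x < snd (s n)")
        case True then show ?thesis using R[of n] b[of x "fst (s n)"] by auto
      next
        case False
        have "0 \<le> k x" if "a \<le> x"
        proof (cases "a = x")
          case True
          have "((k \<longlongrightarrow> k a) (at a within {a..}))" using k by (auto simp: continuous_on)
          then have "((k \<longlongrightarrow> k a) (at_right a))" by (rule tendsto_within_subset) auto
          moreover have "eventually (\<lambda>x. 0 \<le> k x) (at_right a)"
            unfolding eventually_at_filter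
            by (rule always_eventually) (use b order_trans[OF abs_ge_zero b] in auto)
          ultimately have "0 \<le> k a" by (rule tendsto_lowerbound) simp
          then show ?thesis using True by simp
        next
          case False then show ?thesis using that b[of x 0] by auto
        qed
        with False show ?thesis by (auto simp: indicator_def)
      qed
    qed
  qed (use meas in auto)
  then show "(\<lambda>n. case s n of (y, r) \<Rightarrow> opint a (g y) r) \<longlonglongrightarrow> (case z of (y, r) \<Rightarrow> opint a (g y) r)"
    by (simp add: z0 opint_def set_lebesgue_integral_def case_prod_beta)
qed

section \<open>Shift-covariant operators on bounded data\<close>

text \<open>Boundary data are bounded and continuous; the bound is kept explicit because every operator
  below is controlled by it.\<close>

definition bcont :: "real \<Rightarrow> (real \<Rightarrow> real) \<Rightarrow> bool" where
  "bcont K f \<longleftrightarrow> continuous_on UNIV f \<and> (\<forall>x. \<bar>f x\<bar> \<le> K)"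

lemma bcontD: "bcont K f \<Longrightarrow> continuous_on UNIV f" "bcont K f \<Longrightarrow> \<bar>f x\<bar> \<le> K" "bcont K f \<Longrightarrow> 0 \<le> K"
  by (auto simp: bcont_def intro: order_trans[OF abs_ge_zero])

lemma bcont_lincomb:
  "bcont K f \<Longrightarrow> bcont L g \<Longrightarrow> bcont (\<bar>\<alpha>\<bar> * K + \<bar>\<beta>\<bar> * L) (\<lambda>x. \<alpha> * f x + \<beta> * g x)"
  unfolding bcont_def
  by (auto intro!: continuous_intros order_trans[OF abs_triangle_ineq] add_mono mult_left_mono simp: abs_mult)

lemma bcont_shift: "bcont K f \<Longrightarrow> bcont K (\<lambda>x. f (x + s))"
  unfolding bcont_def by (auto intro!: continuous_on_compose2[of UNIV f] continuous_intros)

text \<open>An operator that commutes with shifts satisfies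
  \<open>\<Lambda> f (u + s) - \<Lambda> f u - s * \<Lambda> f' u = \<Lambda> (f(\<cdot> + s) - f - s * f') u\<close>, and by Taylor's formula
  the argument on the right is \<open>O(s\<^sup>2)\<close> uniformly. This moves derivatives through all integral
  operators below without differentiating under an integral sign.\<close>

lemma shift_covariant_derivative:
  fixes \<Lambda> :: "(real \<Rightarrow> real) \<Rightarrow> real \<Rightarrow> real"
  assumes lin: "\<And>K L f g \<alpha> \<beta>. bcont K f \<Longrightarrow> bcont L g \<Longrightarrow>
      \<Lambda> (\<lambda>x. \<alpha> * f x + \<beta> * g x) u = \<alpha> * \<Lambda> f u + \<beta> * \<Lambda> g u"
    and shift: "\<And>K f s. bcont K f \<Longrightarrow> \<Lambda> (\<lambda>x. f (x + s)) u = \<Lambda> f (u + s)"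
    and bnd: "\<And>K f. bcont K f \<Longrightarrow> \<bar>\<Lambda> f u\<bar> \<le> C * K"
    and f: "bcont K0 f" "bcont K1 f'" "bcont K2 f''"
    and df: "\<And>x. (f has_real_derivative f' x) (at x)"
    and df': "\<And>x. (f' has_real_derivative f'' x) (at x)"
  shows "(\<Lambda> f has_real_derivative \<Lambda> f' u) (at u)"
proof -
  have taylor: "\<bar>f (x + s) - f x - s * f' x\<bar> \<le> K2 * s\<^sup>2" for x s
  proof -
    have lip: "\<bar>f' y - f' x\<bar> \<le> K2 * \<bar>y - x\<bar>" for y
      using field_differentiable_bound[of UNIV f' f'' K2 y x] df' bcontD(2)[OF f(3)]
      by (auto intro: DERIV_subset)
    have "norm (f (x + s) - f x - f' x * (x + s - x)) \<le> (K2 * \<bar>s\<bar>) * norm (x + s - x)"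
    proof (rule order_trans[OF _ field_differentiable_bound[of "closed_segment x (x + s)" "\<lambda>y. f y - f x - f' x * (y - x)" "\<lambda>y. f' y - f' x" "K2 * \<bar>s\<bar>" "x + s" x]])
      fix y assume y: "y \<in> closed_segment x (x + s)"
      show "((\<lambda>y. f y - f x - f' x * (y - x)) has_real_derivative f' y - f' x) (at y within closed_segment x (x + s))"
        by (auto intro!: derivative_eq_intros DERIV_subset[OF df])
      have "\<bar>y - x\<bar> \<le> \<bar>s\<bar>" using y by (auto simp: closed_segment_eq_real_ivl split: if_splits)
      then have "K2 * \<bar>y - x\<bar> \<le> K2 * \<bar>s\<bar>" by (intro mult_left_mono bcontD(3)[OF f(3)])
      with lip[of y] show "norm (f' y - f' x) \<le> K2 * \<bar>s\<bar>" by simp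
    qed (auto simp: algebra_simps)
    then show ?thesis by (simp add: power2_eq_square algebra_simps abs_mult)
  qed
  have C: "0 \<le> C * K2" using bnd[of K2 f''] f(3) by (auto intro: order_trans[OF abs_ge_zero])
  have key: "\<bar>\<Lambda> f (u + s) - \<Lambda> f u - s * \<Lambda> f' u\<bar> \<le> C * K2 * s\<^sup>2" for s
  proof -
    let ?d = "\<lambda>x. f (x + s) - f x"
    have b1: "bcont (\<bar>1\<bar> * K0 + \<bar>-1\<bar> * K0) (\<lambda>x. 1 * f (x + s) + (-1) * f x)"
      by (intro bcont_lincomb bcont_shift f)
    have l1: "\<Lambda> (\<lambda>x. 1 * f (x + s) + (-1) * f x) u = \<Lambda> f (u + s) - \<Lambda> f u"
      using lin[OF bcont_shift[OF f(1)] f(1), of 1 s "-1"] shift[OF f(1)] by simp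
    have l2: "\<Lambda> (\<lambda>x. 1 * (1 * f (x + s) + (-1) * f x) + (-s) * f' x) u
        = \<Lambda> f (u + s) - \<Lambda> f u - s * \<Lambda> f' u"
      using lin[OF b1 f(2), of 1 "-s"] l1 by simp
    have "bcont (K2 * s\<^sup>2) (\<lambda>x. 1 * (1 * f (x + s) + (-1) * f x) + (-s) * f' x)"
      using bcont_lincomb[OF b1 f(2), of 1 "-s"] taylor by (auto simp: bcont_def)
    from bnd[OF this] l2 show ?thesis by (simp add: mult.assoc)
  qed
  have "((\<lambda>s. (\<Lambda> f (u + s) - \<Lambda> f u) / s - \<Lambda> f' u) \<longlongrightarrow> 0) (at 0)"
  proof (rule Lim_null_comparison)
    show "((\<lambda>s. C * K2 * \<bar>s\<bar>) \<longlongrightarrow> 0) (at 0)"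
      by (auto intro!: tendsto_eq_intros)
    show "eventually (\<lambda>s. norm ((\<Lambda> f (u + s) - \<Lambda> f u) / s - \<Lambda> f' u) \<le> C * K2 * \<bar>s\<bar>) (at 0)"
      unfolding eventually_at_filter
    proof (rule always_eventually, intro allI impI)
      fix s :: real assume s: "s \<noteq> 0"
      have "(\<Lambda> f (u + s) - \<Lambda> f u) / s - \<Lambda> f' u = (\<Lambda> f (u + s) - \<Lambda> f u - s * \<Lambda> f' u) / s"
        using s by (simp add: field_simps)
      then have "norm ((\<Lambda> f (u + s) - \<Lambda> f u) / s - \<Lambda> f' u) \<le> C * K2 * s\<^sup>2 / \<bar>s\<bar>"
        using key[of s] by (simp add: divide_right_mono)
      also have "\<dots> = C * K2 * \<bar>s\<bar>" using s by (simp add: field_simps power2_eq_square)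
      finally show "norm ((\<Lambda> f (u + s) - \<Lambda> f u) / s - \<Lambda> f' u) \<le> C * K2 * \<bar>s\<bar>" .
    qed
  qed
  then show ?thesis unfolding DERIV_def by (simp add: LIM_zero_iff)
qed

text \<open>What \<open>shift_covariant_derivative\<close> asks of a function and its derivative.\<close>

definition deriv_pair :: "(real \<Rightarrow> real) \<Rightarrow> (real \<Rightarrow> real) \<Rightarrow> bool" where
  "deriv_pair f f' \<longleftrightarrow> (\<exists>K0 K1 K2 f''. bcont K0 f \<and> bcont K1 f' \<and> bcont K2 f'' \<and>
     (\<forall>x. (f has_real_derivative f' x) (at x)) \<and> (\<forall>x. (f' has_real_derivative f'' x) (at x)))"

lemma compose_deriv:
  fixes g :: "real \<Rightarrow> real \<Rightarrow> real"
  assumes "((\<lambda>(x, r). g x r) has_derivative (\<lambda>(h, k). a * h + b * k)) (at (p t, q t))"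
    and "(p has_real_derivative p') (at t)" "(q has_real_derivative q') (at t)"
  shows "((\<lambda>t. g (p t) (q t)) has_real_derivative a * p' + b * q') (at t)"
proof -
  have "((\<lambda>t. (p t, q t)) has_derivative (\<lambda>h. (p' * h, q' * h))) (at t)"
    using has_derivative_Pair[OF assms(2,3)[unfolded has_field_derivative_def]] .
  from has_derivative_compose[OF this assms(1)]
  have "((\<lambda>t. g (p t) (q t)) has_derivative (\<lambda>h. a * (p' * h) + b * (q' * h))) (at t)" by simp
  moreover have "(\<lambda>h. a * (p' * h) + b * (q' * h)) = (*) (a * p' + b * q')"
    by (rule ext) (simp add: distrib_right mult.assoc)
  ultimately show ?thesis by (simp only: has_field_derivative_def)
qed

text \<open>The coordinates \<open>(u, r)\<close>, \<open>(v, r)\<close> and their reflections differ by shears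
  \<open>(v, r) \<mapsto> (v + c r, d r)\<close>.\<close>

lemma compose_deriv_shear:
  fixes g :: "real \<Rightarrow> real \<Rightarrow> real"
  assumes g: "((\<lambda>(x, y). g x y) has_derivative (\<lambda>(h, k). a * h + b * k)) (at (v + c r, d r))"
    and c: "(c has_real_derivative c') (at r)" and d: "(d has_real_derivative d') (at r)"
    and e: "a * c' + b * d' = e"
  shows "((\<lambda>(v, r). g (v + c r) (d r)) has_derivative (\<lambda>(h, l). a * h + e * l)) (at (v, r))"
proof -
  have c1: "((\<lambda>z. c (snd z)) has_derivative (\<lambda>z. c' * snd z)) (at (v, r))"
    by (rule has_derivative_compose[OF has_derivative_snd[OF has_derivative_ident]])
       (use c in \<open>simp add: has_field_derivative_def\<close>)
  have d1: "((\<lambda>z. d (snd z)) has_derivative (\<lambda>z. d' * snd z)) (at (v, r))"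
    by (rule has_derivative_compose[OF has_derivative_snd[OF has_derivative_ident]])
       (use d in \<open>simp add: has_field_derivative_def\<close>)
  have "((\<lambda>z. (fst z + c (snd z), d (snd z))) has_derivative (\<lambda>z. (fst z + c' * snd z, d' * snd z))) (at (v, r))"
    by (intro has_derivative_Pair has_derivative_add has_derivative_fst[OF has_derivative_ident] c1 d1)
  from has_derivative_compose[OF this, of "\<lambda>(x, y). g x y" "\<lambda>(h, k). a * h + b * k"] g
  have "((\<lambda>z. g (fst z + c (snd z)) (d (snd z))) has_derivative
      (\<lambda>z. a * (fst z + c' * snd z) + b * (d' * snd z))) (at (v, r))" by simp
  moreover have "(\<lambda>z :: real \<times> real. a * (fst z + c' * snd z) + b * (d' * snd z)) = (\<lambda>(h, l). a * h + e * l)"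
    by (auto simp: fun_eq_iff e[symmetric] algebra_simps)
  ultimately show ?thesis by (simp add: case_prod_unfold)
qed

section \<open>The tortoise coordinate and the potential\<close>

locale ern = fixes M :: real assumes M_pos: "0 < M"
begin

text \<open>Twice the tortoise coordinate, so that \<open>tort r = v - u\<close>.\<close>

definition tort :: "real \<Rightarrow> real" where "tort r = 2 * rstar M r"
text \<open>The derivative of \<open>tort\<close>, that is, \<open>2 dr\<^sub>* / dr\<close>.\<close>

definition dtort :: "real \<Rightarrow> real" where "dtort r = 2 / Dfun M r"
text \<open>For \<open>\<psi> = \<phi>(u, v) / r\<close> the wave equation is \<open>\<partial>\<^sub>u\<partial>\<^sub>v\<phi> = -V \<phi>\<close> with \<open>V = D D' / (4 r)\<close>, and
  \<open>pot = V * dtort\<close> is the density of \<open>V\<close> with respect to \<open>dr\<close> along a null line.\<close>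

definition pot :: "real \<Rightarrow> real" where "pot r = M * (r - M) / r ^ 4"

lemma Dfun_alt: "0 < r \<Longrightarrow> Dfun M r = (r - M)\<^sup>2 / r\<^sup>2"
  by (simp add: Dfun_def field_simps power2_eq_square)

lemma Dfun_pos: "M < r \<Longrightarrow> 0 < Dfun M r"
  using M_pos by (simp add: Dfun_alt)

lemma Dfun_nonneg: "0 \<le> Dfun M r" by (simp add: Dfun_def)

lemma Dfun_le_one: "M \<le> r \<Longrightarrow> Dfun M r \<le> 1"
  using M_pos by (simp add: Dfun_def abs_le_square_iff[symmetric] power_le_one_iff)

lemma dtort_alt: "M < r \<Longrightarrow> dtort r = 2 * r\<^sup>2 / (r - M)\<^sup>2"
  using M_pos by (simp add: dtort_def Dfun_alt)

lemma dtort_pos: "M < r \<Longrightarrow> 0 < dtort r" by (simp add: dtort_def Dfun_pos)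

lemma Dfun_dtort: "M < r \<Longrightarrow> Dfun M r * dtort r = 2"
  using Dfun_pos[of r] by (simp add: dtort_def)

lemma pot_nonneg: "M \<le> r \<Longrightarrow> 0 \<le> pot r" using M_pos by (simp add: pot_def)

lemma Dfun_deriv: "0 < r \<Longrightarrow> (Dfun M has_real_derivative 2 * r * pot r) (at r)"
  unfolding Dfun_def pot_def
  by (auto intro!: derivative_eq_intros simp: field_simps power2_eq_square power4_eq_xxxx)

lemma tort_deriv: assumes "M < r" shows "(tort has_real_derivative dtort r) (at r)"
proof -
  have p: "r - M \<noteq> 0" "0 < (r - M) / M" "0 < r" using assms M_pos by auto
  have "((\<lambda>r. 2 * (r - M - M\<^sup>2 / (r - M) + 2 * M * ln ((r - M) / M))) has_real_derivative
      2 * (1 + M\<^sup>2 / (r - M)\<^sup>2 + 2 * M / (r - M))) (at r)"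
    using p M_pos by (auto intro!: derivative_eq_intros simp: field_simps power2_eq_square)
  also have "2 * (1 + M\<^sup>2 / (r - M)\<^sup>2 + 2 * M / (r - M)) = 2 * ((r - M)\<^sup>2 + M\<^sup>2 + 2 * M * (r - M)) / (r - M)\<^sup>2"
    using p by (simp add: power2_eq_square add_divide_distrib)
  also have "\<dots> = dtort r"
    by (simp add: dtort_alt assms power2_eq_square algebra_simps)
  finally show ?thesis by (simp add: tort_def[abs_def] rstar_def)
qed

lemma tort_strict_mono: assumes "M < s" "s < r" shows "tort s < tort r"
  by (rule DERIV_pos_imp_increasing[OF assms(2)])
     (use assms tort_deriv dtort_pos in \<open>meson less_le_trans order_less_le_trans\<close>)

lemma tort_mono: "M < s \<Longrightarrow> s \<le> r \<Longrightarrow> tort s \<le> tort r"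
  using tort_strict_mono[of s r] by (cases "s = r") auto

lemma continuous_on_tort: "continuous_on {M<..} tort"
  by (auto intro!: continuous_at_imp_continuous_on DERIV_isCont tort_deriv)

lemma continuous_on_dtort: "continuous_on {M<..} dtort"
  unfolding dtort_def[abs_def] Dfun_def using M_pos by (auto intro!: continuous_intros)

lemma continuous_on_pot: "continuous_on {M..} pot"
  unfolding pot_def[abs_def] using M_pos by (auto intro!: continuous_intros)

text \<open>The static solution \<open>\<psi> = 1\<close> is \<open>\<phi> = r\<close>; integrating the potential against it is exact and gives
  its derivative \<open>D / 2\<close> along \<open>u = const\<close>.\<close>

lemma opint_pot_lin: assumes "M \<le> r"
  shows "opint M (\<lambda>\<rho>. pot \<rho> * (S * (\<rho> / M))) r = S * Dfun M r / (2 * M)"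
proof -
  have "opint M (\<lambda>\<rho>. pot \<rho> * (S * (\<rho> / M))) r = S * Dfun M r / (2 * M) - S * Dfun M M / (2 * M)"
  proof (rule opint_FTC)
    show "((\<lambda>r. S * Dfun M r / (2 * M)) has_real_derivative pot x * (S * (x / M))) (at x)" if "M \<le> x" for x
      using that M_pos by (auto intro!: derivative_eq_intros Dfun_deriv)
    show "continuous_on {M..r} (\<lambda>\<rho>. pot \<rho> * (S * (\<rho> / M)))"
      using M_pos by (auto intro!: continuous_intros continuous_on_subset[OF continuous_on_pot])
  qed (use assms in auto)
  then show ?thesis using M_pos by (simp add: Dfun_def)
qed

text \<open>The integrand is \<open>C / (2 M\<^sup>2)\<close> times the derivative of \<open>\<rho> D(\<rho>)\<close>, up to the positive term
  \<open>D\<close>. The factor two that \<open>r\<^sup>2\<close> gains over \<open>r\<close> here is what makes the iteration contract.\<close>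

lemma opint_pot_quad: assumes "M \<le> r" "0 \<le> C"
  shows "opint M (\<lambda>\<rho>. pot \<rho> * (C * (\<rho> / M)\<^sup>2)) r \<le> C * r * Dfun M r / (2 * M\<^sup>2)"
proof -
  let ?g = "\<lambda>\<rho>. C * (Dfun M \<rho> + \<rho> * (2 * \<rho> * pot \<rho>)) / (2 * M\<^sup>2)"
  have Dc: "continuous_on {M..r} (Dfun M)"
    unfolding Dfun_def using M_pos by (auto intro!: continuous_intros)
  have gc: "continuous_on {M..r} ?g"
    using M_pos by (auto intro!: continuous_intros continuous_on_subset[OF continuous_on_pot] Dc)
  have "opint M ?g r = C * r * Dfun M r / (2 * M\<^sup>2) - C * M * Dfun M M / (2 * M\<^sup>2)"
  proof (rule opint_FTC)
    show "((\<lambda>r. C * r * Dfun M r / (2 * M\<^sup>2)) has_real_derivative ?g x) (at x)" if "M \<le> x" for x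
      using that M_pos by (auto intro!: derivative_eq_intros Dfun_deriv simp: field_simps)
  qed (use assms gc in auto)
  moreover have "opint M (\<lambda>\<rho>. pot \<rho> * (C * (\<rho> / M)\<^sup>2)) r \<le> opint M ?g r"
  proof (rule opint_mono)
    show "set_integrable lborel {M<..<r} ?g"
      by (rule set_integrable_subset[OF borel_integrable_atLeastAtMost'[OF gc]]) auto
    show "set_integrable lborel {M<..<r} (\<lambda>\<rho>. pot \<rho> * (C * (\<rho> / M)\<^sup>2))"
      by (rule set_integrable_subset[OF borel_integrable_atLeastAtMost'[of M r]])
         (use M_pos in \<open>auto intro!: continuous_intros continuous_on_subset[OF continuous_on_pot]\<close>)
    fix x assume "M < x" "x < r"
    have "0 \<le> C * Dfun M x / (2 * M\<^sup>2)" using assms Dfun_nonneg by simp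
    then show "pot x * (C * (x / M)\<^sup>2) \<le> ?g x"
      using M_pos by (simp add: field_simps power2_eq_square)
  qed
  ultimately show ?thesis using M_pos by (simp add: Dfun_def)
qed

section \<open>The sideways integral operators\<close>

text \<open>The equation \<open>\<partial>\<^sub>u\<partial>\<^sub>v\<phi> = -V \<phi>\<close> is solved sideways, in the direction of increasing \<open>r\<close>: \<open>Bop\<close>
  integrates \<open>V \<phi>\<close> along the line \<open>v = const\<close> from the horizon, where \<open>\<phi>\<close> vanishes, and \<open>Aop\<close>
  integrates the resulting \<open>\<partial>\<^sub>v\<phi>\<close> along \<open>u = const\<close>. Functions are written in \<open>(u, r)\<close>.\<close>

definition Bop :: "(real \<Rightarrow> real \<Rightarrow> real) \<Rightarrow> real \<Rightarrow> real \<Rightarrow> real" where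
  "Bop w u r = opint M (\<lambda>\<rho>. pot \<rho> * w (u + tort r - tort \<rho>) \<rho>) r"

definition Aop :: "(real \<Rightarrow> real \<Rightarrow> real) \<Rightarrow> real \<Rightarrow> real \<Rightarrow> real" where
  "Aop w u r = opint M (\<lambda>\<rho>. dtort \<rho> * Bop w u \<rho>) r"

text \<open>The weight is \<open>r\<^sup>2\<close> although solutions only grow like \<open>r\<close>: with the weight \<open>r\<close> the operator
  \<open>Aop\<close> is not a contraction.\<close>

definition quad_bdd :: "real \<Rightarrow> (real \<Rightarrow> real \<Rightarrow> real) \<Rightarrow> bool" where
  "quad_bdd C w \<longleftrightarrow> continuous_on (UNIV \<times> {M<..}) (\<lambda>(u, r). w u r) \<and>
     (\<forall>u. \<forall>r>M. \<bar>w u r\<bar> \<le> C * (r / M)\<^sup>2)"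

lemma quad_bddD: "quad_bdd C w \<Longrightarrow> continuous_on (UNIV \<times> {M<..}) (\<lambda>(u, r). w u r)"
  "quad_bdd C w \<Longrightarrow> M < r \<Longrightarrow> \<bar>w u r\<bar> \<le> C * (r / M)\<^sup>2"
  by (auto simp: quad_bdd_def)

lemma quad_bdd_nonneg: assumes "quad_bdd C w" shows "0 \<le> C"
proof -
  have "0 \<le> C * ((M + 1) / M)\<^sup>2" using quad_bddD(2)[OF assms, of "M + 1" 0] by linarith
  then show ?thesis using M_pos by (simp add: zero_le_mult_iff)
qed

lemma quad_bdd_lincomb:
  assumes "quad_bdd C w" "quad_bdd C' w'"
  shows "quad_bdd (\<bar>\<alpha>\<bar> * C + \<bar>\<beta>\<bar> * C') (\<lambda>u r. \<alpha> * w u r + \<beta> * w' u r)"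
  unfolding quad_bdd_def
proof (intro conjI allI impI)
  show "continuous_on (UNIV \<times> {M<..}) (\<lambda>(u, r). \<alpha> * w u r + \<beta> * w' u r)"
    using quad_bddD(1)[OF assms(1)] quad_bddD(1)[OF assms(2)] by (auto simp: case_prod_beta intro!: continuous_intros)
  fix u r assume "M < r"
  then have "\<bar>\<alpha> * w u r\<bar> \<le> \<bar>\<alpha>\<bar> * (C * (r / M)\<^sup>2)" "\<bar>\<beta> * w' u r\<bar> \<le> \<bar>\<beta>\<bar> * (C' * (r / M)\<^sup>2)"
    using quad_bddD(2)[OF assms(1)] quad_bddD(2)[OF assms(2)] by (auto simp only: abs_mult intro!: mult_left_mono)
  then show "\<bar>\<alpha> * w u r + \<beta> * w' u r\<bar> \<le> (\<bar>\<alpha>\<bar> * C + \<bar>\<beta>\<bar> * C') * (r / M)\<^sup>2"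
    by (simp add: algebra_simps)
qed

lemma quad_bdd_shift:
  assumes "quad_bdd C w" shows "quad_bdd C (\<lambda>u r. w (u + s) r)"
  unfolding quad_bdd_def
proof (intro conjI allI impI)
  have "continuous_on (UNIV \<times> {M<..}) (\<lambda>z. (\<lambda>(u, r). w u r) (fst z + s, snd z))"
    by (rule continuous_on_compose2[OF quad_bddD(1)[OF assms]]) (auto intro!: continuous_intros)
  then show "continuous_on (UNIV \<times> {M<..}) (\<lambda>(u, r). w (u + s) r)" by (simp add: case_prod_beta)
qed (use quad_bddD(2)[OF assms] in auto)

lemma cont_shear:
  assumes w: "continuous_on (UNIV \<times> {M<..}) (\<lambda>(u, r). w u r)"
  shows "continuous_on (UNIV \<times> {M<..}) (\<lambda>(v, r). w (v - tort r) r)"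
    "continuous_on (UNIV \<times> {M<..}) (\<lambda>(u, r). w (u + tort r) r)"
proof -
  have t: "continuous_on (UNIV \<times> {M<..}) (\<lambda>z :: real \<times> real. tort (snd z))"
    by (rule continuous_on_compose2[OF continuous_on_tort]) (auto intro!: continuous_intros)
  have "continuous_on (UNIV \<times> {M<..}) (\<lambda>z. (\<lambda>(u, r). w u r) (fst z - tort (snd z), snd z))"
    by (rule continuous_on_compose2[OF w]) (auto intro!: continuous_intros t)
  then show "continuous_on (UNIV \<times> {M<..}) (\<lambda>(v, r). w (v - tort r) r)" by (simp add: case_prod_beta)
  have "continuous_on (UNIV \<times> {M<..}) (\<lambda>z. (\<lambda>(u, r). w u r) (fst z + tort (snd z), snd z))"
    by (rule continuous_on_compose2[OF w]) (auto intro!: continuous_intros t)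
  then show "continuous_on (UNIV \<times> {M<..}) (\<lambda>(u, r). w (u + tort r) r)" by (simp add: case_prod_beta)
qed

lemma cont_slice:
  assumes "continuous_on (UNIV \<times> {M<..}) (\<lambda>(u, r). w u r)"
  shows "continuous_on {M<..} (w u)"
proof -
  have "continuous_on {M<..} (\<lambda>r. (\<lambda>(u, r). w u r) (u, r))"
    by (rule continuous_on_compose2[OF assms]) (auto intro!: continuous_intros)
  then show ?thesis by simp
qed

lemma cont_mult_slice:
  fixes w :: "real \<Rightarrow> real \<Rightarrow> real"
  assumes "continuous_on (UNIV \<times> {M<..}) (\<lambda>(u, r). w u r)" "continuous_on {M<..} k"
  shows "continuous_on (UNIV \<times> {M<..}) (\<lambda>(u, r). k r * w u r)"
proof -
  have "continuous_on (UNIV \<times> {M<..}) (\<lambda>z :: real \<times> real. k (snd z))"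
    by (rule continuous_on_compose2[OF assms(2)]) (auto intro!: continuous_intros)
  from continuous_on_mult[OF this assms(1)] show ?thesis by (simp add: case_prod_beta)
qed

lemma pot_integrand:
  assumes "quad_bdd C w"
  shows "continuous_on (UNIV \<times> {M<..}) (\<lambda>(v, \<rho>). pot \<rho> * w (v - tort \<rho>) \<rho>)"
    and "M < \<rho> \<Longrightarrow> \<bar>pot \<rho> * w (v - tort \<rho>) \<rho>\<bar> \<le> pot \<rho> * (C * (\<rho> / M)\<^sup>2)"
    and "continuous_on {M..} (\<lambda>\<rho>. pot \<rho> * (C * (\<rho> / M)\<^sup>2))"
    and "set_integrable lborel {M<..<r} (\<lambda>\<rho>. pot \<rho> * w (v - tort \<rho>) \<rho>)"
    and "set_integrable lborel {M<..<r} (\<lambda>\<rho>. pot \<rho> * (C * (\<rho> / M)\<^sup>2))"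
proof -
  show c: "continuous_on (UNIV \<times> {M<..}) (\<lambda>(v, \<rho>). pot \<rho> * w (v - tort \<rho>) \<rho>)"
    by (rule cont_mult_slice[OF cont_shear(1)[OF quad_bddD(1)[OF assms]] continuous_on_subset[OF continuous_on_pot]]) auto
  show b: "\<bar>pot \<rho> * w (v - tort \<rho>) \<rho>\<bar> \<le> pot \<rho> * (C * (\<rho> / M)\<^sup>2)" if "M < \<rho>" for \<rho> v
    using quad_bddD(2)[OF assms that] pot_nonneg[of \<rho>] that by (auto simp: abs_mult intro!: mult_left_mono)
  show k: "continuous_on {M..} (\<lambda>\<rho>. pot \<rho> * (C * (\<rho> / M)\<^sup>2))"
    using M_pos by (auto intro!: continuous_intros continuous_on_pot)
  show "set_integrable lborel {M<..<r} (\<lambda>\<rho>. pot \<rho> * w (v - tort \<rho>) \<rho>)"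
    by (rule opint_integrable[OF cont_slice[OF c] b k])
  show "set_integrable lborel {M<..<r} (\<lambda>\<rho>. pot \<rho> * (C * (\<rho> / M)\<^sup>2))"
    by (rule opint_integrable[OF continuous_on_subset[OF k] _ k])
       (use quad_bdd_nonneg[OF assms] pot_nonneg in auto)
qed

lemma pot_lin_integrable: "set_integrable lborel {M<..<r} (\<lambda>\<rho>. pot \<rho> * (S * (\<rho> / M)))"
  by (rule set_integrable_subset[OF borel_integrable_atLeastAtMost'[of M r]])
     (use M_pos in \<open>auto intro!: continuous_intros continuous_on_subset[OF continuous_on_pot]\<close>)

lemma Bop_cont:
  assumes "quad_bdd C w"
  shows "continuous_on (UNIV \<times> {M<..}) (\<lambda>(u, r). Bop w u r)"
    and "continuous_on (UNIV \<times> {M<..}) (\<lambda>(v, r). Bop w (v - tort r) r)"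
proof -
  have *: "continuous_on (UNIV \<times> {M<..}) (\<lambda>(v, r). opint M (\<lambda>\<rho>. pot \<rho> * w (v - tort \<rho>) \<rho>) r)"
    by (rule opint_continuous_param[OF pot_integrand(1-3)[OF assms]])
  from cont_shear(2)[OF this] show "continuous_on (UNIV \<times> {M<..}) (\<lambda>(u, r). Bop w u r)"
    by (simp add: Bop_def)
  from * show "continuous_on (UNIV \<times> {M<..}) (\<lambda>(v, r). Bop w (v - tort r) r)"
    by (simp add: Bop_def)
qed

lemma Bop_deriv_v:
  assumes "quad_bdd C w" "M < r"
  shows "((\<lambda>r. Bop w (v - tort r) r) has_real_derivative pot r * w (v - tort r) r) (at r)"
  using opint_has_derivative[OF pot_integrand(4)[OF assms(1)] cont_slice[OF pot_integrand(1)[OF assms(1)]] assms(2), of v]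
  by (simp add: Bop_def[abs_def])

text \<open>Since \<open>tort\<close> increases, only times \<open>t \<ge> u\<close> enter: the domain of dependence of \<open>(u, r)\<close> lies
  to the future in \<open>u\<close>.\<close>

lemma Bop_bound_lin:
  assumes "quad_bdd C w" "M < r" and S: "\<And>t \<rho>. u \<le> t \<Longrightarrow> M < \<rho> \<Longrightarrow> \<bar>w t \<rho>\<bar> \<le> S * (\<rho> / M)"
  shows "\<bar>Bop w u r\<bar> \<le> S * Dfun M r / (2 * M)"
proof -
  have "\<bar>Bop w u r\<bar> \<le> opint M (\<lambda>\<rho>. pot \<rho> * (S * (\<rho> / M))) r"
    unfolding Bop_def
  proof (rule opint_abs_le[OF pot_integrand(4)[OF assms(1)] pot_lin_integrable])
    fix x assume "M < x" "x < r"
    then show "\<bar>pot x * w (u + tort r - tort x) x\<bar> \<le> pot x * (S * (x / M))"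
      using mult_left_mono[OF S[of "u + tort r - tort x" x] pot_nonneg[of x]] pot_nonneg[of x] tort_mono[of x r]
      by (auto simp: abs_mult)
  qed
  then show ?thesis using opint_pot_lin[of r S] assms(2) by simp
qed

lemma Bop_bound_quad:
  assumes "quad_bdd C w" "M < r"
  shows "\<bar>Bop w u r\<bar> \<le> C * r * Dfun M r / (2 * M\<^sup>2)"
proof -
  have "\<bar>Bop w u r\<bar> \<le> opint M (\<lambda>\<rho>. pot \<rho> * (C * (\<rho> / M)\<^sup>2)) r"
    unfolding Bop_def
    by (rule opint_abs_le[OF pot_integrand(4)[OF assms(1)] pot_integrand(5)[OF assms(1)] pot_integrand(2)[OF assms(1)]])
  with opint_pot_quad[of r C] quad_bdd_nonneg[OF assms(1)] assms(2) show ?thesis by simp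
qed

lemma Bop_lincomb:
  assumes "quad_bdd C w" "quad_bdd C' w'"
  shows "Bop (\<lambda>u r. \<alpha> * w u r + \<beta> * w' u r) u r = \<alpha> * Bop w u r + \<beta> * Bop w' u r"
  unfolding Bop_def
  by (subst opint_linear[OF pot_integrand(4)[OF assms(1)] pot_integrand(4)[OF assms(2)], symmetric])
     (simp add: algebra_simps)

lemma Bop_shift: "Bop (\<lambda>u r. w (u + s) r) u r = Bop w (u + s) r"
  by (simp add: Bop_def algebra_simps)

lemma Bop_nonneg:
  assumes "M < r" "\<And>t \<rho>. u \<le> t \<Longrightarrow> M < \<rho> \<Longrightarrow> 0 \<le> w t \<rho>"
  shows "0 \<le> Bop w u r"
  unfolding Bop_def
proof (rule opint_nonneg)
  fix x assume "M < x" "x < r"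
  then show "0 \<le> pot x * w (u + tort r - tort x) x"
    using assms(2)[of "u + tort r - tort x" x] pot_nonneg[of x] tort_mono[of x r] by auto
qed

lemma Bop_cong: "(\<And>u r. M < r \<Longrightarrow> w u r = w' u r) \<Longrightarrow> Bop w u r = Bop w' u r"
  unfolding Bop_def by (rule opint_cong) simp

lemma dtort_integrand:
  assumes "quad_bdd C w"
  shows "continuous_on (UNIV \<times> {M<..}) (\<lambda>(u, \<rho>). dtort \<rho> * Bop w u \<rho>)"
    and "M < \<rho> \<Longrightarrow> \<bar>dtort \<rho> * Bop w u \<rho>\<bar> \<le> C * \<rho> / M\<^sup>2"
    and "continuous_on {M..} (\<lambda>\<rho>. C * \<rho> / M\<^sup>2)"
    and "set_integrable lborel {M<..<r} (\<lambda>\<rho>. dtort \<rho> * Bop w u \<rho>)"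
    and "set_integrable lborel {M<..<r} (\<lambda>\<rho>. C * \<rho> / M\<^sup>2)"
proof -
  show c: "continuous_on (UNIV \<times> {M<..}) (\<lambda>(u, \<rho>). dtort \<rho> * Bop w u \<rho>)"
    by (rule cont_mult_slice[OF Bop_cont(1)[OF assms] continuous_on_dtort])
  show b: "\<bar>dtort \<rho> * Bop w u \<rho>\<bar> \<le> C * \<rho> / M\<^sup>2" if \<rho>: "M < \<rho>" for \<rho> u
  proof -
    have "\<bar>dtort \<rho> * Bop w u \<rho>\<bar> \<le> dtort \<rho> * (C * \<rho> * Dfun M \<rho> / (2 * M\<^sup>2))"
      using mult_left_mono[OF Bop_bound_quad[OF assms \<rho>, of u] less_imp_le[OF dtort_pos[OF \<rho>]]]
        dtort_pos[OF \<rho>] by (simp add: abs_mult)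
    also have "\<dots> = (Dfun M \<rho> * dtort \<rho>) * (C * \<rho>) / (2 * M\<^sup>2)" by simp
    finally show ?thesis by (simp add: Dfun_dtort[OF \<rho>])
  qed
  show k: "continuous_on {M..} (\<lambda>\<rho>. C * \<rho> / M\<^sup>2)"
    using M_pos by (auto intro!: continuous_intros)
  show "set_integrable lborel {M<..<r} (\<lambda>\<rho>. dtort \<rho> * Bop w u \<rho>)"
    by (rule opint_integrable[OF cont_slice[OF c] b k])
  show "set_integrable lborel {M<..<r} (\<lambda>\<rho>. C * \<rho> / M\<^sup>2)"
    by (rule set_integrable_subset[OF borel_integrable_atLeastAtMost'[of M r]])
       (auto intro!: continuous_on_subset[OF k])
qed

lemma Aop_bound_lin:
  assumes "quad_bdd C w" "M < r" and S: "\<And>t \<rho>. u \<le> t \<Longrightarrow> M < \<rho> \<Longrightarrow> \<bar>w t \<rho>\<bar> \<le> S * (\<rho> / M)"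
  shows "\<bar>Aop w u r\<bar> \<le> S * (r - M) / M"
proof -
  have "\<bar>Aop w u r\<bar> \<le> opint M (\<lambda>_. S / M) r"
    unfolding Aop_def
  proof (rule opint_abs_le[OF dtort_integrand(4)[OF assms(1)]])
    show "set_integrable lborel {M<..<r} (\<lambda>_. S / M)"
      by (rule set_integrable_subset[OF borel_integrable_atLeastAtMost'[of M r]]) auto
    fix x assume x: "M < x" "x < r"
    have "\<bar>dtort x * Bop w u x\<bar> \<le> dtort x * (S * Dfun M x / (2 * M))"
      using mult_left_mono[OF Bop_bound_lin[OF assms(1) x(1) S] less_imp_le[OF dtort_pos[OF x(1)]]]
        dtort_pos[OF x(1)] by (simp add: abs_mult)
    also have "\<dots> = (Dfun M x * dtort x) * S / (2 * M)" by simp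
    finally show "\<bar>dtort x * Bop w u x\<bar> \<le> S / M" by (simp add: Dfun_dtort[OF x(1)])
  qed
  also have "opint M (\<lambda>_. S / M) r = S / M * r - S / M * M"
    by (rule opint_FTC) (use assms(2) M_pos in \<open>auto intro!: derivative_eq_intros\<close>)
  finally show ?thesis using M_pos by (simp add: field_simps)
qed

text \<open>The contraction: in the norm weighted by \<open>r\<^sup>2\<close> the operator \<open>Aop\<close> has norm at most one half.\<close>

lemma quad_bdd_Aop:
  assumes "quad_bdd C w" shows "quad_bdd (C / 2) (Aop w)"
  unfolding quad_bdd_def
proof (intro conjI allI impI)
  show "continuous_on (UNIV \<times> {M<..}) (\<lambda>(u, r). Aop w u r)"
    unfolding Aop_def by (rule opint_continuous_param[OF dtort_integrand(1-3)[OF assms]])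
  fix u r assume r: "M < r"
  have "\<bar>Aop w u r\<bar> \<le> opint M (\<lambda>\<rho>. C * \<rho> / M\<^sup>2) r"
    unfolding Aop_def
    by (rule opint_abs_le[OF dtort_integrand(4)[OF assms] dtort_integrand(5)[OF assms] dtort_integrand(2)[OF assms]])
  also have "opint M (\<lambda>\<rho>. C * \<rho> / M\<^sup>2) r = C * r\<^sup>2 / (2 * M\<^sup>2) - C * M\<^sup>2 / (2 * M\<^sup>2)"
    by (rule opint_FTC) (use r M_pos in \<open>auto intro!: derivative_eq_intros continuous_intros simp: power4_eq_xxxx power2_eq_square\<close>)
  also have "\<dots> \<le> C / 2 * (r / M)\<^sup>2"
    using quad_bdd_nonneg[OF assms] M_pos by (simp add: field_simps)
  finally show "\<bar>Aop w u r\<bar> \<le> C / 2 * (r / M)\<^sup>2" .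
qed

lemma Aop_deriv:
  assumes "quad_bdd C w" "M < r"
  shows "(Aop w u has_real_derivative dtort r * Bop w u r) (at r)"
  unfolding Aop_def[abs_def]
  by (rule opint_has_derivative[OF dtort_integrand(4)[OF assms(1)] cont_slice[OF dtort_integrand(1)[OF assms(1)]] assms(2)])

lemma Aop_lincomb:
  assumes "quad_bdd C w" "quad_bdd C' w'"
  shows "Aop (\<lambda>u r. \<alpha> * w u r + \<beta> * w' u r) u r = \<alpha> * Aop w u r + \<beta> * Aop w' u r"
  unfolding Aop_def
  by (subst opint_linear[OF dtort_integrand(4)[OF assms(1)] dtort_integrand(4)[OF assms(2)], symmetric])
     (simp add: Bop_lincomb[OF assms] algebra_simps)

lemma Aop_shift: "Aop (\<lambda>u r. w (u + s) r) u r = Aop w (u + s) r"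
  by (simp add: Aop_def Bop_shift)

lemma Aop_nonneg:
  assumes "\<And>t \<rho>. u \<le> t \<Longrightarrow> M < \<rho> \<Longrightarrow> 0 \<le> w t \<rho>"
  shows "0 \<le> Aop w u r"
  unfolding Aop_def
  by (rule opint_nonneg, rule mult_nonneg_nonneg[OF less_imp_le[OF dtort_pos] Bop_nonneg])
     (use assms in auto)

section \<open>The solution operator\<close>

primrec iter :: "(real \<Rightarrow> real) \<Rightarrow> nat \<Rightarrow> real \<Rightarrow> real \<Rightarrow> real" where
  "iter f 0 = (\<lambda>u r. 0)"
| "iter f (Suc n) = (\<lambda>u r. f u + Aop (iter f n) u r)"

text \<open>The solution that vanishes on the future horizon \<open>u = \<infinity>\<close> and equals \<open>f(u)\<close> on the past horizon
  \<open>v = -\<infinity>\<close>, as the limit of the Picard iterates of \<open>w = f + Aop w\<close>.\<close>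

definition sol :: "(real \<Rightarrow> real) \<Rightarrow> real \<Rightarrow> real \<Rightarrow> real" where
  "sol f u r = lim (\<lambda>n. iter f n u r)"

lemma ratio_ge_one: "M < r \<Longrightarrow> 1 \<le> r / M" "M < r \<Longrightarrow> 1 \<le> (r / M)\<^sup>2"
  using M_pos by (auto simp: field_simps)

lemma quad_bdd_bcont: assumes "bcont K f" shows "quad_bdd K (\<lambda>u r. f u)"
  unfolding quad_bdd_def
proof (intro conjI allI impI)
  show "continuous_on (UNIV \<times> {M<..}) (\<lambda>(u, r). f u)"
    using continuous_on_compose2[OF bcontD(1)[OF assms] continuous_on_fst[OF continuous_on_id]]
    by (simp add: case_prod_beta)
  fix u r assume "M < r"
  have "K * 1 \<le> K * (r / M)\<^sup>2"
    using bcontD(3)[OF assms] ratio_ge_one(2)[OF \<open>M < r\<close>] by (rule mult_left_mono[rotated])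
  then show "\<bar>f u\<bar> \<le> K * (r / M)\<^sup>2" using bcontD(2)[OF assms, of u] by simp
qed

lemma iter_quad_bdd: assumes "bcont K f" shows "quad_bdd (2 * K) (iter f n)"
proof (induction n)
  case 0 then show ?case using bcontD(3)[OF assms] by (simp add: quad_bdd_def case_prod_beta)
next
  case (Suc n)
  from quad_bdd_lincomb[OF quad_bdd_bcont[OF assms] quad_bdd_Aop[OF Suc], of 1 1] show ?case by simp
qed

text \<open>\<open>S * (r / M)\<close> is a fixed point of \<open>w \<mapsto> S + Aop w\<close>, so the bound is preserved exactly by the
  iteration. Only the values of \<open>f\<close> on \<open>[u, \<infinity>)\<close> count.\<close>

lemma iter_bound:
  assumes f: "bcont K f" and S: "\<And>t. u \<le> t \<Longrightarrow> \<bar>f t\<bar> \<le> S"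
  shows "u \<le> t \<Longrightarrow> M < r \<Longrightarrow> \<bar>iter f n t r\<bar> \<le> S * (r / M)"
proof (induction n arbitrary: t r)
  case 0
  have "0 \<le> S" using S[of u] by simp
  then show ?case using 0 M_pos by simp
next
  case (Suc n)
  have "\<bar>Aop (iter f n) t r\<bar> \<le> S * (r - M) / M"
    by (rule Aop_bound_lin[OF iter_quad_bdd[OF f] Suc.prems(2)]) (use Suc in auto)
  moreover have "\<bar>f t\<bar> \<le> S" using S Suc.prems by simp
  ultimately have "\<bar>iter f (Suc n) t r\<bar> \<le> S + S * (r - M) / M" by simp
  also have "\<dots> = S * (r / M)" using M_pos by (simp add: field_simps)
  finally show ?case .
qed

lemma iter_diff:
  assumes f: "bcont K f"
  shows "quad_bdd (K / 2 ^ n) (\<lambda>u r. iter f (Suc n) u r - iter f n u r)"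
proof (induction n)
  case 0
  have "Aop (\<lambda>u r. 0) u r = 0" for u r
    by (simp add: Aop_def Bop_def opint_def set_lebesgue_integral_def)
  then show ?case using quad_bdd_bcont[OF f] by simp
next
  case (Suc n)
  have "iter f (Suc (Suc n)) u r - iter f (Suc n) u r
      = Aop (\<lambda>u r. iter f (Suc n) u r - iter f n u r) u r" for u r
    using Aop_lincomb[OF iter_quad_bdd[OF f, of "Suc n"] iter_quad_bdd[OF f, of n], of 1 "-1" u r] by simp
  with quad_bdd_Aop[OF Suc] show ?case by (simp add: mult.commute)
qed

lemma iter_tail:
  assumes f: "bcont K f" and r: "M < r"
  shows "n \<le> m \<Longrightarrow> \<bar>iter f m u r - iter f n u r\<bar> \<le> (2 * K / 2 ^ n - 2 * K / 2 ^ m) * (r / M)\<^sup>2"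
proof (induction m rule: dec_induct)
  case base then show ?case by simp
next
  case (step m)
  have "\<bar>iter f (Suc m) u r - iter f m u r\<bar> \<le> K / 2 ^ m * (r / M)\<^sup>2"
    using quad_bddD(2)[OF iter_diff[OF f] r] .
  with step have "\<bar>iter f (Suc m) u r - iter f n u r\<bar>
      \<le> (2 * K / 2 ^ n - 2 * K / 2 ^ m) * (r / M)\<^sup>2 + K / 2 ^ m * (r / M)\<^sup>2" by linarith
  also have "\<dots> = (2 * K / 2 ^ n - 2 * K / 2 ^ Suc m) * (r / M)\<^sup>2"
  proof -
    have "2 * K / 2 ^ m = 2 * (K / 2 ^ m)" "2 * K / 2 ^ Suc m = K / 2 ^ m" by simp_all
    then show ?thesis by (simp only: left_diff_distrib)
  qed
  finally show ?case .
qed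

lemma sol_lim:
  assumes f: "bcont K f" and r: "M < r"
  shows "(\<lambda>n. iter f n u r) \<longlonglongrightarrow> sol f u r"
proof -
  have "summable (\<lambda>n. iter f (Suc n) u r - iter f n u r)"
  proof (rule summable_comparison_test')
    show "summable (\<lambda>n. K * (r / M)\<^sup>2 * (1 / 2) ^ n)"
      by (intro summable_mult summable_geometric) simp
    fix n :: nat
    show "norm (iter f (Suc n) u r - iter f n u r) \<le> K * (r / M)\<^sup>2 * (1 / 2) ^ n"
      using quad_bddD(2)[OF iter_diff[OF f] r, of n u] by (simp add: power_divide field_simps)
  qed
  then have "convergent (\<lambda>n. \<Sum>i<n. iter f (Suc i) u r - iter f i u r)"
    by (simp add: summable_iff_convergent)
  moreover have "(\<Sum>i<n. iter f (Suc i) u r - iter f i u r) = iter f n u r" for n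
    using sum_lessThan_telescope[of "\<lambda>i. iter f i u r" n] by simp
  ultimately show ?thesis unfolding sol_def by (simp add: convergent_LIMSEQ_iff)
qed

lemma sol_tail:
  assumes f: "bcont K f" and r: "M < r"
  shows "\<bar>sol f u r - iter f n u r\<bar> \<le> 2 * K / 2 ^ n * (r / M)\<^sup>2"
proof (rule LIMSEQ_le_const2)
  show "(\<lambda>m. \<bar>iter f m u r - iter f n u r\<bar>) \<longlonglongrightarrow> \<bar>sol f u r - iter f n u r\<bar>"
    by (intro tendsto_intros sol_lim[OF f r])
  have "\<bar>iter f m u r - iter f n u r\<bar> \<le> 2 * K / 2 ^ n * (r / M)\<^sup>2" if "n \<le> m" for m
  proof -
    have "0 \<le> 2 * K / 2 ^ m * (r / M)\<^sup>2" using bcontD(3)[OF f] by simp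
    with iter_tail[OF f r that, of u] show ?thesis by (simp add: algebra_simps)
  qed
  then show "\<exists>N. \<forall>m\<ge>N. \<bar>iter f m u r - iter f n u r\<bar> \<le> 2 * K / 2 ^ n * (r / M)\<^sup>2" by blast
qed

lemma sol_bound:
  assumes f: "bcont K f" and S: "\<And>t. u \<le> t \<Longrightarrow> \<bar>f t\<bar> \<le> S" and "u \<le> t" "M < r"
  shows "\<bar>sol f t r\<bar> \<le> S * (r / M)"
proof (rule LIMSEQ_le_const2)
  show "(\<lambda>n. \<bar>iter f n t r\<bar>) \<longlonglongrightarrow> \<bar>sol f t r\<bar>"
    by (intro tendsto_intros sol_lim[OF f assms(4)])
qed (use iter_bound[OF f S] assms in blast)

lemma sol_quad_bdd: assumes f: "bcont K f" shows "quad_bdd (2 * K) (sol f)"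
  unfolding quad_bdd_def
proof (intro conjI allI impI)
  have "continuous_on (UNIV \<times> {M<..<R}) (\<lambda>(u, r). sol f u r)" for R
  proof (rule uniform_limit_theorem[OF always_eventually, where f = "\<lambda>n (u, r). iter f n u r" and F = sequentially])
    show "\<forall>n. continuous_on (UNIV \<times> {M<..<R}) (\<lambda>(u, r). iter f n u r)"
      by (intro allI continuous_on_subset[OF quad_bddD(1)[OF iter_quad_bdd[OF f]]]) auto
    show "uniform_limit (UNIV \<times> {M<..<R}) (\<lambda>n (u, r). iter f n u r) (\<lambda>(u, r). sol f u r) sequentially"
    proof (rule uniform_limitI)
      fix e :: real assume e: "0 < e"
      have "(\<lambda>n. 2 * K * (R / M)\<^sup>2 * (1 / 2) ^ n) \<longlonglongrightarrow> 2 * K * (R / M)\<^sup>2 * 0"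
        by (intro tendsto_intros LIMSEQ_realpow_zero) auto
      then have "eventually (\<lambda>n. 2 * K * (R / M)\<^sup>2 * (1 / 2) ^ n < e) sequentially"
        using e by (auto dest: order_tendstoD)
      then show "\<forall>\<^sub>F n in sequentially. \<forall>x\<in>UNIV \<times> {M<..<R}.
          dist (case x of (u, r) \<Rightarrow> iter f n u r) (case x of (u, r) \<Rightarrow> sol f u r) < e"
      proof eventually_elim
        case (elim n)
        have "dist (iter f n u r) (sol f u r) < e" if r: "M < r" "r < R" for u r
        proof -
          have "(r / M)\<^sup>2 \<le> (R / M)\<^sup>2" using r M_pos by (intro power_mono divide_right_mono) auto
          then have "2 * K / 2 ^ n * (r / M)\<^sup>2 \<le> 2 * K / 2 ^ n * (R / M)\<^sup>2"
            using bcontD(3)[OF f] by (intro mult_left_mono) auto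
          then show ?thesis using sol_tail[OF f r(1), of u n] elim
            by (simp add: dist_real_def abs_minus_commute power_one_over field_simps)
        qed
        then show ?case by auto
      qed
    qed
  qed auto
  then have "continuous_on (\<Union>R\<in>UNIV. UNIV \<times> {M<..<R}) (\<lambda>(u, r). sol f u r)"
    by (intro continuous_on_open_UN) (auto intro!: open_Times)
  moreover have "UNIV \<times> {M<..} \<subseteq> (\<Union>R\<in>UNIV. UNIV \<times> {M<..<R})"
  proof clarsimp
    fix b :: real assume "M < b" then show "\<exists>x. b < x" by (rule_tac gt_ex)
  qed
  ultimately show "continuous_on (UNIV \<times> {M<..}) (\<lambda>(u, r). sol f u r)"
    by (rule continuous_on_subset)
  fix u r assume r: "M < r"
  show "\<bar>sol f u r\<bar> \<le> 2 * K * (r / M)\<^sup>2" using sol_tail[OF f r, of u 0] by simp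
qed

lemma sol_eq:
  assumes f: "bcont K f" and r: "M < r"
  shows "sol f u r = f u + Aop (sol f) u r"
proof -
  have "(\<lambda>n. Aop (iter f n) u r) \<longlonglongrightarrow> Aop (sol f) u r"
  proof (rule LIM_zero_cancel, rule Lim_null_comparison)
    show "(\<lambda>n. K * (r / M)\<^sup>2 * (1 / 2) ^ n) \<longlonglongrightarrow> 0"
      by (intro tendsto_mult_right_zero LIMSEQ_realpow_zero) auto
    have "norm (Aop (iter f n) u r - Aop (sol f) u r) \<le> K * (r / M)\<^sup>2 * (1 / 2) ^ n" for n
    proof -
      let ?w = "\<lambda>u r. 1 * iter f n u r + (-1) * sol f u r"
      have "quad_bdd (2 * K / 2 ^ n) ?w"
        using quad_bdd_lincomb[OF iter_quad_bdd[OF f] sol_quad_bdd[OF f], of 1 "-1" n] sol_tail[OF f]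
        by (auto simp: quad_bdd_def abs_minus_commute)
      from quad_bddD(2)[OF quad_bdd_Aop[OF this] r, of u] Aop_lincomb[OF iter_quad_bdd[OF f, of n] sol_quad_bdd[OF f], of 1 "-1" u r]
      show ?thesis by (simp add: power_one_over field_simps)
    qed
    then show "\<forall>\<^sub>F n in sequentially. norm (Aop (iter f n) u r - Aop (sol f) u r) \<le> K * (r / M)\<^sup>2 * (1 / 2) ^ n"
      by simp
  qed
  then have "(\<lambda>n. iter f (Suc n) u r) \<longlonglongrightarrow> f u + Aop (sol f) u r" by (auto intro!: tendsto_intros)
  with LIMSEQ_Suc[OF sol_lim[OF f r, of u]] show ?thesis by (rule LIMSEQ_unique)
qed

text \<open>Uniqueness; it makes \<open>sol\<close> linear and shift covariant.\<close>

lemma Aop_fixpoint_zero: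
  assumes w: "quad_bdd C w" and eq: "\<And>u r. M < r \<Longrightarrow> w u r = Aop w u r" and r: "M < r"
  shows "w u r = 0"
proof -
  have "quad_bdd (C / 2 ^ n) w" for n
  proof (induction n)
    case (Suc n)
    from quad_bdd_Aop[OF this] have "quad_bdd (C / 2 ^ Suc n) (Aop w)" by (simp add: mult.commute)
    then show ?case using w eq by (auto simp: quad_bdd_def)
  qed (use w in simp)
  then have "\<bar>w u r\<bar> \<le> C / 2 ^ n * (r / M)\<^sup>2" for n by (rule quad_bddD(2)[OF _ r])
  moreover have "(\<lambda>n. C * (r / M)\<^sup>2 * (1 / 2) ^ n) \<longlonglongrightarrow> 0"
    by (intro tendsto_mult_right_zero LIMSEQ_realpow_zero) auto
  ultimately have "\<bar>w u r\<bar> \<le> 0"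
    by (intro LIMSEQ_le_const) (auto simp: power_one_over field_simps)
  then show ?thesis by simp
qed

lemma sol_unique:
  assumes f: "bcont K f" and w: "quad_bdd C w" and eq: "\<And>u r. M < r \<Longrightarrow> w u r = f u + Aop w u r" and r: "M < r"
  shows "w u r = sol f u r"
proof -
  let ?d = "\<lambda>u r. 1 * w u r + (-1) * sol f u r"
  have "?d u r = 0"
  proof (rule Aop_fixpoint_zero[OF quad_bdd_lincomb[OF w sol_quad_bdd[OF f]] _ r])
    fix u r assume r: "M < r"
    show "?d u r = Aop ?d u r"
      using eq[OF r, of u] sol_eq[OF f r, of u] Aop_lincomb[OF w sol_quad_bdd[OF f], of 1 "-1" u r] by simp
  qed
  then show ?thesis by simp
qed

lemma sol_lincomb:
  assumes f: "bcont K f" and g: "bcont L g" and r: "M < r"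
  shows "sol (\<lambda>x. \<alpha> * f x + \<beta> * g x) u r = \<alpha> * sol f u r + \<beta> * sol g u r"
proof (rule sol_unique[OF bcont_lincomb[OF f g] quad_bdd_lincomb[OF sol_quad_bdd[OF f] sol_quad_bdd[OF g]] _ r, symmetric])
  fix u r assume r: "M < r"
  show "\<alpha> * sol f u r + \<beta> * sol g u r
      = \<alpha> * f u + \<beta> * g u + Aop (\<lambda>u r. \<alpha> * sol f u r + \<beta> * sol g u r) u r"
    using sol_eq[OF f r, of u] sol_eq[OF g r, of u]
    by (simp add: Aop_lincomb[OF sol_quad_bdd[OF f] sol_quad_bdd[OF g]] algebra_simps)
qed

lemma sol_shift:
  assumes f: "bcont K f" and r: "M < r"
  shows "sol (\<lambda>x. f (x + s)) u r = sol f (u + s) r"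
proof (rule sol_unique[OF bcont_shift[OF f] quad_bdd_shift[OF sol_quad_bdd[OF f]] _ r, symmetric])
  fix u r assume r: "M < r"
  show "sol f (u + s) r = f (u + s) + Aop (\<lambda>u. sol f (u + s)) u r"
    using sol_eq[OF f r, of "u + s"] Aop_shift[of "sol f" s u r] by simp
qed

lemma sol_nonneg:
  assumes f: "bcont K f" and pos: "\<And>t. 0 \<le> f t" and r: "M < r"
  shows "0 \<le> sol f u r"
proof (rule LIMSEQ_le_const[OF sol_lim[OF f r]])
  have "M < r \<Longrightarrow> 0 \<le> iter f n u r" for n u r
    by (induction n arbitrary: u r) (use pos Aop_nonneg in auto)
  then show "\<exists>N. \<forall>n\<ge>N. 0 \<le> iter f n u r" using r by blast
qed

text \<open>The derivative \<open>\<partial>\<^sub>v\<phi>\<close> at constant \<open>u\<close>.\<close>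

definition solx :: "(real \<Rightarrow> real) \<Rightarrow> real \<Rightarrow> real \<Rightarrow> real" where
  "solx f = Bop (sol f)"

lemma solx_bound:
  assumes f: "bcont K f" and S: "\<And>t. u \<le> t \<Longrightarrow> \<bar>f t\<bar> \<le> S" and "M < r"
  shows "\<bar>solx f u r\<bar> \<le> S * Dfun M r / (2 * M)"
  unfolding solx_def
  by (rule Bop_bound_lin[OF sol_quad_bdd[OF f] assms(3)]) (rule sol_bound[OF f S])

lemma solx_lincomb:
  assumes f: "bcont K f" and g: "bcont L g"
  shows "solx (\<lambda>x. \<alpha> * f x + \<beta> * g x) u r = \<alpha> * solx f u r + \<beta> * solx g u r"
  unfolding solx_def
  by (simp add: Bop_lincomb[OF sol_quad_bdd[OF f] sol_quad_bdd[OF g], symmetric] sol_lincomb[OF f g] cong: Bop_cong)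

lemma solx_shift:
  assumes f: "bcont K f"
  shows "solx (\<lambda>x. f (x + s)) u r = solx f (u + s) r"
  unfolding solx_def
  by (simp add: Bop_shift[symmetric] sol_shift[OF f] cong: Bop_cong)

lemma sol_deriv_u:
  assumes "bcont K0 f" "bcont K1 f'" "bcont K2 f''"
    and "\<And>x. (f has_real_derivative f' x) (at x)" "\<And>x. (f' has_real_derivative f'' x) (at x)"
    and r: "M < r"
  shows "((\<lambda>u. sol f u r) has_real_derivative sol f' u r) (at u)"
proof (rule shift_covariant_derivative[where \<Lambda> = "\<lambda>f u. sol f u r" and C = "r / M", OF _ _ _ assms(1-5)])
  show "\<bar>sol f u r\<bar> \<le> r / M * K" if "bcont K f" for K f
    using sol_bound[OF that, of u K u r] bcontD(2)[OF that] r by (simp add: mult.commute)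
qed (use sol_lincomb sol_shift r in auto)

lemma solx_deriv_u:
  assumes "bcont K0 f" "bcont K1 f'" "bcont K2 f''"
    and "\<And>x. (f has_real_derivative f' x) (at x)" "\<And>x. (f' has_real_derivative f'' x) (at x)"
    and r: "M < r"
  shows "((\<lambda>u. solx f u r) has_real_derivative solx f' u r) (at u)"
proof (rule shift_covariant_derivative[where \<Lambda> = "\<lambda>f u. solx f u r" and C = "Dfun M r / (2 * M)", OF _ _ _ assms(1-5)])
  show "\<bar>solx f u r\<bar> \<le> Dfun M r / (2 * M) * K" if "bcont K f" for K f
    using solx_bound[OF that, of u K r] bcontD(2)[OF that] r by (simp add: mult.commute)
qed (use solx_lincomb solx_shift r in auto)

lemma sol_deriv_r:
  assumes f: "bcont K f" and r: "M < r"
  shows "(sol f u has_real_derivative dtort r * solx f u r) (at r)"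
proof -
  have "((\<lambda>r. f u + Aop (sol f) u r) has_real_derivative dtort r * solx f u r) (at r)"
    using Aop_deriv[OF sol_quad_bdd[OF f] r, of u] by (auto intro!: derivative_eq_intros simp: solx_def)
  then show ?thesis
    by (rule has_field_derivative_transform_within_open[where S = "{M<..}"]) (use r sol_eq[OF f] in auto)
qed

lemma solx_deriv_v:
  assumes f: "bcont K f" and r: "M < r"
  shows "((\<lambda>r. solx f (v - tort r) r) has_real_derivative pot r * sol f (v - tort r) r) (at r)"
  unfolding solx_def by (rule Bop_deriv_v[OF sol_quad_bdd[OF f] r])

lemma sol_cont: "bcont K f \<Longrightarrow> continuous_on (UNIV \<times> {M<..}) (\<lambda>(u, r). sol f u r)"
  by (rule quad_bddD(1)[OF sol_quad_bdd])

lemma solx_cont: "bcont K f \<Longrightarrow> continuous_on (UNIV \<times> {M<..}) (\<lambda>(u, r). solx f u r)"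
  unfolding solx_def by (rule Bop_cont(1)[OF sol_quad_bdd])


section \<open>Double null coordinates and derivatives of the solution\<close>

text \<open>The Couch--Torrence inversion. It turns \<open>r\<^sub>*\<close> into \<open>-r\<^sub>*\<close> and thus exchanges the horizon with
  null infinity, and it preserves the potential (see \<open>pot_mirror\<close>).\<close>

definition mirror :: "real \<Rightarrow> real" where "mirror r = M + M\<^sup>2 / (r - M)"

lemma mirror_gt: "M < r \<Longrightarrow> M < mirror r" using M_pos by (simp add: mirror_def)

lemma tort_mirror: assumes "M < r" shows "tort (mirror r) = - tort r"
proof -
  have "ln (M / (r - M)) = - ln ((r - M) / M)"
    using assms M_pos by (simp add: ln_div)
  then show ?thesis
    using assms M_pos by (simp add: tort_def rstar_def mirror_def power2_eq_square)
qed

text \<open>Together with its mirror image \<open>tort_lower\<close> this compares \<open>v - u\<close> with \<open>r\<close> far away and with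
  \<open>1 / (r - M)\<close> near the horizon, which are the weights in the two energy fluxes.\<close>

lemma tort_upper: assumes "M < r" shows "tort r \<le> 6 * (r - M)"
proof -
  have "ln ((r - M) / M) \<le> (r - M) / M - 1" using assms M_pos by (intro ln_le_minus_one) simp
  then have "M * ln ((r - M) / M) \<le> M * ((r - M) / M - 1)" using M_pos by (intro mult_left_mono) auto
  also have "\<dots> \<le> r - M" using M_pos by (simp add: field_simps)
  finally have "M * ln ((r - M) / M) \<le> r - M" .
  moreover have "0 \<le> M\<^sup>2 / (r - M)" using assms by simp
  ultimately show ?thesis by (simp add: tort_def rstar_def)
qed

lemma tort_lower_far: assumes "2 * M \<le> r" shows "2 * (r - 2 * M) \<le> tort r"
proof -
  have "M\<^sup>2 / (r - M) \<le> M" using assms M_pos by (simp add: field_simps power2_eq_square)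
  moreover have "0 \<le> ln ((r - M) / M)" using assms M_pos by (intro ln_ge_zero) (simp add: field_simps)
  then have "0 \<le> M * ln ((r - M) / M)" using M_pos by simp
  ultimately show ?thesis by (simp add: tort_def rstar_def)
qed

lemma tort_lower: assumes "M < r" shows "- (6 * M\<^sup>2 / (r - M)) \<le> tort r"
proof -
  have "- tort r \<le> 6 * (mirror r - M)"
    using tort_upper[OF mirror_gt[OF assms]] tort_mirror[OF assms] by linarith
  then show ?thesis by (simp add: mirror_def)
qed

lemma tort_at_top: "filterlim tort at_top at_top"
proof (rule filterlim_at_top_mono)
  show "filterlim (\<lambda>r. 2 * (r - 2 * M)) at_top at_top"
    unfolding filterlim_at_top eventually_at_top_linorder
  proof
    fix Z show "\<exists>N. \<forall>n\<ge>N. Z \<le> 2 * (n - 2 * M)" by (rule exI[of _ "\<bar>Z\<bar> + 2 * M"]) auto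
  qed
  show "\<forall>\<^sub>F r in at_top. 2 * (r - 2 * M) \<le> tort r"
    using eventually_ge_at_top[of "2 * M"] by eventually_elim (rule tort_lower_far)
qed

lemma tort_surj: "\<exists>r>M. tort r = y"
proof -
  define b where "b = 2 * M + \<bar>y\<bar>"
  have b: "M < b" "2 * M \<le> b" using M_pos by (auto simp: b_def)
  have "2 * \<bar>y\<bar> \<le> tort b" using tort_lower_far[OF b(2)] by (simp add: b_def)
  then have y: "tort (mirror b) \<le> y" "y \<le> tort b" using tort_mirror[OF b(1)] by auto
  have r: "M < mirror b" using mirror_gt b by auto
  have le: "mirror b \<le> b"
  proof (rule ccontr)
    assume "\<not> mirror b \<le> b"
    then have "tort b < tort (mirror b)" by (intro tort_strict_mono b) auto
    with y show False by linarith
  qed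
  have "continuous_on {mirror b..b} tort"
    by (rule continuous_on_subset[OF continuous_on_tort]) (use r in auto)
  from IVT'[OF y le this] obtain x where "mirror b \<le> x" "tort x = y" by blast
  with r show ?thesis by (intro exI[of _ x]) auto
qed

lemma r_uv_gt: "M < r_uv M u v" and tort_r_uv: "tort (r_uv M u v) = v - u"
proof -
  obtain r where "M < r" "tort r = v - u" using tort_surj by blast
  then have "(v - u) / 2 \<in> rstar M ` {M<..}" by (auto simp: tort_def intro!: image_eqI[of _ _ r])
  from inv_into_into[OF this] f_inv_into_f[OF this]
  show "M < r_uv M u v" "tort (r_uv M u v) = v - u"
    unfolding r_uv_def tort_def by simp_all
qed

lemma r_uv_le_iff: assumes "M < \<rho>" shows "r_uv M u v \<le> \<rho> \<longleftrightarrow> v - u \<le> tort \<rho>"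
  using tort_mono[OF r_uv_gt, of u v \<rho>] tort_strict_mono[OF assms, of "r_uv M u v"] tort_r_uv[of u v]
  by linarith

lemma r_uv_at_top: "filterlim (\<lambda>v. r_uv M u v) at_top at_top"
  unfolding filterlim_at_top
proof
  fix Z
  define \<rho> where "\<rho> = max Z (M + 1)"
  have \<rho>: "M < \<rho>" "Z \<le> \<rho>" by (auto simp: \<rho>_def)
  show "\<forall>\<^sub>F v in at_top. Z \<le> r_uv M u v"
    using eventually_gt_at_top[of "u + tort \<rho>"]
  proof eventually_elim
    case (elim v)
    then have "\<not> r_uv M u v \<le> \<rho>" using r_uv_le_iff[OF \<rho>(1)] by simp
    with \<rho> show ?case by simp
  qed
qed

lemma joint_deriv:
  fixes g gx gr :: "real \<Rightarrow> real \<Rightarrow> real"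
  assumes x: "\<And>x r. M < r \<Longrightarrow> ((\<lambda>x. g x r) has_real_derivative gx x r) (at x)"
    and r: "\<And>x r. M < r \<Longrightarrow> ((\<lambda>r. g x r) has_real_derivative gr x r) (at r)"
    and c: "continuous_on (UNIV \<times> {M<..}) (\<lambda>(x, r). gr x r)" and "M < r0"
  shows "((\<lambda>(x, r). g x r) has_derivative (\<lambda>(h, k). gx x0 r0 * h + gr x0 r0 * k)) (at (x0, r0))"
proof -
  have op: "open (UNIV \<times> {M<..} :: (real \<times> real) set)" by (intro open_Times) auto
  have "((\<lambda>(x, r). g x r) has_derivative
      (\<lambda>(h, k). gx x0 r0 * h + blinfun_mult_right (gr x0 r0) k)) (at (x0, r0) within UNIV \<times> {M<..})"
  proof (rule has_derivative_partialsI)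
    show "((\<lambda>x. g x r0) has_derivative (*) (gx x0 r0)) (at x0 within UNIV)"
      using x[OF \<open>M < r0\<close>, of x0] by (simp add: has_field_derivative_def)
    show "((\<lambda>r. g x r) has_derivative blinfun_apply (blinfun_mult_right (gr x r))) (at r within {M<..})"
      if "r \<in> {M<..}" for x r
    proof -
      have "((\<lambda>r. g x r) has_derivative (*) (gr x r)) (at r)"
        using r[of r x] that by (simp add: has_field_derivative_def)
      then show ?thesis unfolding blinfun_mult_right.rep_eq by (rule has_derivative_at_withinI)
    qed
    have "continuous_on (UNIV \<times> {M<..}) (\<lambda>z. blinfun_mult_right ((\<lambda>(x, r). gr x r) z))"
      by (rule bounded_linear.continuous_on[OF bounded_linear_blinfun_mult_right c])
    then show "continuous (at (x0, r0) within UNIV \<times> {M<..}) (\<lambda>(x, r). blinfun_mult_right (gr x r))"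
      using \<open>M < r0\<close> by (simp add: case_prod_unfold continuous_on_eq_continuous_within)
  qed (use \<open>M < r0\<close> in auto)
  then show ?thesis
    using at_within_open[OF _ op, of "(x0, r0)"] \<open>M < r0\<close> by (simp add: blinfun_mult_right.rep_eq)
qed

lemma deriv_pair_sol_deriv_u: "deriv_pair f f' \<Longrightarrow> M < r \<Longrightarrow> ((\<lambda>u. sol f u r) has_real_derivative sol f' u r) (at u)"
  unfolding deriv_pair_def by (elim exE conjE) (rule sol_deriv_u, assumption+, simp_all)

lemma deriv_pair_solx_deriv_u: "deriv_pair f f' \<Longrightarrow> M < r \<Longrightarrow> ((\<lambda>u. solx f u r) has_real_derivative solx f' u r) (at u)"
  unfolding deriv_pair_def by (elim exE conjE) (rule solx_deriv_u, assumption+, simp_all)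

lemma sol_has_derivative:
  assumes c: "deriv_pair f f'" and r: "M < r"
  shows "((\<lambda>(u, r). sol f u r) has_derivative (\<lambda>(h, k). sol f' u r * h + (dtort r * solx f u r) * k)) (at (u, r))"
proof -
  obtain K where f: "bcont K f" using c by (auto simp: deriv_pair_def)
  show ?thesis
    by (rule joint_deriv[OF deriv_pair_sol_deriv_u[OF c] sol_deriv_r[OF f]
          cont_mult_slice[OF solx_cont[OF f] continuous_on_dtort] r])
qed

lemma solx_has_derivative_v:
  assumes c: "deriv_pair f f'" and r: "M < r"
  shows "((\<lambda>(v, r). solx f (v - tort r) r) has_derivative
     (\<lambda>(h, k). solx f' (v - tort r) r * h + (pot r * sol f (v - tort r) r) * k)) (at (v, r))"
proof -
  obtain K where f: "bcont K f" using c by (auto simp: deriv_pair_def)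
  show ?thesis
  proof (rule joint_deriv[OF _ solx_deriv_v[OF f] _ r])
    show "((\<lambda>v. solx f (v - tort r) r) has_real_derivative solx f' (v - tort r) r) (at v)" if "M < r" for v r
    proof -
      have "((\<lambda>v. v - tort r) has_real_derivative 1) (at v)" by (auto intro!: derivative_eq_intros)
      from DERIV_chain2[where f = "\<lambda>u. solx f u r", OF deriv_pair_solx_deriv_u[OF c that] this]
      show ?thesis by simp
    qed
    show "continuous_on (UNIV \<times> {M<..}) (\<lambda>(v, r). pot r * sol f (v - tort r) r)"
      by (rule pot_integrand(1)[OF sol_quad_bdd[OF f]])
  qed
qed

lemma solx_deriv_r:
  assumes c: "deriv_pair f f'" and r: "M < r"
  shows "((\<lambda>r. solx f u r) has_real_derivative dtort r * solx f' u r + pot r * sol f u r) (at r)"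
proof -
  define g where "g = (\<lambda>v r. solx f (v - tort r) r)"
  have g: "((\<lambda>(v, r). g v r) has_derivative (\<lambda>(h, k). solx f' u r * h + (pot r * sol f u r) * k)) (at (u + tort r, r))"
    unfolding g_def using solx_has_derivative_v[OF c r, of "u + tort r"] by (simp only: add_diff_cancel_right')
  have p: "((\<lambda>r. u + tort r) has_real_derivative dtort r) (at r)"
    using DERIV_add[OF DERIV_const tort_deriv[OF r], of u] by simp
  have "((\<lambda>s. g (u + tort s) s) has_real_derivative solx f' u r * dtort r + (pot r * sol f u r) * 1) (at r)"
    by (rule compose_deriv[where p = "\<lambda>s. u + tort s" and q = "\<lambda>s. s" and t = r, OF g p DERIV_ident])
  then have "((\<lambda>s. solx f u s) has_real_derivative solx f' u r * dtort r + (pot r * sol f u r) * 1) (at r)"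
    by (simp only: g_def add_diff_cancel_right')
  then show ?thesis by (rule DERIV_cong) simp
qed


section \<open>The radiation field\<close>

lemma Dfun_at_top: "(Dfun M \<longlongrightarrow> 1) at_top"
proof -
  have "((\<lambda>r. M / r) \<longlongrightarrow> 0) at_top"
    by (rule tendsto_divide_0[OF tendsto_const]) (simp add: filterlim_at_top_imp_at_infinity filterlim_ident)
  then have "((\<lambda>r. (1 - M / r)\<^sup>2) \<longlongrightarrow> (1 - 0)\<^sup>2) at_top" by (intro tendsto_intros)
  then show ?thesis by (simp add: Dfun_def[abs_def])
qed

text \<open>\<open>S * D / (2 M)\<close> has derivative \<open>pot r * (S * (r / M))\<close>, so adding or subtracting \<open>p\<close> gives an
  increasing function.\<close>

lemma pot_increment:
  assumes r: "M < r1" "r1 \<le> r2"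
    and p: "\<And>r. M < r \<Longrightarrow> (p has_real_derivative pot r * q r) (at r)"
    and q: "\<And>r. M < r \<Longrightarrow> \<bar>q r\<bar> \<le> S * (r / M)"
  shows "\<bar>p r2 - p r1\<bar> \<le> S * (Dfun M r2 - Dfun M r1) / (2 * M)"
proof -
  have d: "((\<lambda>r. S * Dfun M r / (2 * M) + c * p r) has_real_derivative
      pot x * (S * (x / M) + c * q x)) (at x)" if "M < x" for x c
    using that M_pos by (auto intro!: derivative_eq_intros Dfun_deriv p simp: field_simps)
  have "S * Dfun M r1 / (2 * M) + c * p r1 \<le> S * Dfun M r2 / (2 * M) + c * p r2"
    if c: "\<bar>c\<bar> = 1" for c
  proof (rule DERIV_nonneg_imp_nondecreasing[OF r(2)])
    fix x assume x: "r1 \<le> x" "x \<le> r2"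
    have "\<bar>c * q x\<bar> \<le> S * (x / M)" using q[of x] x r c by (simp add: abs_mult)
    then have "0 \<le> pot x * (S * (x / M) + c * q x)"
      using pot_nonneg[of x] x r by (intro mult_nonneg_nonneg) auto
    then show "\<exists>y. ((\<lambda>r. S * Dfun M r / (2 * M) + c * p r) has_real_derivative y) (at x) \<and> 0 \<le> y"
      using d[of x c] x r by auto
  qed
  from this[of 1] this[of "-1"] show ?thesis
    by (simp add: right_diff_distrib diff_divide_distrib)
qed

text \<open>The loss of \<open>\<partial>\<^sub>u\<phi>\<close> along \<open>u = const\<close> between the past horizon and radius \<open>r\<close>, and its limit at
  null infinity.\<close>

definition pint :: "(real \<Rightarrow> real) \<Rightarrow> real \<Rightarrow> real \<Rightarrow> real" where
  "pint f u r = opint M (\<lambda>\<rho>. pot \<rho> * sol f u \<rho>) r"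

definition Gop :: "(real \<Rightarrow> real) \<Rightarrow> real \<Rightarrow> real" where
  "Gop f u = lim (\<lambda>n. pint f u (M + 1 + real n))"

lemma pint_integrand:
  assumes f: "bcont K f"
  shows "continuous_on {M<..} (\<lambda>\<rho>. pot \<rho> * sol f u \<rho>)"
    and "set_integrable lborel {M<..<r} (\<lambda>\<rho>. pot \<rho> * sol f u \<rho>)"
proof -
  show c: "continuous_on {M<..} (\<lambda>\<rho>. pot \<rho> * sol f u \<rho>)"
    by (intro continuous_on_mult cont_slice[OF sol_cont[OF f]] continuous_on_subset[OF continuous_on_pot]) auto
  show "set_integrable lborel {M<..<r} (\<lambda>\<rho>. pot \<rho> * sol f u \<rho>)"
  proof (rule opint_integrable[OF c])
    show "continuous_on {M..} (\<lambda>\<rho>. pot \<rho> * (K * (\<rho> / M)))"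
      using M_pos by (intro continuous_intros continuous_on_pot) auto
    fix x assume x: "M < x"
    have "\<bar>sol f u x\<bar> \<le> K * (x / M)" by (rule sol_bound[OF f bcontD(2)[OF f] order_refl x])
    from mult_left_mono[OF this pot_nonneg[of x]] show "\<bar>pot x * sol f u x\<bar> \<le> pot x * (K * (x / M))"
      using x pot_nonneg[of x] by (simp add: abs_mult)
  qed
qed

lemma pint_deriv:
  assumes "bcont K f" "M < r"
  shows "(pint f u has_real_derivative pot r * sol f u r) (at r)"
  unfolding pint_def[abs_def]
  by (rule opint_has_derivative[OF pint_integrand(2)[OF assms(1)] pint_integrand(1)[OF assms(1)] assms(2)])

lemma pint_bound:
  assumes f: "bcont K f" and S: "\<And>t. u \<le> t \<Longrightarrow> \<bar>f t\<bar> \<le> S" and r: "M < r"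
  shows "\<bar>pint f u r\<bar> \<le> S * Dfun M r / (2 * M)"
proof -
  have "\<bar>pint f u r\<bar> \<le> opint M (\<lambda>\<rho>. pot \<rho> * (S * (\<rho> / M))) r"
    unfolding pint_def
  proof (rule opint_abs_le[OF pint_integrand(2)[OF f] pot_lin_integrable])
    fix x assume "M < x" "x < r"
    then show "\<bar>pot x * sol f u x\<bar> \<le> pot x * (S * (x / M))"
      using mult_left_mono[OF sol_bound[OF f S order_refl \<open>M < x\<close>] pot_nonneg[of x]] pot_nonneg[of x]
      by (auto simp: abs_mult)
  qed
  then show ?thesis using opint_pot_lin[of r S] r by simp
qed

lemma pint_lincomb:
  assumes f: "bcont K f" and g: "bcont L g"
  shows "pint (\<lambda>x. \<alpha> * f x + \<beta> * g x) u r = \<alpha> * pint f u r + \<beta> * pint g u r"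
proof -
  have "pint (\<lambda>x. \<alpha> * f x + \<beta> * g x) u r
      = opint M (\<lambda>\<rho>. \<alpha> * (pot \<rho> * sol f u \<rho>) + \<beta> * (pot \<rho> * sol g u \<rho>)) r"
    unfolding pint_def by (rule opint_cong) (simp add: sol_lincomb[OF f g] algebra_simps)
  then show ?thesis
    unfolding pint_def by (simp add: opint_linear[OF pint_integrand(2)[OF f] pint_integrand(2)[OF g]])
qed

lemma pint_shift: assumes f: "bcont K f" shows "pint (\<lambda>x. f (x + s)) u r = pint f (u + s) r"
  unfolding pint_def by (rule opint_cong) (simp add: sol_shift[OF f])

lemma pint_increment:
  assumes f: "bcont K f" and S: "\<And>t. u \<le> t \<Longrightarrow> \<bar>f t\<bar> \<le> S" and r: "M < r1" "r1 \<le> r2"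
  shows "\<bar>pint f u r2 - pint f u r1\<bar> \<le> S * (Dfun M r2 - Dfun M r1) / (2 * M)"
  by (rule pot_increment[OF r pint_deriv[OF f] sol_bound[OF f S order_refl]])

lemma Dfun_seq: "(\<lambda>n. Dfun M (M + 1 + real n)) \<longlonglongrightarrow> 1"
  by (rule filterlim_compose[OF Dfun_at_top])
     (rule filterlim_tendsto_add_at_top[OF tendsto_const filterlim_real_sequentially])

lemma pint_lim: assumes f: "bcont K f" shows "(\<lambda>n. pint f u (M + 1 + real n)) \<longlonglongrightarrow> Gop f u"
proof -
  let ?d = "\<lambda>n. K * Dfun M (M + 1 + real n) / (2 * M)"
  have inc: "\<bar>pint f u (M + 1 + real n) - pint f u (M + 1 + real m)\<bar> \<le> \<bar>?d n - ?d m\<bar>" for n m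
  proof -
    have *: "\<bar>pint f u (M + 1 + real n) - pint f u (M + 1 + real m)\<bar> \<le> \<bar>?d n - ?d m\<bar>" if "m \<le> n" for n m
      using pint_increment[OF f bcontD(2)[OF f], of "M + 1 + real m" "M + 1 + real n" u] that
      by (simp add: right_diff_distrib diff_divide_distrib)
    show ?thesis using *[of m n] *[of n m] by (cases "m \<le> n") (auto simp: abs_minus_commute)
  qed
  have "convergent ?d"
    using M_pos by (intro convergentI[of _ "K * 1 / (2 * M)"] tendsto_intros Dfun_seq) auto
  then have "Cauchy ?d" by (rule convergent_Cauchy)
  then have "Cauchy (\<lambda>n. pint f u (M + 1 + real n))"
    unfolding Cauchy_def dist_real_def by (meson inc le_less_trans)
  then show ?thesis unfolding Gop_def by (simp add: Cauchy_convergent_iff convergent_LIMSEQ_iff)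
qed

lemma Gop_tail:
  assumes f: "bcont K f" and S: "\<And>t. u \<le> t \<Longrightarrow> \<bar>f t\<bar> \<le> S" and r: "M < r"
  shows "\<bar>Gop f u - pint f u r\<bar> \<le> S * (1 - Dfun M r) / (2 * M)"
proof (rule LIMSEQ_le_const2)
  show "(\<lambda>n. \<bar>pint f u (M + 1 + real n) - pint f u r\<bar>) \<longlonglongrightarrow> \<bar>Gop f u - pint f u r\<bar>"
    by (intro tendsto_intros pint_lim[OF f])
  have S0: "0 \<le> S" using S[of u] by simp
  obtain N :: nat where N: "r \<le> real N" using real_arch_simple by blast
  have "\<bar>pint f u (M + 1 + real n) - pint f u r\<bar> \<le> S * (1 - Dfun M r) / (2 * M)" if "N \<le> n" for n
  proof -
    have "r \<le> M + 1 + real n" using N that M_pos by (simp add: of_nat_mono add_increasing order_trans)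
    from pint_increment[OF f S r this]
    have "\<bar>pint f u (M + 1 + real n) - pint f u r\<bar> \<le> S * (Dfun M (M + 1 + real n) - Dfun M r) / (2 * M)" .
    also have "\<dots> \<le> S * (1 - Dfun M r) / (2 * M)"
      using S0 M_pos Dfun_le_one[of "M + 1 + real n"] by (intro divide_right_mono mult_left_mono) auto
    finally show ?thesis .
  qed
  then show "\<exists>N. \<forall>n\<ge>N. \<bar>pint f u (M + 1 + real n) - pint f u r\<bar> \<le> S * (1 - Dfun M r) / (2 * M)" by blast
qed

lemma Gop_bound:
  assumes f: "bcont K f" and S: "\<And>t. u \<le> t \<Longrightarrow> \<bar>f t\<bar> \<le> S"
  shows "\<bar>Gop f u\<bar> \<le> S / (2 * M)"
proof -
  have "\<bar>Gop f u\<bar> \<le> \<bar>Gop f u - pint f u (M + 1)\<bar> + \<bar>pint f u (M + 1)\<bar>" by simp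
  also have "\<dots> \<le> S * (1 - Dfun M (M + 1)) / (2 * M) + S * Dfun M (M + 1) / (2 * M)"
    by (intro add_mono Gop_tail[OF f S] pint_bound[OF f S]) auto
  also have "\<dots> = S / (2 * M)" by (simp add: add_divide_distrib[symmetric] algebra_simps)
  finally show ?thesis .
qed

lemma Gop_lincomb:
  assumes f: "bcont K f" and g: "bcont L g"
  shows "Gop (\<lambda>x. \<alpha> * f x + \<beta> * g x) u = \<alpha> * Gop f u + \<beta> * Gop g u"
proof -
  have "(\<lambda>n. \<alpha> * pint f u (M + 1 + real n) + \<beta> * pint g u (M + 1 + real n)) \<longlonglongrightarrow> \<alpha> * Gop f u + \<beta> * Gop g u"
    by (intro tendsto_intros pint_lim[OF f] pint_lim[OF g])
  with pint_lim[OF bcont_lincomb[OF f g], of \<alpha> \<beta> u] show ?thesis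
    unfolding pint_lincomb[OF f g] by (rule LIMSEQ_unique)
qed

lemma Gop_shift: "bcont K f \<Longrightarrow> Gop (\<lambda>x. f (x + s)) u = Gop f (u + s)"
  by (simp add: Gop_def pint_shift)

lemma Gop_nonneg:
  assumes f: "bcont K f" and pos: "\<And>t. 0 \<le> f t"
  shows "0 \<le> Gop f u"
proof (rule LIMSEQ_le_const[OF pint_lim[OF f]], intro exI allI impI)
  fix n :: nat
  show "0 \<le> pint f u (M + 1 + real n)"
    unfolding pint_def
    by (rule opint_nonneg, rule mult_nonneg_nonneg[OF pot_nonneg sol_nonneg[OF f pos]]) auto
qed

text \<open>Positivity of the operator, applied to \<open>g + f\<close> and \<open>g - f\<close>.\<close>

lemma Gop_dominated:
  assumes f: "bcont K f" and g: "bcont L g" and le: "\<And>t. \<bar>f t\<bar> \<le> g t"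
  shows "\<bar>Gop f u\<bar> \<le> Gop g u"
proof -
  have "0 \<le> Gop (\<lambda>x. 1 * g x + c * f x) u" if "\<bar>c\<bar> = 1" for c
  proof (rule Gop_nonneg[OF bcont_lincomb[OF g f]])
    fix t show "0 \<le> 1 * g t + c * f t" using le[of t] that by (auto simp: abs_le_iff abs_if split: if_splits)
  qed
  from this[of 1] this[of "-1"] have "0 \<le> 1 * Gop g u + 1 * Gop f u" "0 \<le> 1 * Gop g u + (-1) * Gop f u"
    unfolding Gop_lincomb[OF g f] by simp_all
  then show ?thesis by simp
qed

lemma deriv_pairE:
  assumes "deriv_pair f f'"
  obtains K0 K1 where "bcont K0 f" "bcont K1 f'" "\<And>x. (f has_real_derivative f' x) (at x)"
  using assms by (auto simp: deriv_pair_def)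

lemma Gop_deriv:
  assumes "deriv_pair f f'" shows "(Gop f has_real_derivative Gop f' u) (at u)"
proof -
  from assms obtain K0 K1 K2 f'' where f: "bcont K0 f" "bcont K1 f'" "bcont K2 f''"
    "\<And>x. (f has_real_derivative f' x) (at x)" "\<And>x. (f' has_real_derivative f'' x) (at x)"
    by (auto simp: deriv_pair_def)
  show ?thesis
  proof (rule shift_covariant_derivative[where \<Lambda> = Gop and C = "1 / (2 * M)", OF _ _ _ f])
    show "\<bar>Gop f u\<bar> \<le> 1 / (2 * M) * K" if "bcont K f" for K f
      using Gop_bound[OF that, of u K] bcontD(2)[OF that] by simp
  qed (use Gop_lincomb Gop_shift in auto)
qed

text \<open>Both sides are \<open>\<partial>\<^sub>u\<phi>\<close> at constant \<open>v\<close>. By the wave equation they have the same derivative in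
  \<open>r\<close>, and both tend to \<open>f' u\<close> at the past horizon.\<close>

lemma flux_identity:
  assumes c: "deriv_pair f f'" and r: "M < r"
  shows "sol f' u r - solx f u r = f' u - pint f u r"
proof -
  obtain K0 K1 where f: "bcont K0 f" "bcont K1 f'" using c by (rule deriv_pairE)
  let ?h = "\<lambda>r. sol f' u r - solx f u r + pint f u r"
  have d: "(?h has_real_derivative 0) (at s)" if "M < s" for s
    using DERIV_add[OF DERIV_diff[OF sol_deriv_r[OF f(2) that, of u] solx_deriv_r[OF c that, of u]] pint_deriv[OF f(1) that, of u]]
    by simp
  have const: "?h s = ?h r" if s: "M < s" for s
  proof (rule has_field_derivative_zero_constant[of "{M<..}" ?h, THEN exE])
    show "convex {M<..}" by (rule convex_real_interval)
    show "(?h has_real_derivative 0) (at x within {M<..})" if "x \<in> {M<..}" for x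
      using d[of x] that by (auto intro: has_field_derivative_at_within)
    fix k assume "\<forall>x\<in>{M<..}. ?h x = k"
    then show ?thesis using s r by simp
  qed
  have near: "\<bar>?h r - f' u\<bar> \<le> K1 * (s - M) / M + K0 * Dfun M s / (2 * M) + K0 * Dfun M s / (2 * M)" if s: "M < s" for s
  proof -
    have "\<bar>sol f' u s - f' u\<bar> \<le> K1 * (s - M) / M"
      using Aop_bound_lin[OF sol_quad_bdd[OF f(2)] s, of u K1] sol_bound[OF f(2) bcontD(2)[OF f(2)]] sol_eq[OF f(2) s, of u]
      by simp
    moreover have "\<bar>solx f u s\<bar> \<le> K0 * Dfun M s / (2 * M)" "\<bar>pint f u s\<bar> \<le> K0 * Dfun M s / (2 * M)"
      by (rule solx_bound[OF f(1) bcontD(2)[OF f(1)] s]) (rule pint_bound[OF f(1) bcontD(2)[OF f(1)] s])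
    ultimately show ?thesis unfolding const[OF s, symmetric] by linarith
  qed
  have "((\<lambda>s. K1 * (s - M) / M + K0 * Dfun M s / (2 * M) + K0 * Dfun M s / (2 * M)) \<longlongrightarrow>
      K1 * (M - M) / M + K0 * Dfun M M / (2 * M) + K0 * Dfun M M / (2 * M)) (at_right M)"
    unfolding Dfun_def using M_pos by (intro tendsto_intros) auto
  then have lim: "((\<lambda>s. K1 * (s - M) / M + K0 * Dfun M s / (2 * M) + K0 * Dfun M s / (2 * M)) \<longlongrightarrow> 0) (at_right M)"
    using M_pos by (simp add: Dfun_def)
  have "\<bar>?h r - f' u\<bar> \<le> 0"
  proof (rule tendsto_le[OF _ lim tendsto_const])
    show "\<forall>\<^sub>F s in at_right M. \<bar>?h r - f' u\<bar> \<le> K1 * (s - M) / M + K0 * Dfun M s / (2 * M) + K0 * Dfun M s / (2 * M)"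
      using eventually_at_right_less[of M] by eventually_elim (rule near)
  qed simp
  then show ?thesis by simp
qed

text \<open>Decay of the data at late times is inherited by the solution, uniformly up to the factor
  \<open>r / M\<close>. It gives the vanishing traces.\<close>

lemma sol_small:
  assumes f: "bcont K f" and lim: "(f \<longlongrightarrow> 0) at_top" and e: "0 < e"
  shows "\<exists>T. \<forall>t\<ge>T. \<forall>r>M. \<bar>sol f t r\<bar> \<le> e * (r / M) \<and> \<bar>solx f t r\<bar> \<le> e * Dfun M r / (2 * M)"
proof -
  have "eventually (\<lambda>t. dist (f t) 0 < e) at_top" using lim e by (rule tendstoD)
  then obtain T where T: "\<bar>f t\<bar> \<le> e" if "T \<le> t" for t
    unfolding eventually_at_top_linorder dist_real_def by force
  show ?thesis
  proof (intro exI allI impI conjI)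
    fix t r assume *: "T \<le> t" "M < r"
    show "\<bar>sol f t r\<bar> \<le> e * (r / M)" by (rule sol_bound[OF f T *])
    show "\<bar>solx f t r\<bar> \<le> e * Dfun M r / (2 * M)" by (rule solx_bound[OF f _ *(2)]) (use T * in auto)
  qed
qed

text \<open>Follow the line \<open>v = const\<close> through \<open>(u, r)\<close> from the horizon. Up to a fixed radius \<open>R\<close> it runs at
  late times \<open>v - tort R\<close>, where the solution is small; beyond \<open>R\<close> little mass of the potential is
  left.\<close>

lemma solx_far:
  assumes f: "bcont K f" and lim: "(f \<longlongrightarrow> 0) at_top"
  shows "((\<lambda>(u, r). solx f u r) \<longlongrightarrow> 0) (nhds u0 \<times>\<^sub>F at_top)"
proof (rule tendstoI)
  fix e :: real assume e: "0 < e"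
  have "((\<lambda>r. K * (1 - Dfun M r) / (2 * M)) \<longlongrightarrow> K * (1 - 1) / (2 * M)) at_top"
    using M_pos by (intro tendsto_intros Dfun_at_top) auto
  then have "eventually (\<lambda>r. K * (1 - Dfun M r) / (2 * M) < e / 2) at_top"
    by (rule order_tendstoD) (use e in simp)
  then have "eventually (\<lambda>r. K * (1 - Dfun M r) / (2 * M) < e / 2 \<and> M < r) at_top"
    using eventually_gt_at_top[of M] by eventually_elim simp
  then obtain R where R: "M < R" "K * (1 - Dfun M R) / (2 * M) < e / 2"
    unfolding eventually_at_top_linorder by blast
  \<comment> \<open>\<open>e\' / (2 M) = e / 4\<close>, which leaves room for the tail beyond \<open>R\<close>.\<close>
  define e' where "e' = M * e / 2"
  have e': "0 < e'" using e M_pos by (simp add: e'_def)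
  from sol_small[OF f lim e'] obtain T
    where T: "\<forall>t\<ge>T. \<forall>r>M. \<bar>sol f t r\<bar> \<le> e' * (r / M) \<and> \<bar>solx f t r\<bar> \<le> e' * Dfun M r / (2 * M)" ..
  have "eventually (\<lambda>r. T + tort R - u0 + 1 \<le> tort r) at_top"
    using tort_at_top unfolding filterlim_at_top by simp
  then have far: "eventually (\<lambda>r. T + tort R - u0 + 1 \<le> tort r \<and> R \<le> r) at_top"
    using eventually_ge_at_top[of R] by eventually_elim simp
  have "eventually (\<lambda>u. u \<in> {u0 - 1<..}) (nhds u0)"
    by (rule eventually_nhds_in_open) auto
  from eventually_prodI[OF this far]
  have "eventually (\<lambda>z. fst z \<in> {u0 - 1<..} \<and> (T + tort R - u0 + 1 \<le> tort (snd z) \<and> R \<le> snd z)) (nhds u0 \<times>\<^sub>F at_top)" .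
  then show "\<forall>\<^sub>F z in nhds u0 \<times>\<^sub>F at_top. dist (case z of (u, r) \<Rightarrow> solx f u r) 0 < e"
  proof eventually_elim
    case (elim z)
    obtain u r where z: "z = (u, r)" by (cases z)
    let ?v = "u + tort r"
    have 1: "\<bar>solx f (?v - tort r) r - solx f (?v - tort R) R\<bar> \<le> K * (Dfun M r - Dfun M R) / (2 * M)"
      using elim z sol_bound[OF f bcontD(2)[OF f]]
      by (intro pot_increment[of R r "\<lambda>r. solx f (?v - tort r) r" "\<lambda>r. sol f (?v - tort r) r"] R solx_deriv_v[OF f]) auto
    have "r \<ge> M" using elim z R by simp
    have "K * (Dfun M r - Dfun M R) / (2 * M) \<le> K * (1 - Dfun M R) / (2 * M)"
      using bcontD(3)[OF f] M_pos Dfun_le_one[OF \<open>r \<ge> M\<close>] by (intro divide_right_mono mult_left_mono) auto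
    moreover have "\<bar>solx f (?v - tort R) R\<bar> \<le> e' * Dfun M R / (2 * M)"
      using T elim z R by auto
    moreover have "e' * Dfun M R / (2 * M) \<le> e' * 1 / (2 * M)"
      using e' M_pos Dfun_le_one[of R] R by (intro divide_right_mono mult_left_mono) auto
    moreover have "e' * 1 / (2 * M) = e / 4" using M_pos by (simp add: e'_def)
    ultimately have "\<bar>solx f u r\<bar> < e" using 1 R e by simp
    then show ?case by (simp add: z)
  qed
qed

text \<open>The existence of the radiation field. Applied to an antiderivative \<open>F\<close> of the data,
  \<open>flux_identity\<close> expresses \<open>sol f\<close> through \<open>solx F\<close> and \<open>pint F\<close>, and both converge under no more
  than boundedness of \<open>F\<close> and \<open>F \<longlongrightarrow> 0\<close>. The limit is jointly uniform near each \<open>u0\<close>, which after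
  reflection is continuity up to the horizon.\<close>

lemma sol_far:
  assumes c: "deriv_pair F f" and lim: "(F \<longlongrightarrow> 0) at_top"
  shows "((\<lambda>(u, r). sol f u r) \<longlongrightarrow> f u0 - Gop F u0) (nhds u0 \<times>\<^sub>F at_top)"
proof -
  from c obtain K0 K1 where F: "bcont K0 F" "bcont K1 f" by (rule deriv_pairE)
  have "((\<lambda>z. K0 * (1 - Dfun M (snd z)) / (2 * M)) \<longlongrightarrow> K0 * (1 - 1) / (2 * M)) (nhds u0 \<times>\<^sub>F at_top)"
    using M_pos by (intro tendsto_intros filterlim_compose[OF Dfun_at_top filterlim_snd]) auto
  then have k: "((\<lambda>z. K0 * (1 - Dfun M (snd z)) / (2 * M)) \<longlongrightarrow> 0) (nhds u0 \<times>\<^sub>F at_top)" by simp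
  have ev: "eventually (\<lambda>z. M < snd z) (nhds u0 \<times>\<^sub>F at_top)"
    by (rule filterlim_snd[unfolded filterlim_iff, rule_format, OF eventually_gt_at_top])
  have "((\<lambda>z. pint F (fst z) (snd z) - Gop F (fst z)) \<longlongrightarrow> 0) (nhds u0 \<times>\<^sub>F at_top)"
  proof (rule Lim_null_comparison[OF _ k])
    show "\<forall>\<^sub>F z in nhds u0 \<times>\<^sub>F at_top. norm (pint F (fst z) (snd z) - Gop F (fst z)) \<le> K0 * (1 - Dfun M (snd z)) / (2 * M)"
      using ev by eventually_elim (use Gop_tail[OF F(1) bcontD(2)[OF F(1)]] in \<open>simp add: abs_minus_commute\<close>)
  qed
  moreover have "((\<lambda>z. Gop F (fst z)) \<longlongrightarrow> Gop F u0) (nhds u0 \<times>\<^sub>F at_top)"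
    by (rule filterlim_compose[OF _ filterlim_fst]) (use DERIV_isCont[OF Gop_deriv[OF c, of u0]] in \<open>simp add: isCont_def tendsto_nhds_iff\<close>)
  moreover have "((\<lambda>z. f (fst z)) \<longlongrightarrow> f u0) (nhds u0 \<times>\<^sub>F at_top)"
    by (rule filterlim_compose[OF _ filterlim_fst])
       (use bcontD(1)[OF F(2)] in \<open>simp add: continuous_on_eq_continuous_at isCont_def tendsto_nhds_iff\<close>)
  moreover have "((\<lambda>z. solx F (fst z) (snd z)) \<longlongrightarrow> 0) (nhds u0 \<times>\<^sub>F at_top)"
    using solx_far[OF F(1) lim, of u0] by (simp add: case_prod_unfold)
  ultimately have "((\<lambda>z. f (fst z) + solx F (fst z) (snd z) - ((pint F (fst z) (snd z) - Gop F (fst z)) + Gop F (fst z)))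
      \<longlongrightarrow> f u0 + 0 - (0 + Gop F u0)) (nhds u0 \<times>\<^sub>F at_top)"
    by (intro tendsto_intros)
  then have "((\<lambda>z. f (fst z) + solx F (fst z) (snd z) - pint F (fst z) (snd z)) \<longlongrightarrow> f u0 - Gop F u0) (nhds u0 \<times>\<^sub>F at_top)"
    by simp
  then show ?thesis
  proof (rule Lim_transform_eventually)
    show "\<forall>\<^sub>F z in nhds u0 \<times>\<^sub>F at_top. f (fst z) + solx F (fst z) (snd z) - pint F (fst z) (snd z) = (case z of (u, r) \<Rightarrow> sol f u r)"
      using ev by eventually_elim (use flux_identity[OF c] in \<open>simp add: case_prod_beta algebra_simps\<close>)
  qed
qed

end

section \<open>Smoothness, the metric and radial functions\<close>

lemma C_on_cong:
  assumes "open U" "\<And>x. x \<in> U \<Longrightarrow> f x = g x"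
  shows "C_on k f U \<Longrightarrow> C_on k g U"
  using assms(2)
proof (induction k arbitrary: f g)
  case 0
  then show ?case using continuous_on_cong[of U U f g] by simp
next
  case (Suc k)
  have d: "(g has_derivative frechet_derivative f (at x)) (at x)" if x: "x \<in> U" for x
  proof -
    have "f differentiable (at x)"
      using Suc.prems(1) x at_within_open[OF x \<open>open U\<close>] by (auto simp: differentiable_on_def)
    then have "(f has_derivative frechet_derivative f (at x)) (at x)"
      by (simp add: frechet_derivative_works)
    then show ?thesis
      by (rule has_derivative_transform_within_open[OF _ \<open>open U\<close> x]) (use Suc.prems(2) in auto)
  qed
  have eq: "frechet_derivative g (at x) = frechet_derivative f (at x)" if "x \<in> U" for x
    using frechet_derivative_at[OF d[OF that]] by simp
  have "g differentiable_on U"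
    unfolding differentiable_on_def using d by (meson differentiable_def has_derivative_at_withinI)
  moreover have "C_on k (\<lambda>x. frechet_derivative g (at x) b) U" if "b \<in> Basis" for b
    by (rule Suc.IH[of "\<lambda>x. frechet_derivative f (at x) b"]) (use Suc.prems that eq in auto)
  ultimately show ?case by simp
qed

text \<open>Smoothness without bookkeeping of higher derivatives: it suffices that the partial derivatives
  stay in the class.\<close>

lemma C_on_closed_class:
  fixes P :: "('a::euclidean_space \<Rightarrow> real) \<Rightarrow> bool"
  assumes U: "open U" and
    step: "\<And>f. P f \<Longrightarrow> \<exists>f'. (\<forall>x\<in>U. (f has_derivative f' x) (at x)) \<and> (\<forall>b\<in>Basis. P (\<lambda>x. f' x b))"
  shows "P f \<Longrightarrow> C_on k f U"
proof (induction k arbitrary: f)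
  case 0
  from step[OF 0] obtain f' where "\<forall>x\<in>U. (f has_derivative f' x) (at x)" by blast
  then show ?case
    by (auto intro!: continuous_at_imp_continuous_on intro: has_derivative_continuous)
next
  case (Suc k)
  from step[OF Suc.prems] obtain f' where f': "\<And>x. x \<in> U \<Longrightarrow> (f has_derivative f' x) (at x)"
    and P: "\<And>b. b \<in> Basis \<Longrightarrow> P (\<lambda>x. f' x b)" by blast
  have "f differentiable_on U"
    unfolding differentiable_on_def using f' by (meson differentiable_def has_derivative_at_withinI)
  moreover have "C_on k (\<lambda>x. frechet_derivative f (at x) b) U" if "b \<in> Basis" for b
    by (rule C_on_cong[OF U _ Suc.IH[OF P[OF that]]]) (use frechet_derivative_at[OF f'] in auto)
  ultimately show ?case by simp
qed

lemma det_4: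
  "det (A::'a::comm_ring_1^4^4) =
    A$1$1 * (A$2$2 * (A$3$3 * A$4$4 - A$3$4 * A$4$3) - A$2$3 * (A$3$2 * A$4$4 - A$3$4 * A$4$2) + A$2$4 * (A$3$2 * A$4$3 - A$3$3 * A$4$2))
  - A$1$2 * (A$2$1 * (A$3$3 * A$4$4 - A$3$4 * A$4$3) - A$2$3 * (A$3$1 * A$4$4 - A$3$4 * A$4$1) + A$2$4 * (A$3$1 * A$4$3 - A$3$3 * A$4$1))
  + A$1$3 * (A$2$1 * (A$3$2 * A$4$4 - A$3$4 * A$4$2) - A$2$2 * (A$3$1 * A$4$4 - A$3$4 * A$4$1) + A$2$4 * (A$3$1 * A$4$2 - A$3$2 * A$4$1))
  - A$1$4 * (A$2$1 * (A$3$2 * A$4$3 - A$3$3 * A$4$2) - A$2$2 * (A$3$1 * A$4$3 - A$3$3 * A$4$1) + A$2$3 * (A$3$1 * A$4$2 - A$3$2 * A$4$1))"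
proof -
  have f1: "finite {2::4, 3, 4}" "1 \<notin> {2::4, 3, 4}" by auto
  have f2: "finite {3::4, 4}" "2 \<notin> {3::4, 4}" by auto
  have f3: "finite {4::4}" "3 \<notin> {4::4}" by auto
  show ?thesis
    unfolding det_def UNIV_4
    unfolding sum_over_permutations_insert[OF f1] sum_over_permutations_insert[OF f2] sum_over_permutations_insert[OF f3]
    unfolding permutes_sing
    by (simp add: sign_swap_id permutation_swap_id permutation_compose sign_compose sign_id swap_id_eq algebra_simps)
qed

lemma rad_unit:
  assumes "0 < rad p"
  shows "(p$2 / rad p)\<^sup>2 + (p$3 / rad p)\<^sup>2 + (p$4 / rad p)\<^sup>2 = 1"
proof -
  have "(rad p)\<^sup>2 = (p$2)\<^sup>2 + (p$3)\<^sup>2 + (p$4)\<^sup>2" by (simp add: rad_def)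
  moreover have "(rad p)\<^sup>2 \<noteq> 0" using assms by simp
  ultimately show ?thesis by (simp add: power_divide add_divide_distrib[symmetric])
qed

lemma metric_entry:
  "metric M p $ a $ b = (if a = 1 then (if b = 1 then - Dfun M (rad p) else p$b / rad p)
     else if b = 1 then p$a / rad p
     else (if a = b then 1 else 0) - (p$a / rad p) * (p$b / rad p))"
  by (simp add: metric_def dv_def dr_def axis_def)

text \<open>In the chart \<open>(v, y)\<close> the volume density is one, as \<open>r\<^sup>2 dr d\<omega>\<close> is Lebesgue measure in \<open>y\<close>.\<close>

lemma det_metric: assumes "0 < rad p" shows "det (metric M p) = -1"
proof -
  have "- d * ((1 - x*x) * ((1 - y*y) * (1 - z*z) - - (y*z) * - (z*y)) - - (x*y) * (- (y*x) * (1 - z*z) - - (y*z) * - (z*x)) + - (x*z) * (- (y*x) * - (z*y) - (1 - y*y) * - (z*x)))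
     - x * (x * ((1 - y*y) * (1 - z*z) - - (y*z) * - (z*y)) - - (x*y) * (y * (1 - z*z) - - (y*z) * z) + - (x*z) * (y * - (z*y) - (1 - y*y) * z))
     + y * (x * (- (y*x) * (1 - z*z) - - (y*z) * - (z*x)) - (1 - x*x) * (y * (1 - z*z) - - (y*z) * z) + - (x*z) * (y * - (z*x) - - (y*x) * z))
     - z * (x * (- (y*x) * - (z*y) - (1 - y*y) * - (z*x)) - (1 - x*x) * (y * - (z*y) - (1 - y*y) * z) + - (x*y) * (y * - (z*x) - - (y*x) * z)) = -1"
    if "x\<^sup>2 + y\<^sup>2 + z\<^sup>2 = 1" for x y z d :: real
    using that by algebra
  from this[OF rad_unit[OF assms], of "Dfun M (rad p)"]
  show ?thesis unfolding det_4 metric_entry by simp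
qed

lemma vol_density_one: "0 < rad p \<Longrightarrow> vol_density M p = 1"
  by (simp add: vol_density_def det_metric)

lemma matrix_inv_eqI:
  fixes A B :: "real^'n^'n"
  assumes "A ** B = mat 1"
  shows "matrix_inv A = B"
proof -
  have BA: "B ** A = mat 1" using assms matrix_left_right_inverse by blast
  have inv: "A ** matrix_inv A = mat 1 \<and> matrix_inv A ** A = mat 1"
    unfolding matrix_inv_def by (rule someI[of _ B]) (use assms BA in auto)
  have "matrix_inv A = matrix_inv A ** (A ** B)" by (simp add: assms matrix_mul_rid)
  also have "\<dots> = (matrix_inv A ** A) ** B" by (simp only: matrix_mul_assoc)
  finally show ?thesis by (simp add: inv matrix_mul_lid)
qed

lemma inv_metric_entry:
  assumes "0 < rad p"
  shows "inv_metric M p $ a $ b = (if a = 1 then (if b = 1 then 0 else p$b / rad p)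
     else if b = 1 then p$a / rad p
     else (if a = b then 1 else 0) + (Dfun M (rad p) - 1) * ((p$a / rad p) * (p$b / rad p)))"
proof -
  let ?G = "(\<chi> a b. if a = 1 then (if b = 1 then 0 else p$b / rad p)
     else if b = 1 then p$a / rad p
     else (if a = b then 1 else 0) + (Dfun M (rad p) - 1) * ((p$a / rad p) * (p$b / rad p))) :: real^4^4"
  have "metric M p ** ?G = mat 1"
  proof -
    define d x y z where "d = Dfun M (rad p)" and "x = p$2 / rad p" and "y = p$3 / rad p" and "z = p$4 / rad p"
    have u: "x\<^sup>2 + y\<^sup>2 + z\<^sup>2 = 1" using rad_unit[OF assms] by (simp add: x_def y_def z_def)
    show ?thesis
      unfolding vec_eq_iff matrix_matrix_mult_def forall_4 sum_4 mat_def
      apply (simp add: metric_entry d_def[symmetric] x_def[symmetric] y_def[symmetric] z_def[symmetric])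
      apply (intro conjI)
      using u by algebra+
  qed
  from matrix_inv_eqI[OF this] show ?thesis unfolding inv_metric_def by simp
qed

lemma rad_has_derivative:
  assumes "0 < rad p"
  shows "(rad has_derivative (\<lambda>h. (p$2 * h$2 + p$3 * h$3 + p$4 * h$4) / rad p)) (at p)"
proof -
  have c: "((\<lambda>p. p$i) has_derivative (\<lambda>h. h$i)) (at p)" for i
    by (rule bounded_linear.has_derivative[OF bounded_linear_vec_nth has_derivative_ident])
  have pos: "0 < (p$2)\<^sup>2 + (p$3)\<^sup>2 + (p$4)\<^sup>2" using assms by (simp add: rad_def)
  have "((\<lambda>p. sqrt ((p$2)\<^sup>2 + (p$3)\<^sup>2 + (p$4)\<^sup>2)) has_derivative
      (\<lambda>h. (p$2 * h$2 + p$3 * h$3 + p$4 * h$4) / rad p)) (at p)"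
    using pos by (auto intro!: derivative_eq_intros c simp: rad_def field_simps)
  then show ?thesis by (simp add: rad_def[abs_def])
qed

lemma continuous_rad: "continuous_on UNIV rad"
  unfolding rad_def[abs_def] by (intro continuous_intros)

lemma open_exterior_open: "open (exterior_open M)"
  unfolding exterior_open_def by (intro open_Collect_less continuous_on_const continuous_rad)

text \<open>\<open>rd f a b p\<close>: to first order at \<open>p\<close>, \<open>f\<close> is a function of \<open>(v, r)\<close> alone, with \<open>\<partial>\<^sub>v f = a\<close> and
  \<open>\<partial>\<^sub>r f = b\<close>.\<close>

definition rd :: "(real^4 \<Rightarrow> real) \<Rightarrow> real \<Rightarrow> real \<Rightarrow> real^4 \<Rightarrow> bool" where
  "rd f a b p \<longleftrightarrow> 0 < rad p \<and>
     (f has_derivative (\<lambda>h. a * h$1 + b * ((p$2 * h$2 + p$3 * h$3 + p$4 * h$4) / rad p))) (at p)"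

lemma pd_has_derivative: "(f has_derivative f') (at p) \<Longrightarrow> pd a f p = f' (axis a 1)"
  unfolding pd_def using frechet_derivative_at by metis

lemma pd_rd:
  assumes "rd f a b p"
  shows "pd i f p = (if i = 1 then a else b * (p$i / rad p))"
proof -
  from assms have "pd i f p = a * axis i 1 $ 1 + b * ((p$2 * axis i 1 $ 2 + p$3 * axis i 1 $ 3 + p$4 * axis i 1 $ 4) / rad p)"
    unfolding rd_def by (intro pd_has_derivative) simp
  moreover have "i = 1 \<or> i = 2 \<or> i = 3 \<or> i = 4" by (rule exhaust_4)
  ultimately show ?thesis by (auto simp: axis_def)
qed

lemma rd_transform:
  assumes "rd f a b p" "open S" "p \<in> S" "\<And>q. q \<in> S \<Longrightarrow> f q = g q"
  shows "rd g a b p"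
  using assms has_derivative_transform_within_open[of f _ p UNIV S g] unfolding rd_def by auto

lemma pd_transform:
  assumes "open S" "p \<in> S" "\<And>q. q \<in> S \<Longrightarrow> f q = g q" and d: "(g has_derivative g') (at p)"
  shows "pd a f p = g' (axis a 1)"
  by (rule pd_has_derivative, rule has_derivative_transform_within_open[OF d assms(1,2)]) (simp add: assms(3))

lemma rd_const: "0 < rad p \<Longrightarrow> rd (\<lambda>_. c) 0 0 p"
  by (simp add: rd_def)

lemma rd_add: "rd f a b p \<Longrightarrow> rd g a' b' p \<Longrightarrow> rd (\<lambda>q. f q + g q) (a + a') (b + b') p"
  unfolding rd_def by (auto intro!: derivative_eq_intros simp: algebra_simps add_divide_distrib)

lemma rd_mult: "rd f a b p \<Longrightarrow> rd g a' b' p \<Longrightarrow>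
    rd (\<lambda>q. f q * g q) (a * g p + f p * a') (b * g p + f p * b') p"
  unfolding rd_def by (auto intro!: derivative_eq_intros simp: algebra_simps add_divide_distrib)

lemma rd_radial:
  assumes g: "(g has_real_derivative g') (at (rad p))" and p: "0 < rad p"
  shows "rd (\<lambda>q. g (rad q)) 0 g' p"
  using has_derivative_compose[OF rad_has_derivative[OF p] g[unfolded has_field_derivative_def]] p
  by (simp add: rd_def)

lemma rd_joint:
  assumes F: "((\<lambda>(v, r). F v r) has_derivative (\<lambda>(h, k). a * h + b * k)) (at (p$1, rad p))" and p: "0 < rad p"
  shows "rd (\<lambda>q. F (q$1) (rad q)) a b p"
proof -
  have "((\<lambda>q. (q$1, rad q)) has_derivative (\<lambda>h. (h$1, (p$2 * h$2 + p$3 * h$3 + p$4 * h$4) / rad p))) (at p)"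
    by (intro has_derivative_Pair rad_has_derivative[OF p]
        bounded_linear.has_derivative[OF bounded_linear_vec_nth has_derivative_ident])
  from has_derivative_compose[OF this F] p show ?thesis by (simp add: rd_def)
qed

section \<open>Spherically symmetric solutions as towers of derivatives\<close>

context ern begin

text \<open>\<open>A k\<close> and \<open>B k\<close> stand for \<open>T\<^sup>k \<phi>\<close> and \<open>T\<^sup>k L \<phi>\<close> as functions of \<open>(v, r)\<close>. The first rule says
  that \<open>L = T + (1 / dtort) \<partial>\<^sub>r\<close>; the second contains the wave equation
  \<open>\<partial>\<^sub>r(L \<phi>) = pot * \<phi>\<close>. All further derivatives follow from these, so a tower is a spherically
  symmetric smooth solution.\<close>

definition tower :: "(nat \<Rightarrow> real \<Rightarrow> real \<Rightarrow> real) \<Rightarrow> (nat \<Rightarrow> real \<Rightarrow> real \<Rightarrow> real) \<Rightarrow> bool" where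
  "tower A B \<longleftrightarrow> (\<forall>k v. \<forall>r>M.
     ((\<lambda>(v, r). A k v r) has_derivative
        (\<lambda>(h, l). A (Suc k) v r * h + (dtort r * (B k v r - A (Suc k) v r)) * l)) (at (v, r)) \<and>
     ((\<lambda>(v, r). B k v r) has_derivative
        (\<lambda>(h, l). B (Suc k) v r * h + (pot r * A k v r) * l)) (at (v, r)))"

lemma tower_rd:
  assumes "tower A B" "M < rad p"
  shows "rd (\<lambda>q. A k (q$1) (rad q)) (A (Suc k) (p$1) (rad p))
      (dtort (rad p) * (B k (p$1) (rad p) - A (Suc k) (p$1) (rad p))) p"
    and "rd (\<lambda>q. B k (q$1) (rad q)) (B (Suc k) (p$1) (rad p)) (pot (rad p) * A k (p$1) (rad p)) p"
  using assms M_pos by (auto intro!: rd_joint simp: tower_def)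

text \<open>The algebra generated by a tower and the coordinate functions, closed under partial derivatives
  because \<open>dtort\<close> and \<open>pot\<close> are polynomials in \<open>r\<close>, \<open>1 / r\<close> and \<open>1 / (r - M)\<close>.\<close>

inductive tower_alg :: "(nat \<Rightarrow> real \<Rightarrow> real \<Rightarrow> real) \<Rightarrow> (nat \<Rightarrow> real \<Rightarrow> real \<Rightarrow> real) \<Rightarrow> (real^4 \<Rightarrow> real) \<Rightarrow> bool"
  for A B where
  const: "tower_alg A B (\<lambda>_. c)"
| coord: "tower_alg A B (\<lambda>p. p$i)"
| inv_rad: "tower_alg A B (\<lambda>p. 1 / rad p)"
| inv_rad_M: "tower_alg A B (\<lambda>p. 1 / (rad p - M))"
| A: "tower_alg A B (\<lambda>p. A k (p$1) (rad p))"
| B: "tower_alg A B (\<lambda>p. B k (p$1) (rad p))"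
| add: "tower_alg A B f \<Longrightarrow> tower_alg A B g \<Longrightarrow> tower_alg A B (\<lambda>p. f p + g p)"
| mult: "tower_alg A B f \<Longrightarrow> tower_alg A B g \<Longrightarrow> tower_alg A B (\<lambda>p. f p * g p)"

definition has_tower_alg_grad where
  "has_tower_alg_grad A B f \<longleftrightarrow> (\<exists>g :: 4 \<Rightarrow> real^4 \<Rightarrow> real. (\<forall>i. tower_alg A B (g i)) \<and>
     (\<forall>p\<in>exterior_open M. (f has_derivative (\<lambda>h. g 1 p * h$1 + g 2 p * h$2 + g 3 p * h$3 + g 4 p * h$4)) (at p)))"

lemma has_tower_alg_grad_rd:
  assumes "\<And>p. M < rad p \<Longrightarrow> rd f (a p) (b p) p" and a: "tower_alg A B a" and b: "tower_alg A B b"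
  shows "has_tower_alg_grad A B f"
  unfolding has_tower_alg_grad_def
proof (intro exI conjI allI ballI)
  let ?g = "\<lambda>i p. if i = 1 then a p else b p * (p$i * (1 / rad p))"
  show "tower_alg A B (?g i)" for i :: 4
  proof (cases "i = 1")
    case False
    have "tower_alg A B (\<lambda>p. b p * (p$i * (1 / rad p)))" by (intro tower_alg.mult b tower_alg.coord tower_alg.inv_rad)
    with False show ?thesis by simp
  qed (use a in simp)
  fix p assume "p \<in> exterior_open M"
  then have "rd f (a p) (b p) p" by (intro assms) (simp add: exterior_open_def)
  then show "(f has_derivative (\<lambda>h. ?g 1 p * h$1 + ?g 2 p * h$2 + ?g 3 p * h$3 + ?g 4 p * h$4)) (at p)"
    unfolding rd_def by (elim conjE) (erule has_derivative_eq_rhs, rule ext, simp add: algebra_simps add_divide_distrib)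
qed

lemma tower_alg_rad: "tower_alg A B rad"
proof -
  have "rad = (\<lambda>p. (p$2 * p$2 + (p$3 * p$3 + p$4 * p$4)) * (1 / rad p))"
  proof
    fix p
    have "rad p * rad p = p$2 * p$2 + (p$3 * p$3 + p$4 * p$4)"
      unfolding rad_def by (simp add: power2_eq_square add.assoc)
    then show "rad p = (p$2 * p$2 + (p$3 * p$3 + p$4 * p$4)) * (1 / rad p)"
      by (cases "rad p = 0") (auto simp: field_simps)
  qed
  moreover have "tower_alg A B (\<lambda>p. (p$2 * p$2 + (p$3 * p$3 + p$4 * p$4)) * (1 / rad p))"
    by (intro tower_alg.intros)
  ultimately show ?thesis by simp
qed

lemma tower_alg_grad:
  assumes t: "tower A B" and f: "tower_alg A B f"
  shows "has_tower_alg_grad A B f"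
  using f
proof induction
  case (const c)
  show ?case
    by (rule has_tower_alg_grad_rd[OF rd_const tower_alg.const tower_alg.const]) (use M_pos in auto)
next
  case (coord i)
  show ?case unfolding has_tower_alg_grad_def
  proof (intro exI conjI allI ballI)
    let ?g = "\<lambda>j (p :: real^4). if j = i then 1 else (0 :: real)"
    show "tower_alg A B (?g j)" for j by (cases "j = i") (auto intro: tower_alg.const)
    fix p :: "real^4"
    have "((\<lambda>p. p$i) has_derivative (\<lambda>h. h$i)) (at p)"
      by (rule bounded_linear.has_derivative[OF bounded_linear_vec_nth has_derivative_ident])
    moreover have "(\<lambda>h :: real^4. h$i) = (\<lambda>h. ?g 1 p * h$1 + ?g 2 p * h$2 + ?g 3 p * h$3 + ?g 4 p * h$4)"
      using exhaust_4[of i] by auto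
    ultimately show "((\<lambda>p. p$i) has_derivative (\<lambda>h. ?g 1 p * h$1 + ?g 2 p * h$2 + ?g 3 p * h$3 + ?g 4 p * h$4)) (at p)"
      by simp
  qed
next
  case inv_rad
  show ?case
  proof (rule has_tower_alg_grad_rd)
    fix p assume "M < rad p"
    then have p: "0 < rad p" using M_pos by simp
    show "rd (\<lambda>p. 1 / rad p) 0 ((-1) * ((1 / rad p) * (1 / rad p))) p"
      by (rule rd_radial[OF _ p]) (use p in \<open>auto intro!: derivative_eq_intros simp: power2_eq_square\<close>)
  qed (intro tower_alg.intros)+
next
  case inv_rad_M
  show ?case
  proof (rule has_tower_alg_grad_rd)
    fix p assume "M < rad p"
    then have p: "0 < rad p" "rad p - M \<noteq> 0" using M_pos by auto
    show "rd (\<lambda>p. 1 / (rad p - M)) 0 ((-1) * ((1 / (rad p - M)) * (1 / (rad p - M)))) p"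
      by (rule rd_radial[OF _ p(1)]) (use p in \<open>auto intro!: derivative_eq_intros simp: power2_eq_square\<close>)
  qed (intro tower_alg.intros)+
next
  case (A k)
  show ?case
  proof (rule has_tower_alg_grad_rd)
    fix p assume p: "M < rad p"
    have "dtort (rad p) = 2 * (rad p * rad p * ((1 / (rad p - M)) * (1 / (rad p - M))))"
      by (simp add: dtort_alt[OF p] power2_eq_square)
    with tower_rd(1)[OF t p, of k]
    show "rd (\<lambda>p. A k (p$1) (rad p)) (A (Suc k) (p$1) (rad p))
       ((2 * (rad p * rad p * ((1 / (rad p - M)) * (1 / (rad p - M))))) *
          (B k (p$1) (rad p) + (-1) * A (Suc k) (p$1) (rad p))) p" by simp
  qed (intro tower_alg.intros tower_alg_rad)+
next
  case (B k)
  show ?case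
  proof (rule has_tower_alg_grad_rd)
    fix p assume p: "M < rad p"
    have "pot (rad p) = M * (rad p + (- M)) * (((1 / rad p) * (1 / rad p)) * ((1 / rad p) * (1 / rad p)))"
      by (simp add: pot_def power4_eq_xxxx)
    with tower_rd(2)[OF t p, of k]
    show "rd (\<lambda>p. B k (p$1) (rad p)) (B (Suc k) (p$1) (rad p))
       (M * (rad p + (- M)) * (((1 / rad p) * (1 / rad p)) * ((1 / rad p) * (1 / rad p))) * A k (p$1) (rad p)) p" by simp
  qed (intro tower_alg.intros tower_alg_rad)+
next
  case (add f g)
  from add.IH(1) obtain df :: "4 \<Rightarrow> real^4 \<Rightarrow> real" where df: "(\<forall>i. tower_alg A B (df i)) \<and>
      (\<forall>p\<in>exterior_open M. (f has_derivative (\<lambda>h. df 1 p * h$1 + df 2 p * h$2 + df 3 p * h$3 + df 4 p * h$4)) (at p))"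
    unfolding has_tower_alg_grad_def ..
  from add.IH(2) obtain dg :: "4 \<Rightarrow> real^4 \<Rightarrow> real" where dg: "(\<forall>i. tower_alg A B (dg i)) \<and>
      (\<forall>p\<in>exterior_open M. (g has_derivative (\<lambda>h. dg 1 p * h$1 + dg 2 p * h$2 + dg 3 p * h$3 + dg 4 p * h$4)) (at p))"
    unfolding has_tower_alg_grad_def ..
  note * = df[THEN conjunct1, rule_format] dg[THEN conjunct1, rule_format]
  note d = df[THEN conjunct2] dg[THEN conjunct2]
  show ?case unfolding has_tower_alg_grad_def
  proof (intro exI conjI allI ballI)
    show "tower_alg A B (\<lambda>p. df i p + dg i p)" for i by (intro tower_alg.add *)
    fix p assume p: "p \<in> exterior_open M"
    from has_derivative_add[OF d(1)[rule_format, OF p] d(2)[rule_format, OF p]]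
    show "((\<lambda>p. f p + g p) has_derivative (\<lambda>h. (df 1 p + dg 1 p) * h$1 + (df 2 p + dg 2 p) * h$2
        + (df 3 p + dg 3 p) * h$3 + (df 4 p + dg 4 p) * h$4)) (at p)"
      by (rule has_derivative_eq_rhs) (simp add: algebra_simps)
  qed
next
  case (mult f g)
  from mult.IH(1) obtain df :: "4 \<Rightarrow> real^4 \<Rightarrow> real" where df: "(\<forall>i. tower_alg A B (df i)) \<and>
      (\<forall>p\<in>exterior_open M. (f has_derivative (\<lambda>h. df 1 p * h$1 + df 2 p * h$2 + df 3 p * h$3 + df 4 p * h$4)) (at p))"
    unfolding has_tower_alg_grad_def ..
  from mult.IH(2) obtain dg :: "4 \<Rightarrow> real^4 \<Rightarrow> real" where dg: "(\<forall>i. tower_alg A B (dg i)) \<and>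
      (\<forall>p\<in>exterior_open M. (g has_derivative (\<lambda>h. dg 1 p * h$1 + dg 2 p * h$2 + dg 3 p * h$3 + dg 4 p * h$4)) (at p))"
    unfolding has_tower_alg_grad_def ..
  note * = df[THEN conjunct1, rule_format] dg[THEN conjunct1, rule_format]
  note d = df[THEN conjunct2] dg[THEN conjunct2]
  show ?case unfolding has_tower_alg_grad_def
  proof (intro exI conjI allI ballI)
    show "tower_alg A B (\<lambda>p. f p * dg i p + df i p * g p)" for i by (intro tower_alg.add tower_alg.mult * mult.hyps)
    fix p assume p: "p \<in> exterior_open M"
    from has_derivative_mult[OF d(1)[rule_format, OF p] d(2)[rule_format, OF p]]
    show "((\<lambda>p. f p * g p) has_derivative (\<lambda>h. (f p * dg 1 p + df 1 p * g p) * h$1 + (f p * dg 2 p + df 2 p * g p) * h$2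
        + (f p * dg 3 p + df 3 p * g p) * h$3 + (f p * dg 4 p + df 4 p * g p) * h$4)) (at p)"
      by (rule has_derivative_eq_rhs) (simp add: algebra_simps)
  qed
qed

lemma tower_smooth:
  assumes t: "tower A B" and \<psi>: "\<And>p. M < rad p \<Longrightarrow> \<psi> p = A 0 (p$1) (rad p) / rad p"
  shows "smooth_on (exterior_open M) \<psi>"
  unfolding smooth_on_def
proof (intro exI conjI allI)
  let ?F = "\<lambda>p. A 0 (p$1) (rad p) * (1 / rad p)"
  show "open (exterior_open M)" by (rule open_exterior_open)
  show "\<forall>p\<in>exterior_open M. \<psi> p = ?F p" by (simp add: \<psi> exterior_open_def)
  show "C_on k ?F (exterior_open M)" for k
  proof (rule C_on_closed_class[where P = "tower_alg A B"])
    show "open (exterior_open M)" by (rule open_exterior_open)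
    show "tower_alg A B ?F" by (intro tower_alg.mult tower_alg.A tower_alg.inv_rad)
    fix f assume "tower_alg A B f"
    from tower_alg_grad[OF t this] obtain g :: "4 \<Rightarrow> real^4 \<Rightarrow> real" where g: "(\<forall>i. tower_alg A B (g i)) \<and>
      (\<forall>p\<in>exterior_open M. (f has_derivative (\<lambda>h. g 1 p * h$1 + g 2 p * h$2 + g 3 p * h$3 + g 4 p * h$4)) (at p))"
      unfolding has_tower_alg_grad_def ..
    show "\<exists>f'. (\<forall>x\<in>exterior_open M. (f has_derivative f' x) (at x)) \<and> (\<forall>b\<in>Basis. tower_alg A B (\<lambda>x. f' x b))"
    proof (intro exI conjI ballI)
      fix b :: "real^4"
      show "tower_alg A B (\<lambda>p. g 1 p * b$1 + g 2 p * b$2 + g 3 p * b$3 + g 4 p * b$4)"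
        by (intro tower_alg.add tower_alg.mult g[THEN conjunct1, rule_format] tower_alg.const)
    next
      fix x assume "x \<in> exterior_open M"
      with g show "(f has_derivative (\<lambda>h. g 1 x * h$1 + g 2 x * h$2 + g 3 x * h$3 + g 4 x * h$4)) (at x)" by simp
    qed
  qed
qed auto

lemma tower_psi_rd:
  assumes t: "tower A B" and \<psi>: "\<And>p. M < rad p \<Longrightarrow> \<psi> p = A 0 (p$1) (rad p) / rad p" and p: "M < rad p"
  shows "rd \<psi> (A 1 (p$1) (rad p) / rad p)
     (dtort (rad p) * (B 0 (p$1) (rad p) - A 1 (p$1) (rad p)) / rad p - A 0 (p$1) (rad p) / (rad p)\<^sup>2) p"
proof -
  have p0: "0 < rad p" using p M_pos by simp
  have "((\<lambda>r. 1 / r) has_real_derivative - (1 / (rad p)\<^sup>2)) (at (rad p))"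
    using p0 by (auto intro!: derivative_eq_intros simp: power2_eq_square)
  from rd_mult[OF tower_rd(1)[OF t p, of 0] rd_radial[OF this p0]]
  have "rd (\<lambda>q. A 0 (q$1) (rad q) * (1 / rad q)) (A 1 (p$1) (rad p) / rad p)
     (dtort (rad p) * (B 0 (p$1) (rad p) - A 1 (p$1) (rad p)) / rad p - A 0 (p$1) (rad p) / (rad p)\<^sup>2) p"
    by simp
  then show ?thesis
    by (rule rd_transform[OF _ open_exterior_open[of M]]) (use p \<psi> in \<open>auto simp: exterior_open_def\<close>)
qed

lemma tower_phi_rd:
  assumes t: "tower A B" and \<psi>: "\<And>p. M < rad p \<Longrightarrow> \<psi> p = A 0 (p$1) (rad p) / rad p" and p: "M < rad p"
  shows "rd (\<lambda>q. rad q * \<psi> q) (A 1 (p$1) (rad p))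
     (dtort (rad p) * (B 0 (p$1) (rad p) - A 1 (p$1) (rad p))) p"
  by (rule rd_transform[OF tower_rd(1)[OF t p, of 0, unfolded One_nat_def[symmetric]] open_exterior_open[of M]])
     (use p \<psi> M_pos in \<open>auto simp: exterior_open_def\<close>)

lemma apply_L_rd:
  assumes r: "rd f a b p"
  shows "apply_vf (L_vf M) f p = a + Dfun M (rad p) / 2 * b"
    and "apply_vf (Lbar_vf M) f p = - (Dfun M (rad p) / 2 * b)"
proof -
  have p: "0 < rad p" using r by (simp add: rd_def)
  have u: "(p$2 / rad p) * (p$2 / rad p) + (p$3 / rad p) * (p$3 / rad p) + (p$4 / rad p) * (p$4 / rad p) = 1"
    using rad_unit[OF p] by (simp add: power2_eq_square)
  define x y z where "x = p$2 / rad p" and "y = p$3 / rad p" and "z = p$4 / rad p"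
  have u': "x * x + y * y + z * z = 1" using u by (simp add: x_def y_def z_def)
  have "apply_vf (L_vf M) f p = a + Dfun M (rad p) / 2 * b * (x * x + y * y + z * z)"
    unfolding apply_vf_def sum_4 L_vf_def T_vf_def R_vf_def
    by (simp add: pd_rd[OF r] axis_def x_def[symmetric] y_def[symmetric] z_def[symmetric] algebra_simps)
  then show "apply_vf (L_vf M) f p = a + Dfun M (rad p) / 2 * b" by (simp add: u')
  have "apply_vf (Lbar_vf M) f p = - (Dfun M (rad p) / 2 * b * (x * x + y * y + z * z))"
    unfolding apply_vf_def sum_4 Lbar_vf_def R_vf_def
    by (simp add: pd_rd[OF r] axis_def x_def[symmetric] y_def[symmetric] z_def[symmetric] algebra_simps)
  then show "apply_vf (Lbar_vf M) f p = - (Dfun M (rad p) / 2 * b)" by (simp add: u')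
qed

lemma tower_L:
  assumes t: "tower A B" and \<psi>: "\<And>p. M < rad p \<Longrightarrow> \<psi> p = A 0 (p$1) (rad p) / rad p" and p: "M < rad p"
  shows "apply_vf (L_vf M) (\<lambda>q. rad q * \<psi> q) p = B 0 (p$1) (rad p)"
    and "apply_vf (Lbar_vf M) (\<lambda>q. rad q * \<psi> q) p = A 1 (p$1) (rad p) - B 0 (p$1) (rad p)"
proof -
  let ?x = "B 0 (p$1) (rad p) - A 1 (p$1) (rad p)"
  have "Dfun M (rad p) / 2 * (dtort (rad p) * ?x) = (Dfun M (rad p) * dtort (rad p)) * ?x / 2" by simp
  also have "\<dots> = ?x" by (simp add: Dfun_dtort[OF p])
  finally have e: "Dfun M (rad p) / 2 * (dtort (rad p) * ?x) = ?x" .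
  from apply_L_rd[OF tower_phi_rd[OF t \<psi> p], unfolded e]
  show "apply_vf (L_vf M) (\<lambda>q. rad q * \<psi> q) p = B 0 (p$1) (rad p)"
    "apply_vf (Lbar_vf M) (\<lambda>q. rad q * \<psi> q) p = A 1 (p$1) (rad p) - B 0 (p$1) (rad p)"
    by simp_all
qed

text \<open>The gradient of \<open>\<psi>\<close> has \<open>v\<close>-component \<open>\<partial>\<^sub>r \<psi>\<close> (\<open>PR\<close> below) and spatial part \<open>y * K\<close> with
  \<open>r * K = \<partial>\<^sub>v \<psi> + D \<partial>\<^sub>r \<psi>\<close>. As the volume density is one, its divergence is
  \<open>\<partial>\<^sub>v PR + 3 K + r \<partial>\<^sub>r K\<close>, and the tower rules make the terms cancel.\<close>

lemma tower_box:
  assumes t: "tower A B" and \<psi>: "\<And>p. M < rad p \<Longrightarrow> \<psi> p = A 0 (p$1) (rad p) / rad p" and p: "M < rad p"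
  shows "box M \<psi> p = 0"
proof -
  let ?S = "exterior_open M"
  note S = open_exterior_open[of M]
  have pS: "p \<in> ?S" using p by (simp add: exterior_open_def)
  have p0: "0 < rad p" using p M_pos by simp
  define PR where "PR q = dtort (rad q) * (B 0 (q$1) (rad q) - A 1 (q$1) (rad q)) / rad q - A 0 (q$1) (rad q) / (rad q)\<^sup>2" for q
  define K where "K q = (1 / (rad q)\<^sup>2) * (2 * B 0 (q$1) (rad q) + (-1) * A 1 (q$1) (rad q))
      + (- Dfun M (rad q) / (rad q) ^ 3) * A 0 (q$1) (rad q)" for q
  let ?W = "\<lambda>a q. vol_density M q * (\<Sum>b\<in>UNIV. inv_metric M q $ a $ b * pd b \<psi> q)"
  have W: "?W 1 q = PR q" "i \<noteq> 1 \<Longrightarrow> ?W i q = q$i * K q" if "q \<in> ?S" for q and i :: 4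
  proof -
    have q: "M < rad q" "0 < rad q" using that M_pos by (auto simp: exterior_open_def)
    have r: "rd \<psi> (A 1 (q$1) (rad q) / rad q) (PR q) q"
      unfolding PR_def by (rule tower_psi_rd[OF t \<psi> q(1)])
    have pd: "pd i \<psi> q = (if i = 1 then A 1 (q$1) (rad q) / rad q else PR q * (q$i / rad q))" for i
      by (rule pd_rd[OF r])
    define x y z where "x = q$2 / rad q" and "y = q$3 / rad q" and "z = q$4 / rad q"
    have u: "x\<^sup>2 + y\<^sup>2 + z\<^sup>2 = 1" using rad_unit[OF q(2)] by (simp add: x_def y_def z_def)
    have P: "A 1 (q$1) (rad q) / rad q + Dfun M (rad q) * PR q = rad q * K q"
    proof -
      have "Dfun M (rad q) * PR q = (Dfun M (rad q) * dtort (rad q)) * (B 0 (q$1) (rad q) - A 1 (q$1) (rad q)) / rad q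
          - Dfun M (rad q) * A 0 (q$1) (rad q) / (rad q)\<^sup>2"
        by (simp add: PR_def right_diff_distrib)
      then have "Dfun M (rad q) * PR q = 2 * (B 0 (q$1) (rad q) - A 1 (q$1) (rad q)) / rad q
          - Dfun M (rad q) * A 0 (q$1) (rad q) / (rad q)\<^sup>2"
        by (simp add: Dfun_dtort[OF q(1)])
      moreover have "rad q * K q = (2 * B 0 (q$1) (rad q) + (-1) * A 1 (q$1) (rad q)) / rad q
          - Dfun M (rad q) * A 0 (q$1) (rad q) / (rad q)\<^sup>2"
        using q(2) by (simp add: K_def distrib_left right_diff_distrib diff_divide_distrib power2_eq_square power3_eq_cube)
      ultimately show ?thesis by (simp add: add_divide_distrib diff_divide_distrib)
    qed
    have "PR q * (x * x) + PR q * (y * y) + PR q * (z * z) = PR q" using u by algebra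
    then show "?W 1 q = PR q"
      unfolding sum_4 by (simp add: vol_density_one[OF q(2)] pd inv_metric_entry[OF q(2)]
          x_def[symmetric] y_def[symmetric] z_def[symmetric] algebra_simps)
    show "?W i q = q$i * K q" if "i \<noteq> 1"
    proof -
      define c d where "c = A 1 (q$1) (rad q) / rad q" and "d = Dfun M (rad q)"
      have pdc: "pd i \<psi> q = (if i = 1 then c else PR q * (q$i / rad q))" for i
        unfolding c_def by (rule pd)
      have e: "x * c + (1 + (d - 1) * (x * x)) * (P * x) + (d - 1) * (x * y) * (P * y) + (d - 1) * (x * z) * (P * z) = x * (c + d * P)"
        "y * c + (d - 1) * (y * x) * (P * x) + (1 + (d - 1) * (y * y)) * (P * y) + (d - 1) * (y * z) * (P * z) = y * (c + d * P)"
        "z * c + (d - 1) * (z * x) * (P * x) + (d - 1) * (z * y) * (P * y) + (1 + (d - 1) * (z * z)) * (P * z) = z * (c + d * P)" for P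
        using u by algebra+
      have "?W i q = (q$i / rad q) * (c + d * PR q)"
        using exhaust_4[of i] that e[of "PR q"] unfolding sum_4
        by (elim disjE) (simp_all add: vol_density_one[OF q(2)] pdc inv_metric_entry[OF q(2)]
            x_def[symmetric] y_def[symmetric] z_def[symmetric] d_def[symmetric])
      then have "?W i q = (q$i / rad q) * (A 1 (q$1) (rad q) / rad q + Dfun M (rad q) * PR q)"
        by (simp only: c_def d_def)
      then show ?thesis unfolding P using q(2) by simp
    qed
  qed
  define a0 a1 a2 b0 b1 r where "a0 = A 0 (p$1) (rad p)" and "a1 = A 1 (p$1) (rad p)" and "a2 = A 2 (p$1) (rad p)"
    and "b0 = B 0 (p$1) (rad p)" and "b1 = B 1 (p$1) (rad p)" and "r = rad p"
  have r0: "0 < r" using p0 by (simp add: r_def)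
  note rA0 = tower_rd(1)[OF t p, of 0, unfolded One_nat_def[symmetric]]
  note rA1 = tower_rd(1)[OF t p, of 1, unfolded Suc_1]
  note rB0 = tower_rd(2)[OF t p, of 0, unfolded One_nat_def[symmetric]]
  obtain PRr where PRr: "rd PR (dtort r * (b1 - a2) / r - a1 / r\<^sup>2) PRr p"
  proof -
    define g1 where "g1 r = dtort r / r" for r
    define g2 where "g2 r = - (1 / r\<^sup>2)" for r :: real
    have "\<exists>d. (dtort has_real_derivative d) (at (rad p))"
      unfolding dtort_def[abs_def] using p0 Dfun_pos[OF p]
      by (intro exI) (auto intro!: derivative_eq_intros Dfun_deriv)
    then obtain d where d: "(dtort has_real_derivative d) (at (rad p))" by blast
    have "(g1 has_real_derivative (d * rad p - dtort (rad p) * 1) / (rad p * rad p)) (at (rad p))"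
      unfolding g1_def[abs_def] by (rule DERIV_divide[OF d DERIV_ident]) (use p0 in simp)
    note r1 = rd_radial[OF this p0]
    have "(g2 has_real_derivative 2 * rad p / (rad p ^ 4)) (at (rad p))"
      unfolding g2_def[abs_def] using p0
      by (auto intro!: derivative_eq_intros simp: power2_eq_square power4_eq_xxxx)
    note r2 = rd_radial[OF this p0]
    from rd_add[OF rd_mult[OF r1 rd_add[OF rB0 rd_mult[OF rd_const[OF p0, of "-1"] rA1]]] rd_mult[OF r2 rA0]]
    obtain PRr where "rd (\<lambda>q. g1 (rad q) * (B 0 (q$1) (rad q) + (-1) * A 1 (q$1) (rad q)) + g2 (rad q) * A 0 (q$1) (rad q))
        (g1 r * (b1 - a2) + g2 r * a1) PRr p"
      by (simp add: r_def b1_def a2_def a1_def)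
    moreover have "(\<lambda>q. g1 (rad q) * (B 0 (q$1) (rad q) + (-1) * A 1 (q$1) (rad q)) + g2 (rad q) * A 0 (q$1) (rad q)) = PR"
      by (simp add: fun_eq_iff PR_def g1_def g2_def)
    ultimately show ?thesis using that by (simp add: g1_def g2_def)
  qed
  have Kr: "\<exists>Kv. rd K Kv ((- 2 / r ^ 3) * (2 * b0 - a1) + (1 / r\<^sup>2) * (2 * (pot r * a0) - dtort r * (b1 - a2))
      + (- (2 * r * pot r) / r ^ 3 + 3 * Dfun M r / r ^ 4) * a0 + (- Dfun M r / r ^ 3) * (dtort r * (b0 - a1))) p"
  proof -
    have "((\<lambda>r. 1 / r\<^sup>2) has_real_derivative (- 2 / r ^ 3)) (at (rad p))"
      using r0 unfolding r_def[symmetric] by (auto intro!: derivative_eq_intros simp: field_simps power2_eq_square power3_eq_cube)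
    note r1 = rd_radial[OF this p0]
    have "((\<lambda>r. - Dfun M r / r ^ 3) has_real_derivative (- (2 * r * pot r) / r ^ 3 + 3 * Dfun M r / r ^ 4)) (at (rad p))"
      using r0 unfolding r_def[symmetric]
      by (auto intro!: derivative_eq_intros Dfun_deriv simp: field_simps power2_eq_square power3_eq_cube power4_eq_xxxx)
    note r2 = rd_radial[OF this p0]
    from rd_add[OF rd_mult[OF r1 rd_add[OF rd_mult[OF rd_const[OF p0, of 2] rB0] rd_mult[OF rd_const[OF p0, of "-1"] rA1]]] rd_mult[OF r2 rA0]]
    show ?thesis
      unfolding K_def[abs_def] by (intro exI) (simp add: r_def b1_def b0_def a2_def a1_def a0_def algebra_simps)
  qed
  then obtain Kv where Kr: "rd K Kv ((- 2 / r ^ 3) * (2 * b0 - a1) + (1 / r\<^sup>2) * (2 * (pot r * a0) - dtort r * (b1 - a2))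
      + (- (2 * r * pot r) / r ^ 3 + 3 * Dfun M r / r ^ 4) * a0 + (- Dfun M r / r ^ 3) * (dtort r * (b0 - a1))) p" (is "rd K Kv ?Kr p")
    by blast
  have pd1: "pd 1 (?W 1) p = dtort r * (b1 - a2) / r - a1 / r\<^sup>2"
    using pd_transform[OF S pS W(1) PRr[unfolded rd_def, THEN conjunct2], of 1] by (simp add: axis_def)
  have pdi: "pd i (?W i) p = K p + p$i * (?Kr * (p$i / r))" if i: "i \<noteq> 1" for i
  proof -
    have c: "((\<lambda>q. q$i) has_derivative (\<lambda>h. h$i)) (at p)"
      by (rule bounded_linear.has_derivative[OF bounded_linear_vec_nth has_derivative_ident])
    from pd_transform[OF S pS W(2)[OF _ i] has_derivative_mult[OF c Kr[unfolded rd_def, THEN conjunct2]], of i]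
    show ?thesis using exhaust_4[of i] i by (auto simp: axis_def r_def)
  qed
  have "box M \<psi> p = dtort r * (b1 - a2) / r - a1 / r\<^sup>2 + 3 * K p + ?Kr * ((p$2 * p$2 + p$3 * p$3 + p$4 * p$4) / r)"
  proof -
    have n: "(2::4) \<noteq> 1" "(3::4) \<noteq> 1" "(4::4) \<noteq> 1" by simp_all
    have "(\<Sum>a\<in>UNIV. pd a (?W a) p) = dtort r * (b1 - a2) / r - a1 / r\<^sup>2
        + (K p + p$2 * (?Kr * (p$2 / r))) + (K p + p$3 * (?Kr * (p$3 / r))) + (K p + p$4 * (?Kr * (p$4 / r)))"
      unfolding sum_4[of "\<lambda>a. pd a (?W a) p"] pd1 pdi[OF n(1)] pdi[OF n(2)] pdi[OF n(3)] by (rule refl)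
    also have "\<dots> = dtort r * (b1 - a2) / r - a1 / r\<^sup>2 + 3 * K p + ?Kr * ((p$2 * p$2 + p$3 * p$3 + p$4 * p$4) / r)"
    proof -
      have "A + (k + x * (y * (x / r))) + (k + x' * (y * (x' / r))) + (k + x'' * (y * (x'' / r)))
          = A + 3 * k + y * ((x * x + x' * x' + x'' * x'') / r)" for A k x y x' x'' r :: real
        by (simp add: algebra_simps add_divide_distrib)
      then show ?thesis .
    qed
    finally show ?thesis unfolding box_def vol_density_one[OF p0] by simp
  qed
  also have "(p$2 * p$2 + p$3 * p$3 + p$4 * p$4) / r = r"
    using p0 unfolding r_def rad_def by (simp add: power2_eq_square real_div_sqrt)
  also have "K p = (2 * b0 - a1) / r\<^sup>2 - Dfun M r * a0 / r ^ 3"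
    by (simp add: K_def a0_def a1_def b0_def r_def)
  also have "dtort r * (b1 - a2) / r - a1 / r\<^sup>2 + 3 * ((2 * b0 - a1) / r\<^sup>2 - Dfun M r * a0 / r ^ 3) + ?Kr * r = 0"
  proof -
    have D: "Dfun M r * dtort r = 2" using Dfun_dtort[OF p] by (simp add: r_def)
    have "(- Dfun M r / r ^ 3) * (dtort r * (b0 - a1)) = - (Dfun M r * dtort r) * (b0 - a1) / r ^ 3" by simp
    also have "\<dots> = - 2 * (b0 - a1) / r ^ 3" by (simp add: D)
    finally have e: "(- Dfun M r / r ^ 3) * (dtort r * (b0 - a1)) = - 2 * (b0 - a1) / r ^ 3" .
    show ?thesis unfolding e using r0 by (simp add: field_simps power2_eq_square power3_eq_cube power4_eq_xxxx)
  qed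
  finally show ?thesis .
qed

end

section \<open>The oscillating algebra\<close>

text \<open>Two building blocks whose derivatives are polynomials in them. \<open>env\<close> behaves like
  \<open>u\<^sup>-\<^sup>1\<^sup>/\<^sup>2\<close> for \<open>u \<longlongrightarrow> \<infinity>\<close> and tends to one for \<open>u \<longlongrightarrow> -\<infinity>\<close>; its derivative is
  \<open>- env\<^sup>3 logi / 2\<close>, so \<open>env\<^sup>3 logi\<close> decays like \<open>u\<^sup>-\<^sup>3\<^sup>/\<^sup>2\<close> and is integrable over the whole line
  with the explicit bounded primitive \<open>-2 env\<close>.\<close>

definition logi :: "real \<Rightarrow> real" where "logi u = exp u / (1 + exp u)"
definition env :: "real \<Rightarrow> real" where "env u = 1 / sqrt (1 + ln (1 + exp u))"

lemma logi_bounds: "0 < logi u" "logi u < 1"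
  by (auto simp: logi_def field_simps add_pos_pos)

lemma logi_half: "0 \<le> u \<Longrightarrow> 1 / 2 \<le> logi u"
  by (simp add: logi_def field_simps add_pos_pos)

lemma ln_exp_pos: "0 < ln (1 + exp (u::real))" by (simp add: ln_gt_zero)

lemma env_bounds: "0 < env u" "env u \<le> 1"
  using ln_exp_pos[of u] by (auto simp: env_def field_simps)

lemma env_sq: "(env u)\<^sup>2 = 1 / (1 + ln (1 + exp u))"
  using ln_exp_pos[of u] by (simp add: env_def power_divide)

lemma env_antimono: assumes "u \<le> t" shows "env t \<le> env u"
proof -
  have "ln (1 + exp u) \<le> ln (1 + exp t)" using assms by (simp add: add_pos_pos)
  then show ?thesis unfolding env_def using ln_exp_pos[of u] by (intro divide_left_mono) auto
qed

lemma env_sq_upper: assumes "0 \<le> u" shows "(env u)\<^sup>2 \<le> 1 / (1 + u)"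
proof -
  have "ln (exp u) \<le> ln (1 + exp u)" by (subst ln_le_cancel_iff) (auto simp: add_pos_pos)
  then show ?thesis unfolding env_sq using assms by (intro divide_left_mono) auto
qed

lemma env_sq_lower: assumes "0 \<le> u" shows "1 / (2 * (1 + u)) \<le> (env u)\<^sup>2"
proof -
  have "ln (1 + exp u) \<le> ln (exp (u + 1))"
  proof (subst ln_le_cancel_iff)
    have "exp u * 2 \<le> exp u * exp 1" using exp_ge_add_one_self[of 1] by (intro mult_left_mono) auto
    moreover have "1 \<le> exp u" using assms by simp
    ultimately show "1 + exp u \<le> exp (u + 1)" unfolding exp_add by linarith
  qed (auto simp: add_pos_pos)
  then show ?thesis unfolding env_sq using assms ln_exp_pos[of u] by (intro divide_left_mono) auto
qed

lemma env_six_upper: assumes "0 \<le> u" shows "(env u ^ 3)\<^sup>2 \<le> 1 / (1 + u) ^ 3"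
proof -
  have "(env u ^ 3)\<^sup>2 = ((env u)\<^sup>2) ^ 3" by (simp add: power_mult[symmetric])
  also have "\<dots> \<le> (1 / (1 + u)) ^ 3" by (intro power_mono env_sq_upper assms) simp
  finally show ?thesis by (simp add: power_divide)
qed

lemma env_six_lower: assumes "0 \<le> u" shows "1 / (8 * (1 + u) ^ 3) \<le> (env u ^ 3)\<^sup>2"
proof -
  have "1 / (8 * (1 + u) ^ 3) = (1 / (2 * (1 + u))) ^ 3" by (simp only: power_divide power_mult_distrib) simp
  also have "\<dots> \<le> ((env u)\<^sup>2) ^ 3" by (intro power_mono env_sq_lower assms) (use assms in simp)
  also have "\<dots> = (env u ^ 3)\<^sup>2" by (simp add: power_mult[symmetric])
  finally show ?thesis .
qed

lemma env_tendsto: "(env \<longlongrightarrow> 0) at_top"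
proof (rule tendstoI)
  fix e :: real assume e: "0 < e"
  have "eventually (\<lambda>u. 0 \<le> u \<and> 1 / e\<^sup>2 < u) at_top"
    using eventually_ge_at_top[of 0] eventually_gt_at_top[of "1 / e\<^sup>2"] by eventually_elim simp
  then show "\<forall>\<^sub>F u in at_top. dist (env u) 0 < e"
  proof eventually_elim
    case (elim u)
    have u: "0 \<le> u" "1 / e\<^sup>2 < 1 + u" using elim by auto
    have "0 < 1 / e\<^sup>2" using e by simp
    with u have "1 / (1 + u) < 1 / (1 / e\<^sup>2)" by (intro divide_strict_left_mono mult_pos_pos) auto
    also have "1 / (1 / e\<^sup>2) = e\<^sup>2" by simp
    finally have "(env u)\<^sup>2 < e\<^sup>2" using env_sq_upper[OF u(1)] by linarith
    then have "env u < e" by (rule power2_less_imp_less) (use e in simp)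
    then show ?case using env_bounds(1)[of u] by (simp add: dist_real_def)
  qed
qed

lemma logi_deriv: "(logi has_real_derivative logi u * (1 - logi u)) (at u)"
proof -
  have p: "1 + exp u \<noteq> 0" using exp_gt_zero[of u] by linarith
  have "((\<lambda>u. exp u / (1 + exp u)) has_real_derivative
      (exp u * (1 + exp u) - exp u * exp u) / ((1 + exp u) * (1 + exp u))) (at u)"
    by (rule DERIV_divide) (use p in \<open>auto intro!: derivative_eq_intros\<close>)
  moreover have "(exp u * (1 + exp u) - exp u * exp u) / ((1 + exp u) * (1 + exp u)) = logi u * (1 - logi u)"
  proof -
    have "1 - logi u = 1 / (1 + exp u)" unfolding logi_def using p by (simp add: diff_divide_eq_iff)
    then show ?thesis unfolding logi_def by (simp add: distrib_left)
  qed
  ultimately show ?thesis unfolding logi_def[abs_def] by simp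
qed

lemma env_deriv: "(env has_real_derivative - (1 / 2) * env u ^ 3 * logi u) (at u)"
proof -
  let ?l = "1 + ln (1 + exp u)"
  have l: "0 < ?l" using ln_exp_pos[of u] by simp
  have p: "0 < 1 + exp u" by (simp add: add_pos_pos)
  have s: "((\<lambda>u. sqrt (1 + ln (1 + exp u))) has_real_derivative inverse (sqrt ?l) / 2 * logi u) (at u)"
    using l p by (auto intro!: derivative_eq_intros simp: logi_def)
  have d: "((\<lambda>u. inverse (sqrt (1 + ln (1 + exp u)))) has_real_derivative
      - (inverse (sqrt ?l) * (inverse (sqrt ?l) / 2 * logi u) * inverse (sqrt ?l))) (at u)"
    by (rule DERIV_inverse'[OF s]) (use l in simp)
  have e: "env = (\<lambda>u. inverse (sqrt (1 + ln (1 + exp u))))"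
    by (simp add: fun_eq_iff env_def divide_inverse)
  have eq: "- (inverse (sqrt ?l) * (inverse (sqrt ?l) / 2 * logi u) * inverse (sqrt ?l)) = - (1 / 2) * env u ^ 3 * logi u"
    by (simp add: e power3_eq_cube)
  have "(env has_real_derivative - (inverse (sqrt ?l) * (inverse (sqrt ?l) / 2 * logi u) * inverse (sqrt ?l))) (at u)"
    using d by (simp only: e)
  then show ?thesis by (simp only: eq)
qed

text \<open>All generators are bounded and the algebra is closed under differentiation. Hence every element
  has bounded derivatives of every order, which is what a tower built on it needs.\<close>

inductive osc :: "real \<Rightarrow> (real \<Rightarrow> real) \<Rightarrow> bool" for l where
  const: "osc l (\<lambda>_. c)"
| env: "osc l env"
| logi: "osc l logi"
| sin: "osc l (\<lambda>u. sin (l * u))"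
| cos: "osc l (\<lambda>u. cos (l * u))"
| add: "osc l f \<Longrightarrow> osc l g \<Longrightarrow> osc l (\<lambda>u. f u + g u)"
| mult: "osc l f \<Longrightarrow> osc l g \<Longrightarrow> osc l (\<lambda>u. f u * g u)"

lemma osc_power: assumes "osc l f" shows "osc l (\<lambda>u. f u ^ n)"
proof (induction n)
  case 0 show ?case unfolding power_0 by (rule osc.const)
next
  case (Suc n) show ?case unfolding power_Suc by (rule osc.mult[OF assms Suc])
qed

lemma osc_bounded: "osc l f \<Longrightarrow> \<exists>K. \<forall>u. \<bar>f u\<bar> \<le> K"
proof (induction rule: osc.induct)
  case (const c) then show ?case by auto
next
  case env
  have "\<bar>env u\<bar> \<le> 1" for u using env_bounds[of u] by simp
  then show ?case by blast
next
  case logi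
  have "\<bar>logi u\<bar> \<le> 1" for u using logi_bounds[of u] by simp
  then show ?case by blast
next
  case (add f g)
  then obtain K L where "\<forall>u. \<bar>f u\<bar> \<le> K" "\<forall>u. \<bar>g u\<bar> \<le> L" by auto
  then have "\<bar>f u + g u\<bar> \<le> K + L" for u
    using abs_triangle_ineq[of "f u" "g u"] by (meson add_mono order_trans)
  then show ?case by blast
next
  case (mult f g)
  then obtain K L where "\<forall>u. \<bar>f u\<bar> \<le> K" "\<forall>u. \<bar>g u\<bar> \<le> L" by auto
  then have "\<bar>f u * g u\<bar> \<le> K * L" for u
    unfolding abs_mult using abs_ge_zero[of "f u"] by (intro mult_mono) (auto intro: order.trans)
  then show ?case by blast
next
  case sin
  have "\<bar>sin (l * u)\<bar> \<le> 1" for u by simp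
  then show ?case by blast
next
  case cos
  have "\<bar>cos (l * u)\<bar> \<le> 1" for u by simp
  then show ?case by blast
qed

lemma osc_deriv: "osc l f \<Longrightarrow> \<exists>g. osc l g \<and> (\<forall>u. (f has_real_derivative g u) (at u))"
proof (induction rule: osc.induct)
  case (const c)
  show ?case by (rule exI[of _ "\<lambda>_. 0"]) (simp add: osc.const)
next
  case env
  have o: "osc l (\<lambda>u. (- (1 / 2)) * env u ^ 3 * logi u)" by (intro osc.mult osc.const osc_power osc.env osc.logi)
  show ?case by (rule exI, rule conjI[OF o], rule allI, rule env_deriv)
next
  case logi
  have o: "osc l (\<lambda>u. logi u * (1 + (-1) * logi u))" by (intro osc.mult osc.add osc.const osc.logi)
  have "(logi has_real_derivative logi u * (1 + (-1) * logi u)) (at u)" for u using logi_deriv[of u] by simp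
  then show ?case by (intro exI[of _ "\<lambda>u. logi u * (1 + (-1) * logi u)"] conjI[OF o]) simp
next
  case sin
  have o: "osc l (\<lambda>u. l * cos (l * u))" by (intro osc.mult osc.const osc.cos)
  have "((\<lambda>u. sin (l * u)) has_real_derivative l * cos (l * u)) (at u)" for u
    by (auto intro!: derivative_eq_intros)
  then show ?case by (intro exI[of _ "\<lambda>u. l * cos (l * u)"] conjI[OF o]) simp
next
  case cos
  have o: "osc l (\<lambda>u. (- l) * sin (l * u))" by (intro osc.mult osc.const osc.sin)
  have "((\<lambda>u. cos (l * u)) has_real_derivative (- l) * sin (l * u)) (at u)" for u
    by (auto intro!: derivative_eq_intros)
  then show ?case by (intro exI[of _ "\<lambda>u. (- l) * sin (l * u)"] conjI[OF o]) simp
next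
  case (add f g)
  from add.IH(1) obtain f' where f': "osc l f' \<and> (\<forall>u. (f has_real_derivative f' u) (at u))" ..
  from add.IH(2) obtain g' where g': "osc l g' \<and> (\<forall>u. (g has_real_derivative g' u) (at u))" ..
  have o: "osc l (\<lambda>u. f' u + g' u)" using f' g' by (intro osc.add) simp_all
  have "((\<lambda>u. f u + g u) has_real_derivative f' u + g' u) (at u)" for u
    using f' g' by (intro DERIV_add) simp_all
  then show ?case by (intro exI[of _ "\<lambda>u. f' u + g' u"] conjI[OF o]) simp
next
  case (mult f g)
  from mult.IH(1) obtain f' where f': "osc l f' \<and> (\<forall>u. (f has_real_derivative f' u) (at u))" ..
  from mult.IH(2) obtain g' where g': "osc l g' \<and> (\<forall>u. (g has_real_derivative g' u) (at u))" ..
  have o: "osc l (\<lambda>u. f' u * g u + g' u * f u)" using f' g' by (intro osc.add osc.mult mult.hyps) simp_all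
  have "((\<lambda>u. f u * g u) has_real_derivative f' u * g u + g' u * f u) (at u)" for u
    using f' g' by (intro DERIV_mult) simp_all
  then show ?case by (intro exI[of _ "\<lambda>u. f' u * g u + g' u * f u"] conjI[OF o]) simp
qed

lemma osc_bcont: assumes "osc l f" shows "\<exists>K. bcont K f"
proof -
  from osc_deriv[OF assms] obtain g where g: "osc l g \<and> (\<forall>u. (f has_real_derivative g u) (at u))" ..
  have "isCont f u" for u by (rule DERIV_isCont) (rule g[THEN conjunct2, rule_format])
  then have "continuous_on UNIV f" by (intro continuous_at_imp_continuous_on ballI)
  with osc_bounded[OF assms] show ?thesis by (auto simp: bcont_def)
qed

lemma (in ern) osc_deriv_pair:
  assumes f: "osc l f" and d: "\<And>u. (f has_real_derivative f' u) (at u)"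
  shows "deriv_pair f f'" and "osc l f'"
proof -
  from osc_deriv[OF f] obtain g where g: "osc l g \<and> (\<forall>u. (f has_real_derivative g u) (at u))" ..
  have "f' = g"
  proof
    fix u show "f' u = g u" using g by (intro DERIV_unique[OF d[of u]]) simp
  qed
  with g show o: "osc l f'" by simp
  from osc_deriv[OF o] obtain h where h: "osc l h \<and> (\<forall>u. (f' has_real_derivative h u) (at u))" ..
  from osc_bcont[OF f] obtain K where K: "bcont K f" ..
  from osc_bcont[OF o] obtain K' where K': "bcont K' f'" ..
  from osc_bcont[OF h[THEN conjunct1]] obtain K'' where K'': "bcont K'' h" ..
  show "deriv_pair f f'" unfolding deriv_pair_def
    by (rule exI[of _ K], rule exI[of _ K'], rule exI[of _ K''], rule exI[of _ h]) (use K K' K'' d h in simp)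
qed

lemma (in ern) osc_tower_exists:
  assumes f: "osc l f" and d: "\<And>u. (f has_real_derivative f' u) (at u)"
  shows "\<exists>fs. fs 0 = f \<and> fs (Suc 0) = f' \<and> (\<forall>k. deriv_pair (fs k) (fs (Suc k)))"
proof -
  define fs where "fs k = (deriv ^^ k) f" for k
  have o: "osc l (fs k) \<and> (\<forall>u. (fs k has_real_derivative fs (Suc k) u) (at u))" for k
  proof (induction k)
    case 0
    have "deriv f = f'" by (rule ext) (rule DERIV_imp_deriv[OF d])
    then show ?case using f d by (simp add: fs_def)
  next
    case (Suc k)
    have o: "osc l (fs (Suc k))" by (rule osc_deriv_pair(2)[OF Suc[THEN conjunct1] Suc[THEN conjunct2, rule_format]])
    from osc_deriv[OF o] obtain h where h: "osc l h \<and> (\<forall>u. (fs (Suc k) has_real_derivative h u) (at u))" ..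
    have "deriv (fs (Suc k)) = h"
    proof
      fix u show "deriv (fs (Suc k)) u = h u" using h by (intro DERIV_imp_deriv) simp
    qed
    then have "fs (Suc (Suc k)) = h" by (simp add: fs_def)
    with o h show ?case by simp
  qed
  have "fs 0 = f" by (simp add: fs_def)
  moreover have "fs (Suc 0) = f'" unfolding fs_def by (rule ext) (simp add: DERIV_imp_deriv[OF d])
  moreover have "deriv_pair (fs k) (fs (Suc k))" for k
    by (rule osc_deriv_pair(1)[OF o[THEN conjunct1] o[THEN conjunct2, rule_format]])
  ultimately show ?thesis by (intro exI[of _ fs]) simp
qed

section \<open>Convergent and divergent integrals\<close>

definition bump :: "real \<Rightarrow> real" where "bump u = env u ^ 3 * logi u"
text \<open>The logarithmic derivative of \<open>bump\<close>, followed by its derivative.\<close>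

definition bump_log :: "real \<Rightarrow> real" where "bump_log u = 1 - logi u - 3 / 2 * (env u)\<^sup>2 * logi u"
definition bump_log' :: "real \<Rightarrow> real" where
  "bump_log' u = - (logi u * (1 - logi u)) + 3 / 2 * ((env u)\<^sup>2 * logi u)\<^sup>2 - 3 / 2 * ((env u)\<^sup>2 * (logi u * (1 - logi u)))"

lemma bump_deriv: "(bump has_real_derivative bump u * bump_log u) (at u)"
  unfolding bump_def[abs_def] bump_log_def
  by (auto intro!: derivative_eq_intros env_deriv logi_deriv simp: algebra_simps power2_eq_square power3_eq_cube)

lemma bump_log_deriv: "(bump_log has_real_derivative bump_log' u) (at u)"
  unfolding bump_log_def[abs_def] bump_log'_def
  by (auto intro!: derivative_eq_intros env_deriv logi_deriv simp: field_simps power2_eq_square power3_eq_cube)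

lemma env_logi_bounds: "0 < (env u)\<^sup>2 * logi u" "(env u)\<^sup>2 * logi u < 1"
  "0 < logi u * (1 - logi u)" "logi u * (1 - logi u) < 1"
proof -
  note b = env_bounds[of u] logi_bounds[of u]
  show "0 < (env u)\<^sup>2 * logi u" "0 < logi u * (1 - logi u)" using b by simp_all
  have "(env u)\<^sup>2 \<le> 1" using b by (simp add: power_le_one)
  then have "(env u)\<^sup>2 * logi u \<le> 1 * logi u" using b by (intro mult_right_mono) auto
  then show "(env u)\<^sup>2 * logi u < 1" using b by linarith
  have "logi u * (1 - logi u) \<le> logi u * 1" using b by (intro mult_left_mono) auto
  then show "logi u * (1 - logi u) < 1" using b by linarith
qed

lemma bump_log_bound: "\<bar>bump_log u\<bar> \<le> 3 / 2"
proof -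
  have "bump_log u = 1 - logi u - 3 / 2 * ((env u)\<^sup>2 * logi u)" by (simp add: bump_log_def)
  then show ?thesis using env_logi_bounds[of u] logi_bounds[of u] unfolding abs_le_iff by linarith
qed

lemma bump_log'_bound: "\<bar>bump_log' u\<bar> \<le> 5 / 2"
proof -
  note b = env_logi_bounds[of u]
  have "((env u)\<^sup>2 * logi u)\<^sup>2 \<le> 1" using b by (intro power_le_one) auto
  moreover have "0 \<le> ((env u)\<^sup>2 * logi u)\<^sup>2" by simp
  moreover have "(env u)\<^sup>2 * (logi u * (1 - logi u)) \<le> 1 * 1"
    using b env_bounds[of u] by (intro mult_mono) (auto simp: power_le_one)
  moreover have "0 \<le> (env u)\<^sup>2 * (logi u * (1 - logi u))" using b by simp
  ultimately show ?thesis using b unfolding bump_log'_def abs_le_iff by linarith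
qed

lemma bump_bounds: "0 < bump u" "bump u \<le> env u ^ 3" "bump u \<le> 1" "0 \<le> u \<Longrightarrow> env u ^ 3 / 2 \<le> bump u"
proof -
  note b = env_bounds[of u] logi_bounds[of u]
  show "0 < bump u" using b by (simp add: bump_def)
  show le: "bump u \<le> env u ^ 3" using b mult_left_mono[of "logi u" 1 "env u ^ 3"] by (simp add: bump_def)
  have "env u ^ 3 \<le> 1" using b by (simp add: power_le_one)
  with le show "bump u \<le> 1" by simp
  show "env u ^ 3 / 2 \<le> bump u" if "0 \<le> u"
    using b mult_left_mono[OF logi_half[OF that], of "env u ^ 3"] by (simp add: bump_def)
qed

lemma shift_sum_one: "(sin (l * u))\<^sup>2 + (sin (l * (u + pi / (2 * l))))\<^sup>2 = 1" if "l \<noteq> 0" for l u :: real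
proof -
  have "l * (u + pi / (2 * l)) = l * u + pi / 2" using that by (simp add: field_simps)
  then show ?thesis by (simp add: sin_add)
qed

lemma nn_integral_inverse_infinite:
  assumes "0 \<le> (T::real)"
  shows "(\<integral>\<^sup>+u. indicator {T..} u * ennreal (1 / (1 + u)) \<partial>lborel) = \<infinity>"
proof (rule ccontr)
  let ?I = "\<integral>\<^sup>+u. indicator {T..} u * ennreal (1 / (1 + u)) \<partial>lborel"
  assume "?I \<noteq> \<infinity>"
  then obtain I where I: "?I = ennreal I" "0 \<le> I" by (cases ?I) auto
  \<comment> \<open>Chosen so that the integral over \<open>[T, b]\<close> is \<open>I + 1\<close>.\<close>
  define b where "b = (1 + T) * exp (I + 1) - 1"
  have "1 * (1 + T) \<le> exp (I + 1) * (1 + T)" using I assms by (intro mult_right_mono) auto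
  then have b: "T \<le> b" by (simp add: b_def mult.commute)
  have "(\<integral>\<^sup>+u. ennreal (1 / (1 + u)) * indicator {T..b} u \<partial>lborel) = ennreal (ln (1 + b) - ln (1 + T))"
    by (rule nn_integral_FTC_Icc) (use assms b in \<open>auto intro!: derivative_eq_intros\<close>)
  moreover have "ln (1 + b) - ln (1 + T) = I + 1"
    using assms by (simp add: b_def ln_mult)
  moreover have "(\<integral>\<^sup>+u. ennreal (1 / (1 + u)) * indicator {T..b} u \<partial>lborel) \<le> ?I"
    by (rule nn_integral_mono) (auto simp: indicator_def)
  ultimately have "ennreal (I + 1) \<le> ennreal I" using I(1) by metis
  then have "I + 1 \<le> I" using I(2) by (subst (asm) ennreal_le_iff) auto
  then show False by simp
qed

text \<open>The set where \<open>|sin (l u)| \<ge> 1/2\<close> and its translate by a quarter period cover the half line, and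
  a fixed translation changes \<open>1 / (1 + u)\<close> by a bounded factor. So a finite integral over the
  set would force \<open>1 / (1 + u)\<close> to be integrable.\<close>

lemma nn_integral_oscillating_infinite:
  assumes "0 < l" "0 \<le> (T::real)"
  shows "(\<integral>\<^sup>+u. indicator {u. T \<le> u \<and> 1 / 2 \<le> \<bar>sin (l * u)\<bar>} u * ennreal (1 / (1 + u)) \<partial>lborel) = \<infinity>"
proof (rule ccontr)
  let ?C = "{u. T \<le> u \<and> 1 / 2 \<le> \<bar>sin (l * u)\<bar>}"
  define d where "d = pi / (2 * l)"
  have d: "0 < d" using assms by (simp add: d_def)
  have "closed ?C" by (intro closed_Collect_conj closed_Collect_le continuous_intros)
  then have C [measurable]: "?C \<in> sets borel" by simp
  let ?f = "\<lambda>u. indicator ?C u * ennreal (1 / (1 + u))"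
  let ?I = "\<integral>\<^sup>+u. ?f u \<partial>lborel"
  assume "?I \<noteq> \<infinity>"
  have cover: "indicator {T..} u * ennreal (1 / (1 + u)) \<le> ?f u + ennreal (1 + d) * ?f (d + 1 * u)" for u
  proof (cases "T \<le> u \<and> \<not> 1 / 2 \<le> \<bar>sin (l * u)\<bar>")
    case True
    then have "\<bar>sin (l * u)\<bar>\<^sup>2 < (1 / 2)\<^sup>2" by (intro power_strict_mono) auto
    then have "(1 / 2)\<^sup>2 \<le> \<bar>sin (l * (u + d))\<bar>\<^sup>2"
      using shift_sum_one[of l u] assms by (simp add: d_def power2_eq_square)
    then have "1 / 2 \<le> \<bar>sin (l * (u + d))\<bar>" by (rule power2_le_imp_le) simp
    then have in_C: "d + 1 * u \<in> ?C" using True d by (simp add: add.commute)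
    have "1 / (1 + u) \<le> (1 + d) * (1 / (1 + (d + 1 * u)))"
    proof -
      have "1 * (1 + (d + u)) \<le> (1 + d) * (1 + u)"
        using True assms d by (simp add: algebra_simps)
      then show ?thesis using True assms d by (simp add: field_simps)
    qed
    then have "ennreal (1 / (1 + u)) \<le> ennreal (1 + d) * ennreal (1 / (1 + (d + 1 * u)))"
      using d by (subst ennreal_mult'[symmetric]) (auto intro: ennreal_leI)
    with in_C True show ?thesis by simp
  next
    case False
    then show ?thesis by (cases "T \<le> u") (auto simp: indicator_def)
  qed
  have "\<infinity> = (\<integral>\<^sup>+u. indicator {T..} u * ennreal (1 / (1 + u)) \<partial>lborel)"
    using nn_integral_inverse_infinite[OF assms(2)] by simp
  also have "\<dots> \<le> (\<integral>\<^sup>+u. ?f u + ennreal (1 + d) * ?f (d + 1 * u) \<partial>lborel)"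
    by (rule nn_integral_mono) (rule cover)
  also have "\<dots> = ?I + ennreal (1 + d) * (\<integral>\<^sup>+u. ?f (d + 1 * u) \<partial>lborel)"
    by (subst nn_integral_add) (auto simp: nn_integral_cmult)
  also have "(\<integral>\<^sup>+u. ?f (d + 1 * u) \<partial>lborel) = ?I"
    using nn_integral_real_affine[of ?f 1 d] by simp
  finally have "?I + ennreal (1 + d) * ?I = \<infinity>" by (simp add: top_unique)
  with \<open>?I \<noteq> \<infinity>\<close> show False by (auto simp: ennreal_mult_eq_top_iff)
qed

lemma nn_integral_bounded_primitive:
  fixes q H :: "real \<Rightarrow> real"
  assumes q: "q \<in> borel_measurable borel" "\<And>u. 0 \<le> q u"
    and H: "\<And>u. (H has_real_derivative q u) (at u)" "\<And>u. \<bar>H u\<bar> \<le> C"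
  shows "(\<integral>\<^sup>+u. ennreal (q u) \<partial>lborel) \<le> ennreal (2 * C)"
proof -
  let ?f = "\<lambda>n u. ennreal (q u) * indicator {- real n..real n} u"
  have "(\<integral>\<^sup>+u. ennreal (q u) \<partial>lborel) = (\<integral>\<^sup>+u. (SUP n. ?f n u) \<partial>lborel)"
  proof (rule nn_integral_cong)
    fix u :: real
    obtain n :: nat where n: "\<bar>u\<bar> \<le> real n" using real_arch_simple by blast
    have "ennreal (q u) = ?f n u" using n by (auto simp: indicator_def abs_le_iff)
    also have "\<dots> \<le> (SUP n. ?f n u)" by (rule SUP_upper) simp
    finally show "ennreal (q u) = (SUP n. ?f n u)"
      by (intro antisym SUP_least) (auto simp: indicator_def)
  qed
  also have "\<dots> = (SUP n. \<integral>\<^sup>+u. ?f n u \<partial>lborel)"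
  proof (rule nn_integral_monotone_convergence_SUP)
    show "incseq ?f" by (auto simp: incseq_def le_fun_def indicator_def)
  qed (use q in auto)
  also have "\<dots> \<le> ennreal (2 * C)"
  proof (rule SUP_least)
    fix n :: nat
    have "(\<integral>\<^sup>+u. ?f n u \<partial>lborel) = ennreal (H (real n) - H (- real n))"
      by (rule nn_integral_FTC_Icc) (use q H in auto)
    also have "\<dots> \<le> ennreal (2 * C)"
      using H(2)[of "real n"] H(2)[of "- real n"] by (intro ennreal_leI) linarith
    finally show "(\<integral>\<^sup>+u. ?f n u \<partial>lborel) \<le> ennreal (2 * C)" .
  qed
  finally show ?thesis .
qed

lemma nn_integral_powr_tail:
  fixes a :: real assumes "a < -1"
  shows "(\<integral>\<^sup>+t. ennreal ((1 + t) powr a) * indicator {0..} t \<partial>lborel) < \<infinity>"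
proof -
  have "(\<integral>\<^sup>+t. ennreal ((1 + t) powr a) * indicator {0..} t \<partial>lborel) = ennreal (0 - (1 + 0) powr (a + 1) / (a + 1))"
  proof (rule nn_integral_FTC_atLeast)
    show "DERIV (\<lambda>t. (1 + t) powr (a + 1) / (a + 1)) x :> (1 + x) powr a" if "0 \<le> x" for x
      using that assms by (auto intro!: derivative_eq_intros)
    have "((\<lambda>t. (1 + t) powr (a + 1)) \<longlongrightarrow> 0) at_top"
      by (rule tendsto_neg_powr)
         (use assms in \<open>auto intro: filterlim_tendsto_add_at_top[OF tendsto_const filterlim_ident]\<close>)
    then show "((\<lambda>t. (1 + t) powr (a + 1) / (a + 1)) \<longlongrightarrow> 0) at_top"
      using tendsto_divide[OF _ tendsto_const[of "a + 1"], of _ 0] assms by fastforce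
  qed auto
  then show ?thesis by simp
qed

section \<open>The boundary data\<close>

context ern begin

text \<open>The frequency is large compared with \<open>1 + 1 / M\<close>. The term \<open>- lam\<^sup>2 bump sin\<close> of \<open>prof2\<close> then
  dominates both the lower order terms of \<open>prof2\<close> and \<open>Gop prof1\<close>, which grow only linearly in
  \<open>lam\<close>.\<close>

definition lam :: real where "lam = 20 + 4 / M"
text \<open>The data on the past horizon is \<open>prof1\<close>, given together with its primitive and its derivative.
  Starting from the primitive keeps everything explicit; \<open>sol_far\<close> needs the primitive to tend to
  zero.\<close>

definition prof0 :: "real \<Rightarrow> real" where "prof0 u = bump u * sin (lam * u)"
definition prof1 :: "real \<Rightarrow> real" where
  "prof1 u = bump u * (bump_log u * sin (lam * u) + lam * cos (lam * u))"
definition prof2 :: "real \<Rightarrow> real" where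
  "prof2 u = bump u * (- lam\<^sup>2 * sin (lam * u) + (2 * lam * bump_log u * cos (lam * u)
     + ((bump_log u)\<^sup>2 + bump_log' u) * sin (lam * u)))"

lemma lam_pos: "20 < lam" using M_pos by (simp add: lam_def)

lemma prof0_deriv: "(prof0 has_real_derivative prof1 u) (at u)"
  unfolding prof0_def[abs_def] prof1_def
  by (auto intro!: derivative_eq_intros bump_deriv simp: algebra_simps)

lemma prof1_deriv: "(prof1 has_real_derivative prof2 u) (at u)"
  unfolding prof1_def[abs_def] prof2_def
  by (auto intro!: derivative_eq_intros bump_deriv bump_log_deriv simp: algebra_simps power2_eq_square)

lemma prof_deriv_pair: "deriv_pair prof0 prof1" "deriv_pair prof1 prof2"
  and prof_tower: "\<exists>fs. fs 0 = prof1 \<and> fs (Suc 0) = prof2 \<and> (\<forall>k. deriv_pair (fs k) (fs (Suc k)))"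
proof -
  have o: "osc lam prof0"
    unfolding prof0_def[abs_def] bump_def by (intro osc.mult osc_power osc.env osc.logi osc.sin)
  show "deriv_pair prof0 prof1" by (rule osc_deriv_pair(1)[OF o prof0_deriv])
  have o1: "osc lam prof1" by (rule osc_deriv_pair(2)[OF o prof0_deriv])
  show "deriv_pair prof1 prof2" by (rule osc_deriv_pair(1)[OF o1 prof1_deriv])
  show "\<exists>fs. fs 0 = prof1 \<and> fs (Suc 0) = prof2 \<and> (\<forall>k. deriv_pair (fs k) (fs (Suc k)))"
    by (rule osc_tower_exists[OF o1 prof1_deriv])
qed

lemma env_deriv_pair: "deriv_pair env (\<lambda>u. - (1 / 2) * bump u)"
proof (rule osc_deriv_pair(1)[OF osc.env[of 0]])
  show "(env has_real_derivative - (1 / 2) * bump u) (at u)" for u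
    using env_deriv[of u] by (simp add: bump_def)
qed

lemma prof1_bound: "\<bar>prof1 u\<bar> \<le> (lam + 2) * bump u"
proof -
  have "\<bar>bump_log u * sin (lam * u)\<bar> \<le> 3 / 2 * 1"
    unfolding abs_mult by (intro mult_mono bump_log_bound) auto
  moreover have "\<bar>lam * cos (lam * u)\<bar> \<le> lam * 1"
    unfolding abs_mult using lam_pos by (intro mult_mono) auto
  ultimately have "\<bar>bump_log u * sin (lam * u) + lam * cos (lam * u)\<bar> \<le> lam + 2" by linarith
  then show ?thesis unfolding prof1_def abs_mult using bump_bounds(1)[of u]
    by (simp add: mult.commute)
qed

lemma prof2_rest: "\<bar>2 * lam * bump_log u * cos (lam * u) + ((bump_log u)\<^sup>2 + bump_log' u) * sin (lam * u)\<bar> \<le> 3 * lam + 5"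
proof -
  have 1: "\<bar>2 * lam * bump_log u * cos (lam * u)\<bar> \<le> (2 * lam * (3 / 2)) * 1"
    unfolding abs_mult using lam_pos bump_log_bound[of u] by (intro mult_mono) auto
  have "(bump_log u)\<^sup>2 \<le> (3 / 2)\<^sup>2" using bump_log_bound[of u] by (simp add: abs_le_square_iff[symmetric])
  then have "(bump_log u)\<^sup>2 \<le> 9 / 4" by (simp add: power_divide)
  then have "\<bar>(bump_log u)\<^sup>2 + bump_log' u\<bar> \<le> 5"
    using bump_log'_bound[of u] zero_le_power2[of "bump_log u"] unfolding abs_le_iff by linarith
  then have 2: "\<bar>((bump_log u)\<^sup>2 + bump_log' u) * sin (lam * u)\<bar> \<le> 5 * 1"
    unfolding abs_mult by (intro mult_mono) auto
  from 1 2 show ?thesis by linarith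
qed

lemma prof2_bound: "\<bar>prof2 u\<bar> \<le> (lam\<^sup>2 + 3 * lam + 5) * bump u"
proof -
  have "\<bar>- lam\<^sup>2 * sin (lam * u)\<bar> \<le> lam\<^sup>2 * 1"
    unfolding abs_mult by (intro mult_mono) auto
  with prof2_rest[of u] have "\<bar>- lam\<^sup>2 * sin (lam * u) + (2 * lam * bump_log u * cos (lam * u)
     + ((bump_log u)\<^sup>2 + bump_log' u) * sin (lam * u))\<bar> \<le> lam\<^sup>2 + 3 * lam + 5" by linarith
  from mult_left_mono[OF this less_imp_le[OF bump_bounds(1)[of u]]] show ?thesis
    unfolding prof2_def abs_mult using bump_bounds(1)[of u] by (simp only: abs_of_pos mult.commute[of "bump u"])
qed

text \<open>The surplus \<open>(lam + 2) / (2 M)\<close> pays for \<open>Gop prof1\<close> or for \<open>pint prof1\<close>.\<close>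

lemma prof2_lower:
  assumes u: "0 \<le> u" and s: "1 / 2 \<le> \<bar>sin (lam * u)\<bar>"
  shows "(1 + (lam + 2) / (2 * M)) * env u ^ 3 \<le> \<bar>prof2 u\<bar>"
proof -
  let ?A = "- lam\<^sup>2 * sin (lam * u)"
  let ?B = "2 * lam * bump_log u * cos (lam * u) + ((bump_log u)\<^sup>2 + bump_log' u) * sin (lam * u)"
  have "lam\<^sup>2 / 2 \<le> \<bar>?A\<bar>" using mult_left_mono[OF s, of "lam\<^sup>2"] by (simp add: abs_mult)
  then have AB: "lam\<^sup>2 / 2 - 3 * lam - 5 \<le> \<bar>?A + ?B\<bar>" using prof2_rest[of u] by linarith
  have key: "2 * (1 + (lam + 2) / (2 * M)) \<le> lam\<^sup>2 / 2 - 3 * lam - 5"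
  proof -
    have "lam\<^sup>2 = lam * (20 + 4 / M)" by (simp add: power2_eq_square lam_def)
    also have "\<dots> = 20 * lam + 4 * (lam / M)" by (simp add: algebra_simps)
    finally have sq: "lam\<^sup>2 / 2 = 10 * lam + 2 * (lam / M)" by simp
    have "20 / M \<le> lam / M" using lam_pos M_pos by (intro divide_right_mono) auto
    moreover have "0 < 1 / M" using M_pos by simp
    moreover have "2 * (1 + (lam + 2) / (2 * M)) = 2 + lam / M + 2 * (1 / M)" using M_pos by (simp add: field_simps)
    moreover have "20 / M = 20 * (1 / M)" by simp
    ultimately show ?thesis using sq lam_pos by linarith
  qed
  have pos: "0 \<le> 1 + (lam + 2) / (2 * M)" using lam_pos M_pos by simp
  have "(1 + (lam + 2) / (2 * M)) * env u ^ 3 = env u ^ 3 / 2 * (2 * (1 + (lam + 2) / (2 * M)))" by simp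
  also have "\<dots> \<le> bump u * \<bar>?A + ?B\<bar>"
    by (rule mult_mono[OF _ _ _ mult_nonneg_nonneg[OF _ pos]])
       (use bump_bounds(1)[of u] bump_bounds(4)[OF u] key AB in linarith)+
  also have "\<dots> = \<bar>prof2 u\<bar>" unfolding prof2_def abs_mult using bump_bounds(1)[of u] by simp
  finally show ?thesis .
qed

lemma prof1_decay: "u \<le> t \<Longrightarrow> \<bar>prof1 t\<bar> \<le> (lam + 2) * env u ^ 3"
proof -
  assume t: "u \<le> t"
  have "env t ^ 3 \<le> env u ^ 3" using env_antimono[OF t] env_bounds[of t] by (intro power_mono) auto
  then have "bump t \<le> env u ^ 3" using bump_bounds(2)[of t] by simp
  then have "(lam + 2) * bump t \<le> (lam + 2) * env u ^ 3" using lam_pos by (intro mult_left_mono) auto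
  with prof1_bound[of t] show ?thesis by simp
qed

lemma prof_tendsto: "(prof0 \<longlongrightarrow> 0) at_top" "(prof1 \<longlongrightarrow> 0) at_top"
proof -
  have e: "((\<lambda>u. c * env u ^ 3) \<longlongrightarrow> 0) at_top" for c
    using tendsto_mult[OF tendsto_const[of c] tendsto_power[OF env_tendsto, of 3]] by simp
  show "(prof0 \<longlongrightarrow> 0) at_top"
  proof (rule Lim_null_comparison[OF always_eventually e[of 1]], rule allI)
    fix u have "\<bar>prof0 u\<bar> \<le> bump u * 1"
      unfolding prof0_def abs_mult using bump_bounds(1)[of u] by (intro mult_mono) auto
    then show "norm (prof0 u) \<le> 1 * env u ^ 3" using bump_bounds(2)[of u] by simp
  qed
  show "(prof1 \<longlongrightarrow> 0) at_top"
    by (rule Lim_null_comparison[OF always_eventually e[of "lam + 2"]]) (use prof1_decay in auto)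
qed

text \<open>The trace of \<open>\<phi>\<close> at null infinity by \<open>sol_far\<close>, and its derivative.\<close>

definition rad_field :: "real \<Rightarrow> real" where "rad_field u = prof1 u - Gop prof0 u"
definition rad_field' :: "real \<Rightarrow> real" where "rad_field' u = prof2 u - Gop prof1 u"

lemma rad_field_deriv: "(rad_field has_real_derivative rad_field' u) (at u)"
  unfolding rad_field_def[abs_def] rad_field'_def
  by (intro DERIV_diff prof1_deriv Gop_deriv prof_deriv_pair)

lemma prof1_bcont: obtains K where "bcont K prof1"
  using prof_deriv_pair(2) by (auto simp: deriv_pair_def)

lemma Gop_prof1_bound: "\<bar>Gop prof1 u\<bar> \<le> (lam + 2) / (2 * M) * env u ^ 3"
proof -
  obtain K where "bcont K prof1" by (rule prof1_bcont)
  from Gop_bound[OF this prof1_decay] show ?thesis by simp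
qed

lemma pint_prof1_bound: assumes "M < r" shows "\<bar>pint prof1 u r\<bar> \<le> (lam + 2) / (2 * M) * env u ^ 3"
proof -
  obtain K where "bcont K prof1" by (rule prof1_bcont)
  from pint_bound[OF this prof1_decay assms]
  have "\<bar>pint prof1 u r\<bar> \<le> (lam + 2) * env u ^ 3 * Dfun M r / (2 * M)" .
  also have "\<dots> \<le> (lam + 2) * env u ^ 3 * 1 / (2 * M)"
    using lam_pos M_pos env_bounds[of u] Dfun_le_one[of r] assms by (intro divide_right_mono mult_left_mono) auto
  finally show ?thesis by simp
qed

text \<open>The same lower bound holds for \<open>\<partial>\<^sub>u\<phi>\<close> at null infinity and, by \<open>flux_identity\<close>, at every
  radius. The second form gives the divergence of the energy near the horizon.\<close>

lemma rad_field'_lower: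
  assumes "0 \<le> u" "1 / 2 \<le> \<bar>sin (lam * u)\<bar>"
  shows "(env u ^ 3)\<^sup>2 \<le> (rad_field' u)\<^sup>2"
    and "M < r \<Longrightarrow> (env u ^ 3)\<^sup>2 \<le> (prof2 u - pint prof1 u r)\<^sup>2"
proof -
  have *: "(env u ^ 3)\<^sup>2 \<le> (prof2 u - g)\<^sup>2" if "\<bar>g\<bar> \<le> (lam + 2) / (2 * M) * env u ^ 3" for g
  proof -
    have "env u ^ 3 \<le> \<bar>prof2 u - g\<bar>"
      using prof2_lower[OF assms] that by (simp add: distrib_right)
    then have "(env u ^ 3)\<^sup>2 \<le> \<bar>prof2 u - g\<bar>\<^sup>2" using env_bounds[of u] by (intro power_mono) auto
    then show ?thesis by (simp only: power2_abs)
  qed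
  show "(env u ^ 3)\<^sup>2 \<le> (rad_field' u)\<^sup>2" unfolding rad_field'_def by (rule *[OF Gop_prof1_bound])
  show "M < r \<Longrightarrow> (env u ^ 3)\<^sup>2 \<le> (prof2 u - pint prof1 u r)\<^sup>2" by (rule *[OF pint_prof1_bound])
qed

text \<open>All divergences below are of this logarithmic type.\<close>

lemma osc_integral_infinite:
  assumes "0 < c" "0 \<le> T" and low: "\<And>u. T \<le> u \<Longrightarrow> 1 / 2 \<le> \<bar>sin (lam * u)\<bar> \<Longrightarrow> ennreal (c / (1 + u)) \<le> g u"
  shows "(\<integral>\<^sup>+u. g u \<partial>lborel) = \<infinity>"
proof -
  let ?C = "{u. T \<le> u \<and> 1 / 2 \<le> \<bar>sin (lam * u)\<bar>}"
  have "closed ?C" by (intro closed_Collect_conj closed_Collect_le continuous_intros)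
  then have C [measurable]: "?C \<in> sets borel" by simp
  have "\<infinity> = ennreal c * (\<integral>\<^sup>+u. indicator ?C u * ennreal (1 / (1 + u)) \<partial>lborel)"
    using nn_integral_oscillating_infinite[of lam T] lam_pos assms(1,2) by (simp add: ennreal_mult_top)
  also have "\<dots> = (\<integral>\<^sup>+u. ennreal c * (indicator ?C u * ennreal (1 / (1 + u))) \<partial>lborel)"
    by (rule nn_integral_cmult[symmetric]) measurable
  also have "\<dots> \<le> (\<integral>\<^sup>+u. g u \<partial>lborel)"
  proof (rule nn_integral_mono)
    fix u
    show "ennreal c * (indicator ?C u * ennreal (1 / (1 + u))) \<le> g u"
    proof (cases "u \<in> ?C")
      case True
      have "ennreal c * ennreal (1 / (1 + u)) = ennreal (c / (1 + u))"
        using assms(1) by (simp add: ennreal_mult'[symmetric])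
      with True low[of u] show ?thesis by simp
    qed simp
  qed
  finally show ?thesis by (simp add: top_unique)
qed

lemma rad_field'_weighted_infinite:
  assumes "2 \<le> p"
  shows "(\<integral>\<^sup>+t. ennreal ((1 + t) powr p * (rad_field' t)\<^sup>2) * indicator {0..} t \<partial>lborel) = \<infinity>"
proof (rule osc_integral_infinite[of "1 / 8" 0])
  fix u :: real assume u: "0 \<le> u" "1 / 2 \<le> \<bar>sin (lam * u)\<bar>"
  have "(1 + u) powr 2 * (1 / (8 * (1 + u) ^ 3)) \<le> (1 + u) powr p * (rad_field' u)\<^sup>2"
    using u assms order_trans[OF env_six_lower[OF u(1)] rad_field'_lower(1)[OF u]]
    by (intro mult_mono powr_mono) auto
  moreover have "(1 + u) powr 2 * (1 / (8 * (1 + u) ^ 3)) = 1 / 8 / (1 + u)"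
    using u by (simp add: powr_numeral power2_eq_square power3_eq_cube)
  ultimately show "ennreal (1 / 8 / (1 + u)) \<le> ennreal ((1 + u) powr p * (rad_field' u)\<^sup>2) * indicator {0..} u"
    using u by (simp add: ennreal_leI)
qed auto

lemma rad_field'_abs_bound:
  "\<bar>rad_field' u\<bar> \<le> (lam\<^sup>2 + 3 * lam + 5 + (lam + 2) / (2 * M)) * env u ^ 3"
proof -
  have "\<bar>prof2 u\<bar> \<le> (lam\<^sup>2 + 3 * lam + 5) * env u ^ 3"
    using prof2_bound[of u] mult_left_mono[OF bump_bounds(2)[of u], of "lam\<^sup>2 + 3 * lam + 5"] lam_pos
    by (simp add: add_nonneg_nonneg)
  moreover have "\<bar>rad_field' u\<bar> \<le> \<bar>prof2 u\<bar> + \<bar>Gop prof1 u\<bar>" unfolding rad_field'_def by simp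
  ultimately show ?thesis using Gop_prof1_bound[of u] unfolding distrib_right by linarith
qed

lemma rad_field'_weighted_finite:
  assumes "p < 2"
  shows "(\<integral>\<^sup>+t. ennreal ((1 + t) powr p * (rad_field' t)\<^sup>2) * indicator {0..} t \<partial>lborel) < \<infinity>"
proof -
  define K where "K = lam\<^sup>2 + 3 * lam + 5 + (lam + 2) / (2 * M)"
  have "ennreal ((1 + t) powr p * (rad_field' t)\<^sup>2) * indicator {0..} t
      \<le> ennreal (K\<^sup>2) * (ennreal ((1 + t) powr (p - 3)) * indicator {0..} t)" for t :: real
  proof (cases "0 \<le> t")
    case True
    have "(rad_field' t)\<^sup>2 \<le> (K * env t ^ 3)\<^sup>2"
      using rad_field'_abs_bound[of t] power_mono[of "\<bar>rad_field' t\<bar>" "K * env t ^ 3" 2] by (simp add: K_def)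
    also have "\<dots> \<le> K\<^sup>2 * (1 / (1 + t) ^ 3)"
      unfolding power_mult_distrib by (intro mult_left_mono env_six_upper True) simp
    finally have "(1 + t) powr p * (rad_field' t)\<^sup>2 \<le> (1 + t) powr p * (K\<^sup>2 * (1 / (1 + t) ^ 3))"
      by (intro mult_left_mono) auto
    also have "\<dots> = K\<^sup>2 * (1 + t) powr (p - 3)"
      using True by (simp add: powr_diff powr_numeral)
    finally show ?thesis using True by (simp add: ennreal_mult'[symmetric] ennreal_leI)
  qed simp
  then have "(\<integral>\<^sup>+t. ennreal ((1 + t) powr p * (rad_field' t)\<^sup>2) * indicator {0..} t \<partial>lborel)
      \<le> (\<integral>\<^sup>+t. ennreal (K\<^sup>2) * (ennreal ((1 + t) powr (p - 3)) * indicator {0..} t) \<partial>lborel)"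
    by (rule nn_integral_mono)
  also have "\<dots> = ennreal (K\<^sup>2) * (\<integral>\<^sup>+t. ennreal ((1 + t) powr (p - 3)) * indicator {0..} t \<partial>lborel)"
    by (rule nn_integral_cmult) measurable
  also have "\<dots> < \<infinity>"
    using nn_integral_powr_tail[of "p - 3"] assms by (simp add: ennreal_mult_less_top)
  finally show ?thesis .
qed

text \<open>Towards \<open>u \<longlongrightarrow> -\<infinity>\<close> the bound by \<open>env\<^sup>3\<close> does not decay. There \<open>|rad_field'|\<close> is dominated
  by \<open>bump\<close> and \<open>Gop bump\<close>, which have the bounded primitives \<open>-2 env\<close> and \<open>-2 Gop env\<close>.\<close>

lemma rad_field'_total_finite: "(\<integral>\<^sup>+t. ennreal ((rad_field' t)\<^sup>2) \<partial>lborel) < \<infinity>"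
proof -
  define a b where "a = lam\<^sup>2 + 3 * lam + 5" and "b = lam + 2"
  define K where "K = a + b / (2 * M)"
  have ab: "0 \<le> a" "0 \<le> b" "0 \<le> K" using lam_pos M_pos by (auto simp: a_def b_def K_def)
  obtain K1 where f1: "bcont K1 prof1" by (rule prof1_bcont)
  obtain L L' where L: "bcont L env" "bcont L' (\<lambda>u. - (1 / 2) * bump u)"
    using env_deriv_pair by (auto simp: deriv_pair_def)
  have "\<bar>env u\<bar> \<le> 1" for u using env_bounds[of u] by simp
  with L(1) have env1: "bcont 1 env" by (simp add: bcont_def)
  from bcont_lincomb[OF L(2) L(2), of "-2" 0] have "bcont (2 * L' + 0) bump" by simp
  then have bb: "bcont (2 * L') bump" by simp
  have bL: "bcont (b * (2 * L')) (\<lambda>u. b * bump u)"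
    using bcont_lincomb[OF bb bb, of b 0] ab by simp
  have Gb: "\<bar>Gop prof1 u\<bar> \<le> b * Gop bump u" for u
    using Gop_dominated[OF f1 bL prof1_bound[folded b_def], of u] Gop_lincomb[OF bb bb, of b 0 u] by simp
  define q where "q u = K * (a * bump u + b * Gop bump u)" for u
  define H where "H u = K * (- 2) * (a * env u + b * Gop env u)" for u
  have Gd: "Gop (\<lambda>u. - (1 / 2) * bump u) u = - (1 / 2) * Gop bump u" for u
    using Gop_lincomb[OF bb bb, of "- (1 / 2)" 0 u] by simp
  have H: "(H has_real_derivative q u) (at u)" for u
    using Gop_deriv[OF env_deriv_pair, of u] env_deriv[of u] unfolding H_def[abs_def] q_def Gd
    by (auto intro!: derivative_eq_intros simp: bump_def algebra_simps)
  have "(rad_field' t)\<^sup>2 \<le> q t" for t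
  proof -
    have 1: "\<bar>rad_field' t\<bar> \<le> a * bump t + b * Gop bump t"
      using prof2_bound[of t] Gb[of t] unfolding rad_field'_def a_def by linarith
    have "env t ^ 3 \<le> 1" using env_bounds[of t] by (simp add: power_le_one)
    then have "K * env t ^ 3 \<le> K * 1" using ab by (intro mult_left_mono) auto
    then have 2: "\<bar>rad_field' t\<bar> \<le> K" using rad_field'_abs_bound[of t] by (simp add: K_def a_def b_def)
    have "\<bar>rad_field' t\<bar> * \<bar>rad_field' t\<bar> \<le> K * (a * bump t + b * Gop bump t)"
      using 1 2 by (intro mult_mono) auto
    then show ?thesis by (simp add: q_def power2_eq_square)
  qed
  then have "(\<integral>\<^sup>+t. ennreal ((rad_field' t)\<^sup>2) \<partial>lborel) \<le> (\<integral>\<^sup>+t. ennreal (q t) \<partial>lborel)"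
    by (intro nn_integral_mono ennreal_leI)
  also have "\<dots> \<le> ennreal (2 * (K * 2 * (a + b * (1 / (2 * M)))))"
  proof (rule nn_integral_bounded_primitive[of q H])
    have "continuous_on UNIV bump"
      using bcontD(1)[OF bb] .
    moreover obtain b' where "osc 0 b'" "\<And>u. (bump has_real_derivative b' u) (at u)"
    proof -
      have "osc 0 bump" unfolding bump_def[abs_def] by (intro osc.mult osc_power osc.env osc.logi)
      from osc_deriv[OF this] that show ?thesis by (elim exE conjE) simp
    qed
    then have "deriv_pair bump b'"
    proof -
      assume *: "osc 0 b'" "\<And>u. (bump has_real_derivative b' u) (at u)"
      have "osc 0 bump" unfolding bump_def[abs_def] by (intro osc.mult osc_power osc.env osc.logi)
      from osc_deriv_pair(1)[OF this *(2)] show ?thesis .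
    qed
    then have "continuous_on UNIV (Gop bump)"
      by (intro continuous_at_imp_continuous_on ballI DERIV_isCont[OF Gop_deriv])
    ultimately have "continuous_on UNIV q" unfolding q_def by (intro continuous_intros)
    then show "q \<in> borel_measurable borel" by (rule borel_measurable_continuous_onI)
    show "0 \<le> q u" for u
      unfolding q_def using ab bump_bounds(1) Gop_nonneg[OF bb less_imp_le[OF bump_bounds(1)]]
      by (intro mult_nonneg_nonneg add_nonneg_nonneg) (auto intro: less_imp_le)
    show "\<bar>H u\<bar> \<le> K * 2 * (a + b * (1 / (2 * M)))" for u
    proof -
      have "\<bar>a * env u\<bar> \<le> a * 1" "\<bar>b * Gop env u\<bar> \<le> b * (1 / (2 * M))"
        using mult_left_mono[OF bcontD(2)[OF env1, of u] ab(1)] ab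
          mult_left_mono[OF Gop_bound[OF env1 bcontD(2)[OF env1], of u] ab(2)] by (simp_all add: abs_mult)
      then have "\<bar>a * env u + b * Gop env u\<bar> \<le> a + b * (1 / (2 * M))" by linarith
      then show ?thesis unfolding H_def abs_mult using ab by (intro mult_mono) auto
    qed
  qed (rule H)
  finally show ?thesis using ennreal_less_top le_less_trans by (metis infinity_ennreal_def)
qed

end

section \<open>The unit sphere and the boundary fluxes\<close>

lemma pt_coords:
  "pt v r w $ 1 = v" "pt v r w $ 2 = r * w$1" "pt v r w $ 3 = r * w$2" "pt v r w $ 4 = r * w$3"
  by (simp_all add: pt_def vector_def)

lemma rad_pt:
  assumes "w \<in> sphere 0 1" "0 \<le> r" shows "rad (pt v r w) = r"
proof -
  have "(w$1)\<^sup>2 + (w$2)\<^sup>2 + (w$3)\<^sup>2 = 1"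
    using assms(1) by (simp add: norm_eq_1 inner_vec_def sum_3 power2_eq_square)
  then have "(r * w$1)\<^sup>2 + (r * w$2)\<^sup>2 + (r * w$3)\<^sup>2 = r\<^sup>2"
    by (simp only: power_mult_distrib distrib_left[symmetric] mult_1_right)
  then show ?thesis using assms(2) by (simp add: rad_def pt_coords)
qed

lemma sphere_param_measurable:
  "(\<lambda>(\<theta>, \<phi>). vector [sin \<theta> * cos \<phi>, sin \<theta> * sin \<phi>, cos \<theta>] :: real^3) \<in> borel_measurable borel"
proof (rule borel_measurable_continuous_onI)
  have "continuous_on UNIV (\<lambda>z :: real \<times> real. if i = 1 then sin (fst z) * cos (snd z)
      else if i = 2 then sin (fst z) * sin (snd z) else cos (fst z))" for i :: 3
    by (cases "i = 1"; cases "i = 2") (auto intro!: continuous_intros)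
  then have "continuous_on UNIV (\<lambda>z :: real \<times> real. \<chi> i::3. if i = 1 then sin (fst z) * cos (snd z)
      else if i = 2 then sin (fst z) * sin (snd z) else cos (fst z))"
    by (rule continuous_on_vec_lambda)
  moreover have "(\<lambda>(\<theta>, \<phi>). vector [sin \<theta> * cos \<phi>, sin \<theta> * sin \<phi>, cos \<theta>] :: real^3)
      = (\<lambda>z. \<chi> i. if i = 1 then sin (fst z) * cos (snd z)
      else if i = 2 then sin (fst z) * sin (snd z) else cos (fst z))"
    by (auto simp: fun_eq_iff vec_eq_iff forall_3)
  ultimately show "continuous_on UNIV (\<lambda>(\<theta>, \<phi>). vector [sin \<theta> * cos \<phi>, sin \<theta> * sin \<phi>, cos \<theta>] :: real^3)"
    by simp
qed

definition sphere_density :: "real \<times> real \<Rightarrow> ennreal" where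
  "sphere_density = (\<lambda>(\<theta>, \<phi>). ennreal (indicator ({0..pi} \<times> {0..2*pi}) (\<theta>, \<phi>) * sin \<theta>))"

lemma sphere_density_measurable: "sphere_density \<in> borel_measurable borel"
proof -
  have "closed ({0..pi} \<times> {0..2*pi})" by (intro closed_Times) auto
  then have [measurable]: "{0..pi} \<times> {0..2*pi} \<in> sets (borel :: (real \<times> real) measure)" by simp
  have [measurable]: "(\<lambda>z :: real \<times> real. sin (fst z)) \<in> borel_measurable borel"
    by (intro borel_measurable_continuous_onI continuous_intros)
  have "(\<lambda>z. ennreal (indicator ({0..pi} \<times> {0..2*pi}) z * sin (fst z))) \<in> borel_measurable (borel :: (real \<times> real) measure)"
    by measurable
  then show ?thesis by (simp add: sphere_density_def case_prod_unfold)
qed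

lemma AE_sphere_measure: "AE w in sphere_measure. w \<in> sphere 0 1"
  unfolding sphere_measure_def
proof (subst AE_distr_iff)
  have "norm (vector [sin \<theta> * cos \<phi>, sin \<theta> * sin \<phi>, cos \<theta>] :: real^3) = 1" for \<theta> \<phi>
  proof -
    have "(sin \<theta> * cos \<phi>) * (sin \<theta> * cos \<phi>) + (sin \<theta> * sin \<phi>) * (sin \<theta> * sin \<phi>) + cos \<theta> * cos \<theta>
        = (sin \<theta>)\<^sup>2 * ((cos \<phi>)\<^sup>2 + (sin \<phi>)\<^sup>2) + (cos \<theta>)\<^sup>2"
      by (simp only: power2_eq_square algebra_simps)
    also have "\<dots> = 1" by simp
    finally show ?thesis unfolding norm_eq_1 inner_vec_def sum_3 vector_3 inner_real_def .
  qed
  then show "AE z in density lborel (\<lambda>(\<theta>, \<phi>). ennreal (indicator ({0..pi} \<times> {0..2*pi}) (\<theta>, \<phi>) * sin \<theta>)).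
      (case z of (\<theta>, \<phi>) \<Rightarrow> vector [sin \<theta> * cos \<phi>, sin \<theta> * sin \<phi>, cos \<theta>]) \<in> (sphere 0 1 :: (real^3) set)"
    by (intro always_eventually) auto
qed (use sphere_param_measurable in auto)

lemma sphere_measure_total: "\<exists>s>0. emeasure sphere_measure (space sphere_measure) = ennreal s"
proof -
  have m: "(\<lambda>(\<theta>, \<phi>). vector [sin \<theta> * cos \<phi>, sin \<theta> * sin \<phi>, cos \<theta>] :: real^3)
      \<in> measurable (density lborel sphere_density) borel"
    using sphere_param_measurable by simp
  have "emeasure sphere_measure (space sphere_measure) = emeasure (density lborel sphere_density) UNIV"
    unfolding sphere_measure_def sphere_density_def[symmetric] using m by (simp add: emeasure_distr)
  also have "\<dots> = (\<integral>\<^sup>+z. sphere_density z \<partial>lborel)"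
    using sphere_density_measurable by (simp add: emeasure_density)
  finally have e: "emeasure sphere_measure (space sphere_measure) = (\<integral>\<^sup>+z. sphere_density z \<partial>lborel)" .
  have "(\<integral>\<^sup>+z. sphere_density z \<partial>lborel) \<le> (\<integral>\<^sup>+z. indicator ({0..pi} \<times> {0..2*pi}) z \<partial>lborel)"
  proof (rule nn_integral_mono)
    fix z :: "real \<times> real"
    have "sphere_density z = ennreal (indicator ({0..pi} \<times> {0..2*pi}) z * sin (fst z))"
      by (simp add: sphere_density_def case_prod_unfold)
    then show "sphere_density z \<le> indicator ({0..pi} \<times> {0..2*pi}) z"
      by (cases "z \<in> {0..pi} \<times> {0..2*pi}") (simp_all add: ennreal_le_1)
  qed
  also have "\<dots> = emeasure lborel ({0..pi} \<times> {0..2*pi})"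
    by (intro nn_integral_indicator) (auto intro!: borel_closed closed_Times)
  also have "\<dots> < \<infinity>" by (intro emeasure_compact_finite compact_Times) auto
  finally have fin: "(\<integral>\<^sup>+z. sphere_density z \<partial>lborel) < \<infinity>" .
  have "(\<integral>\<^sup>+z. sphere_density z \<partial>lborel) \<noteq> 0"
  proof
    assume "(\<integral>\<^sup>+z. sphere_density z \<partial>lborel) = 0"
    then have "AE z in lborel. sphere_density z = 0"
      using sphere_density_measurable by (subst (asm) nn_integral_0_iff_AE) auto
    then have "AE z in lborel. z \<notin> {0<..<pi} \<times> {0<..<2*pi}"
    proof eventually_elim
      case (elim z)
      show ?case
      proof
        assume z: "z \<in> {0<..<pi} \<times> {0<..<2*pi}"
        then have "0 < sin (fst z)" by (intro sin_gt_zero) auto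
        with z elim show False by (auto simp: sphere_density_def ennreal_eq_0_iff)
      qed
    qed
    moreover have "{0<..<pi} \<times> {0<..<2*pi} \<in> sets (lborel :: (real \<times> real) measure)"
      by (auto intro!: borel_open open_Times)
    ultimately have "emeasure lborel ({0<..<pi} \<times> {0<..<2*pi} :: (real \<times> real) set) = 0"
      using AE_iff_null_sets by (metis null_setsD1)
    moreover have "emeasure lborel ({0<..<pi} \<times> {0<..<2*pi} :: (real \<times> real) set) = ennreal pi * ennreal (2 * pi)"
      unfolding lborel_prod[symmetric] by (subst lborel.emeasure_pair_measure_Times) auto
    ultimately show False using mult_pos_pos[OF pi_gt_zero pi_gt_zero] by (simp add: ennreal_mult'[symmetric] ennreal_eq_0_iff)
  qed
  moreover obtain s where s: "0 \<le> s" "(\<integral>\<^sup>+z. sphere_density z \<partial>lborel) = ennreal s"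
    using fin by (cases "\<integral>\<^sup>+z. sphere_density z \<partial>lborel") auto
  ultimately have "0 < s" by (cases "s = 0") auto
  then show ?thesis unfolding e s(2) by blast
qed

lemma nn_integral_sphere_const:
  assumes "\<And>w. w \<in> sphere 0 1 \<Longrightarrow> g w = c"
  shows "(\<integral>\<^sup>+w. g w \<partial>sphere_measure) = c * emeasure sphere_measure (space sphere_measure)"
proof -
  have "(\<integral>\<^sup>+w. g w \<partial>sphere_measure) = (\<integral>\<^sup>+w. c \<partial>sphere_measure)"
    by (rule nn_integral_cong_AE) (use AE_sphere_measure in eventually_elim, use assms in auto)
  then show ?thesis by simp
qed

lemma nn_integral_sphere_lower:
  assumes "\<And>w. w \<in> sphere 0 1 \<Longrightarrow> c \<le> g w"
  shows "c * emeasure sphere_measure (space sphere_measure) \<le> (\<integral>\<^sup>+w. g w \<partial>sphere_measure)"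
proof -
  have "(\<integral>\<^sup>+w. c \<partial>sphere_measure) \<le> (\<integral>\<^sup>+w. g w \<partial>sphere_measure)"
    by (rule nn_integral_mono_AE) (use AE_sphere_measure in eventually_elim, use assms in auto)
  then show ?thesis by simp
qed

lemma boundary_flux_radial:
  assumes "q \<in> borel_measurable borel"
  shows "boundary_flux (\<lambda>t w. q t) = (\<integral>\<^sup>+t. ennreal ((q t)\<^sup>2) \<partial>lborel) * emeasure sphere_measure (space sphere_measure)"
  unfolding boundary_flux_def using assms
  by (subst nn_integral_sphere_const[OF refl]) (simp add: nn_integral_multc)

lemma weighted_boundary_flux_radial:
  assumes [measurable]: "q \<in> borel_measurable borel"
  shows "weighted_boundary_flux p (\<lambda>t w. q t)
     = (\<integral>\<^sup>+t. ennreal ((1 + t) powr p * (q t)\<^sup>2) * indicator {0..} t \<partial>lborel) * emeasure sphere_measure (space sphere_measure)"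
proof -
  have "weighted_boundary_flux p (\<lambda>t w. q t) = (\<integral>\<^sup>+t. (ennreal ((1 + t) powr p * (q t)\<^sup>2) * indicator {0..} t)
      * emeasure sphere_measure (space sphere_measure) \<partial>lborel)"
    unfolding weighted_boundary_flux_def
    by (subst nn_integral_sphere_const[OF refl]) (simp add: mult_ac)
  also have "\<dots> = (\<integral>\<^sup>+t. ennreal ((1 + t) powr p * (q t)\<^sup>2) * indicator {0..} t \<partial>lborel) * emeasure sphere_measure (space sphere_measure)"
    by (rule nn_integral_multc) measurable
  finally show ?thesis .
qed

lemma boundary_flux_zero: "boundary_flux (\<lambda>v w. 0) < \<infinity>"
  by (simp add: boundary_flux_def)

lemma fst_coord_tendsto: "((\<lambda>p :: real^4. p$1) \<longlongrightarrow> p0$1) (at p0 within S)"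
  by (intro tendsto_intros)

context ern begin

lemma rad_field'_measurable: "rad_field' \<in> borel_measurable borel"
proof -
  obtain fs where fs: "fs 0 = prof1" "fs (Suc 0) = prof2" "\<And>k. deriv_pair (fs k) (fs (Suc k))"
    using prof_tower by (elim exE conjE) simp
  have "isCont (Gop prof1) u" for u by (rule DERIV_isCont[OF Gop_deriv[OF prof_deriv_pair(2)]])
  then have "continuous_on UNIV (Gop prof1)" by (intro continuous_at_imp_continuous_on ballI)
  moreover have "continuous_on UNIV prof2" using fs(3)[of 1] fs(2) by (auto simp: deriv_pair_def bcont_def)
  ultimately have "continuous_on UNIV rad_field'" unfolding rad_field'_def by (intro continuous_intros)
  then show ?thesis by (rule borel_measurable_continuous_onI)
qed

lemma rad_field'_fluxes:
  "boundary_flux (\<lambda>t w. rad_field' t) < \<infinity>"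
  "weighted_boundary_flux p (\<lambda>t w. rad_field' t) = \<infinity> \<longleftrightarrow> 2 \<le> p"
proof -
  obtain s where s: "0 < s" "emeasure sphere_measure (space sphere_measure) = ennreal s"
    using sphere_measure_total by blast
  show "boundary_flux (\<lambda>t w. rad_field' t) < \<infinity>"
    unfolding boundary_flux_radial[OF rad_field'_measurable] s(2)
    using rad_field'_total_finite by (simp add: ennreal_mult_less_top)
  show "weighted_boundary_flux p (\<lambda>t w. rad_field' t) = \<infinity> \<longleftrightarrow> 2 \<le> p"
  proof (cases "2 \<le> p")
    case True
    then show ?thesis
      unfolding weighted_boundary_flux_radial[OF rad_field'_measurable] s(2) rad_field'_weighted_infinite[OF True]
      using s(1) by (simp add: ennreal_mult_eq_top_iff)
  next
    case False
    then have "(\<integral>\<^sup>+t. ennreal ((1 + t) powr p * (rad_field' t)\<^sup>2) * indicator {0..} t \<partial>lborel) * ennreal s < \<infinity>"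
      using rad_field'_weighted_finite[of p] by (simp add: ennreal_mult_less_top)
    then show ?thesis
      unfolding weighted_boundary_flux_radial[OF rad_field'_measurable] s(2) using False by auto
  qed
qed

text \<open>The passage from \<open>(u, r)\<close> to \<open>(v, r)\<close>.\<close>

lemma tower_forward:
  assumes "\<And>k. deriv_pair (fs k) (fs (Suc k))"
  shows "tower (\<lambda>k v r. sol (fs k) (v - tort r) r) (\<lambda>k v r. solx (fs k) (v - tort r) r)"
  unfolding tower_def
proof (intro allI impI conjI)
  fix k v r assume r: "M < r"
  have t: "((\<lambda>r. - tort r) has_real_derivative - dtort r) (at r)" by (rule DERIV_minus[OF tort_deriv[OF r]])
  have s: "((\<lambda>(u, r). sol (fs k) u r) has_derivative (\<lambda>(h, l). sol (fs (Suc k)) (v + - tort r) r * h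
      + (dtort r * solx (fs k) (v + - tort r) r) * l)) (at (v + - tort r, r))"
    by (rule sol_has_derivative[OF assms r])
  have "((\<lambda>(v, r). sol (fs k) (v + - tort r) r) has_derivative (\<lambda>(h, l). sol (fs (Suc k)) (v + - tort r) r * h
      + (dtort r * (solx (fs k) (v + - tort r) r - sol (fs (Suc k)) (v + - tort r) r)) * l)) (at (v, r))"
    by (rule compose_deriv_shear[where g = "sol (fs k)" and c = "\<lambda>r. - tort r" and d = "\<lambda>r. r", OF s t DERIV_ident])
       (simp add: algebra_simps)
  then show "((\<lambda>(v, r). sol (fs k) (v - tort r) r) has_derivative (\<lambda>(h, l). sol (fs (Suc k)) (v - tort r) r * h
      + (dtort r * (solx (fs k) (v - tort r) r - sol (fs (Suc k)) (v - tort r) r)) * l)) (at (v, r))" by simp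
  show "((\<lambda>(v, r). solx (fs k) (v - tort r) r) has_derivative (\<lambda>(h, l). solx (fs (Suc k)) (v - tort r) r * h
      + (pot r * sol (fs k) (v - tort r) r) * l)) (at (v, r))"
    by (rule solx_has_derivative_v[OF assms r])
qed

lemma solx_has_derivative:
  assumes c: "deriv_pair f f'" and r: "M < r"
  shows "((\<lambda>(u, r). solx f u r) has_derivative
     (\<lambda>(h, k). solx f' u r * h + (dtort r * solx f' u r + pot r * sol f u r) * k)) (at (u, r))"
proof (rule joint_deriv[OF deriv_pair_solx_deriv_u[OF c] solx_deriv_r[OF c] _ r])
  obtain K K' where f: "bcont K f" "bcont K' f'" using c by (auto simp: deriv_pair_def)
  have "continuous_on (UNIV \<times> {M<..}) (\<lambda>z. (\<lambda>(u, r). dtort r * solx f' u r) z + (\<lambda>(u, r). pot r * sol f u r) z)"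
    by (intro continuous_on_add cont_mult_slice solx_cont[OF f(2)] sol_cont[OF f(1)] continuous_on_dtort
        continuous_on_subset[OF continuous_on_pot]) auto
  then show "continuous_on (UNIV \<times> {M<..}) (\<lambda>(u, r). dtort r * solx f' u r + pot r * sol f u r)"
    by (simp add: case_prod_unfold)
qed

lemma mirror_alt: "M < r \<Longrightarrow> mirror r = M * r / (r - M)"
  by (simp add: mirror_def field_simps power2_eq_square)

lemma mirror_deriv: assumes "M < r" shows "(mirror has_real_derivative - (M\<^sup>2 / (r - M)\<^sup>2)) (at r)"
  unfolding mirror_def[abs_def] using assms by (auto intro!: derivative_eq_intros simp: power2_eq_square)

lemma dtort_mirror: assumes r: "M < r" shows "dtort (mirror r) * - (M\<^sup>2 / (r - M)\<^sup>2) = - dtort r"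
proof -
  define y where "y = r - M"
  have y: "0 < y" using r by (simp add: y_def)
  have ym: "mirror r - M = M\<^sup>2 / y" and my: "mirror r = M * r / y"
    using mirror_alt[OF r] by (simp_all add: y_def mirror_def)
  have "dtort (mirror r) = 2 * (M * r / y)\<^sup>2 / (M\<^sup>2 / y)\<^sup>2"
    unfolding dtort_alt[OF mirror_gt[OF r]] ym unfolding my ..
  then show ?thesis unfolding dtort_alt[OF r] y_def[symmetric] using M_pos y by (simp add: power2_eq_square)
qed

text \<open>With \<open>dtort_mirror\<close>: the potential, as a density along \<open>r\<close>, is invariant under the inversion.\<close>

lemma pot_mirror: assumes r: "M < r" shows "pot (mirror r) * - (M\<^sup>2 / (r - M)\<^sup>2) = - pot r"
proof -
  define y where "y = r - M"
  have y: "0 < y" using r by (simp add: y_def)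
  have ym: "mirror r - M = M\<^sup>2 / y" and my: "mirror r = M * r / y"
    using mirror_alt[OF r] by (simp_all add: y_def mirror_def)
  have "pot (mirror r) = M * (M\<^sup>2 / y) / (M * r / y) ^ 4"
    unfolding pot_def ym unfolding my ..
  also have "\<dots> = y ^ 3 / (M * r ^ 4)"
    using M_pos y by (simp add: power2_eq_square power3_eq_cube power4_eq_xxxx mult_ac)
  finally have "pot (mirror r) = y ^ 3 / (M * r ^ 4)" .
  moreover have "pot r = M * y / r ^ 4" by (simp add: pot_def y_def)
  ultimately show ?thesis unfolding y_def[symmetric] using M_pos y
    by (simp add: power2_eq_square power3_eq_cube)
qed

text \<open>The reflected solution \<open>\<phi>(v, u)\<close>. Its \<open>L\<close>-derivative is the \<open>\<partial>\<^sub>u\<close>-derivative \<open>T \<phi> - L \<phi>\<close> of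
  the original one.\<close>

lemma tower_mirror:
  assumes "\<And>k. deriv_pair (fs k) (fs (Suc k))"
  shows "tower (\<lambda>k v r. sol (fs k) v (mirror r)) (\<lambda>k v r. sol (fs (Suc k)) v (mirror r) - solx (fs k) v (mirror r))"
  unfolding tower_def
proof (intro allI impI conjI)
  fix k v r assume r: "M < r"
  let ?s = "mirror r"
  have s: "M < ?s" by (rule mirror_gt[OF r])
  have z: "((\<lambda>r. 0) has_real_derivative 0) (at r)" by simp
  have S: "((\<lambda>(v, r). sol (fs k) (v + 0) (mirror r)) has_derivative (\<lambda>(h, l). sol (fs (Suc k)) v ?s * h
      + (- dtort r * solx (fs k) v ?s) * l)) (at (v, r))" for k
  proof (rule compose_deriv_shear[where g = "sol (fs k)" and c = "\<lambda>r. 0" and d = mirror, OF _ z mirror_deriv[OF r]])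
    show "((\<lambda>(x, y). sol (fs k) x y) has_derivative (\<lambda>(h, l). sol (fs (Suc k)) v ?s * h + (dtort ?s * solx (fs k) v ?s) * l)) (at (v + 0, ?s))"
      using sol_has_derivative[OF assms s] by simp
    show "sol (fs (Suc k)) v ?s * 0 + dtort ?s * solx (fs k) v ?s * - (M\<^sup>2 / (r - M)\<^sup>2) = - dtort r * solx (fs k) v ?s"
      unfolding dtort_mirror[OF r, symmetric] by simp
  qed
  show "((\<lambda>(v, r). sol (fs k) v (mirror r)) has_derivative (\<lambda>(h, l). sol (fs (Suc k)) v ?s * h
      + (dtort r * (sol (fs (Suc k)) v ?s - solx (fs k) v ?s - sol (fs (Suc k)) v ?s)) * l)) (at (v, r))"
    using S[of k] by simp
  have B: "((\<lambda>(v, r). solx (fs k) (v + 0) (mirror r)) has_derivative (\<lambda>(h, l). solx (fs (Suc k)) v ?s * h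
      + (- dtort r * solx (fs (Suc k)) v ?s - pot r * sol (fs k) v ?s) * l)) (at (v, r))"
  proof (rule compose_deriv_shear[where g = "solx (fs k)" and c = "\<lambda>r. 0" and d = mirror, OF _ z mirror_deriv[OF r]])
    show "((\<lambda>(x, y). solx (fs k) x y) has_derivative (\<lambda>(h, l). solx (fs (Suc k)) v ?s * h
        + (dtort ?s * solx (fs (Suc k)) v ?s + pot ?s * sol (fs k) v ?s) * l)) (at (v + 0, ?s))"
      using solx_has_derivative[OF assms s] by simp
    have "(dtort ?s * x + pot ?s * y) * - (M\<^sup>2 / (r - M)\<^sup>2)
        = (dtort ?s * - (M\<^sup>2 / (r - M)\<^sup>2)) * x + (pot ?s * - (M\<^sup>2 / (r - M)\<^sup>2)) * y" for x y
      by (simp add: algebra_simps)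
    then show "solx (fs (Suc k)) v ?s * 0 + (dtort ?s * solx (fs (Suc k)) v ?s + pot ?s * sol (fs k) v ?s) * - (M\<^sup>2 / (r - M)\<^sup>2)
        = - dtort r * solx (fs (Suc k)) v ?s - pot r * sol (fs k) v ?s"
      unfolding dtort_mirror[OF r] pot_mirror[OF r] by simp
  qed
  have "((\<lambda>z. (\<lambda>(v, r). sol (fs (Suc k)) (v + 0) (mirror r)) z - (\<lambda>(v, r). solx (fs k) (v + 0) (mirror r)) z) has_derivative
     (\<lambda>z. (\<lambda>(h, l). sol (fs (Suc (Suc k))) v ?s * h + (- dtort r * solx (fs (Suc k)) v ?s) * l) z
        - (\<lambda>(h, l). solx (fs (Suc k)) v ?s * h + (- dtort r * solx (fs (Suc k)) v ?s - pot r * sol (fs k) v ?s) * l) z)) (at (v, r))"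
    by (rule has_derivative_diff[OF S B])
  moreover have "(\<lambda>z. (\<lambda>(h, l). sol (fs (Suc (Suc k))) v ?s * h + (- dtort r * solx (fs (Suc k)) v ?s) * l) z
        - (\<lambda>(h, l). solx (fs (Suc k)) v ?s * h + (- dtort r * solx (fs (Suc k)) v ?s - pot r * sol (fs k) v ?s) * l) z)
      = (\<lambda>(h, l). (sol (fs (Suc (Suc k))) v ?s - solx (fs (Suc k)) v ?s) * h + (pot r * sol (fs k) v ?s) * l)"
    by (auto simp: fun_eq_iff algebra_simps)
  ultimately show "((\<lambda>(v, r). sol (fs (Suc k)) v (mirror r) - solx (fs k) v (mirror r)) has_derivative
      (\<lambda>(h, l). (sol (fs (Suc (Suc k))) v ?s - solx (fs (Suc k)) v ?s) * h + (pot r * sol (fs k) v ?s) * l)) (at (v, r))"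
    by (simp add: case_prod_unfold)
qed


section \<open>The two solutions and their traces\<close>

lemma pt_uv_props:
  assumes "w \<in> sphere 0 1"
  shows "rad (pt_uv M u v w) = r_uv M u v" "pt_uv M u v w $ 1 = v" "M < rad (pt_uv M u v w)"
    "pt_uv M u v w $ 1 - tort (rad (pt_uv M u v w)) = u"
proof -
  have r: "M < r_uv M u v" by (rule r_uv_gt)
  show 1: "rad (pt_uv M u v w) = r_uv M u v" unfolding pt_uv_def using rad_pt[OF assms] r M_pos by simp
  show 2: "pt_uv M u v w $ 1 = v" by (simp add: pt_uv_def pt_coords)
  show "M < rad (pt_uv M u v w)" using 1 r by simp
  show "pt_uv M u v w $ 1 - tort (rad (pt_uv M u v w)) = u" unfolding 1 2 tort_r_uv by simp
qed

lemma mirror_at_right: "filterlim mirror at_top (at_right M)"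
proof -
  have "((\<lambda>r. r - M) \<longlongrightarrow> 0) (at_right M)"
    by (rule tendsto_eq_rhs[OF tendsto_diff[OF tendsto_ident_at tendsto_const]]) simp
  moreover have "eventually (\<lambda>r. 0 < r - M) (at_right M)"
    using eventually_at_right_less[of M] by eventually_elim simp
  ultimately have "filterlim (\<lambda>r. M\<^sup>2 / (r - M)) at_top (at_right M)"
    using M_pos by (intro LIM_at_top_divide[OF tendsto_const]) auto
  then show ?thesis
    unfolding mirror_def[abs_def] by (rule filterlim_tendsto_add_at_top[OF tendsto_const])
qed

lemma rad_to_horizon:
  assumes "rad p0 = M" shows "filterlim rad (at_right M) (at p0 within exterior_open M)"
  unfolding filterlim_at
proof
  show "\<forall>\<^sub>F p in at p0 within exterior_open M. rad p \<in> {M<..} \<and> rad p \<noteq> M"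
    unfolding eventually_at_filter by (rule always_eventually) (auto simp: exterior_open_def)
  have "isCont rad p0" using continuous_rad by (simp add: continuous_on_eq_continuous_at)
  then show "(rad \<longlongrightarrow> M) (at p0 within exterior_open M)"
    using assms by (metis isCont_def tendsto_within_subset top_greatest)
qed

text \<open>The only part of \<open>wave_solution\<close> that a tower does not provide is the limit at the horizon.\<close>

lemma tower_wave_solution:
  assumes t: "tower A B" and \<psi>: "\<And>p. M < rad p \<Longrightarrow> \<psi> p = A 0 (p$1) (rad p) / rad p"
    and hor: "\<And>p. rad p = M \<Longrightarrow> \<psi> p = \<eta> (p$1)" and \<eta>: "continuous_on UNIV \<eta>"
    and lim: "\<And>p. rad p = M \<Longrightarrow> (\<psi> \<longlongrightarrow> \<eta> (p$1)) (at p within exterior_open M)"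
  shows "wave_solution M \<psi>"
  unfolding wave_solution_def
proof (intro conjI ballI)
  show "continuous_on (exterior M) \<psi>"
    unfolding continuous_on_def
  proof
    fix p assume p: "p \<in> exterior M"
    show "(\<psi> \<longlongrightarrow> \<psi> p) (at p within exterior M)"
    proof (cases "M < rad p")
      case True
      have "(\<psi> has_derivative (\<lambda>h. A 1 (p$1) (rad p) / rad p * h$1
          + (dtort (rad p) * (B 0 (p$1) (rad p) - A 1 (p$1) (rad p)) / rad p - A 0 (p$1) (rad p) / (rad p)\<^sup>2)
            * ((p$2 * h$2 + p$3 * h$3 + p$4 * h$4) / rad p))) (at p)"
        using tower_psi_rd[OF t \<psi> True] by (simp add: rd_def)
      from has_derivative_continuous[OF this] show ?thesis
        by (metis isCont_def tendsto_within_subset top_greatest)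
    next
      case False
      then have M: "rad p = M" using p by (simp add: exterior_def)
      have u: "exterior M = exterior_open M \<union> {p. rad p = M}"
        by (auto simp: exterior_def exterior_open_def)
      have "((\<lambda>q :: real^4. \<eta> (q$1)) \<longlongrightarrow> \<eta> (p$1)) (at p within {p. rad p = M})"
        using \<eta> by (intro isCont_tendsto_compose[OF _ fst_coord_tendsto]) (simp add: continuous_on_eq_continuous_at)
      then have "(\<psi> \<longlongrightarrow> \<eta> (p$1)) (at p within {p. rad p = M})"
        by (rule Lim_transform_eventually) (auto simp: eventually_at_filter hor intro!: always_eventually)
      with lim[OF M] show ?thesis unfolding u Lim_within_Un using hor[OF M] by simp
    qed
  qed
  show "smooth_on (exterior_open M) \<psi>" by (rule tower_smooth[OF t \<psi>])
  show "Defs.box M \<psi> p = 0" if "p \<in> exterior_open M" for p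
    by (rule tower_box[OF t \<psi>]) (use that in \<open>auto simp: exterior_open_def\<close>)
qed

text \<open>The solutions for the two parts of the theorem. The values at the horizon are the limits from
  outside.\<close>

definition psi_i :: "real^4 \<Rightarrow> real" where
  "psi_i p = (if M < rad p then sol prof1 (p$1 - tort (rad p)) (rad p) / rad p else 0)"

definition psi_ii :: "real^4 \<Rightarrow> real" where
  "psi_ii p = (if M < rad p then sol prof1 (p$1) (mirror (rad p)) / rad p else rad_field (p$1) / M)"

lemma towers:
  "\<exists>fs. fs 0 = prof1 \<and> fs (Suc 0) = prof2 \<and>
    tower (\<lambda>k v r. sol (fs k) (v - tort r) r) (\<lambda>k v r. solx (fs k) (v - tort r) r) \<and>
    tower (\<lambda>k v r. sol (fs k) v (mirror r)) (\<lambda>k v r. sol (fs (Suc k)) v (mirror r) - solx (fs k) v (mirror r))"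
proof -
  from prof_tower obtain fs where fs: "fs 0 = prof1 \<and> fs (Suc 0) = prof2 \<and> (\<forall>k. deriv_pair (fs k) (fs (Suc k)))" ..
  then have c: "deriv_pair (fs k) (fs (Suc k))" for k by simp
  show ?thesis
    by (rule exI[of _ fs]) (simp add: fs tower_forward[of fs, OF c] tower_mirror[of fs, OF c])
qed

lemma psi_i_wave: "wave_solution M psi_i"
proof -
  from towers obtain fs where fs_all: "fs 0 = prof1 \<and> fs (Suc 0) = prof2 \<and>
    tower (\<lambda>k v r. sol (fs k) (v - tort r) r) (\<lambda>k v r. solx (fs k) (v - tort r) r) \<and>
    tower (\<lambda>k v r. sol (fs k) v (mirror r)) (\<lambda>k v r. sol (fs (Suc k)) v (mirror r) - solx (fs k) v (mirror r))" ..
  then have fs: "fs 0 = prof1" "fs (Suc 0) = prof2" by simp_all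
  note t = fs_all[THEN conjunct2, THEN conjunct2, THEN conjunct1]
  show ?thesis
  proof (rule tower_wave_solution[OF t, where \<eta> = "\<lambda>_. 0"])
    show "psi_i p = sol (fs 0) (p$1 - tort (rad p)) (rad p) / rad p" if "M < rad p" for p
      using that by (simp add: psi_i_def fs)
    fix p :: "real^4" assume p: "rad p = M"
    show "psi_i p = 0" using p by (simp add: psi_i_def)
    have "filterlim (\<lambda>q. q$1 + tort (mirror (rad q))) at_top (at p within exterior_open M)"
      by (rule filterlim_tendsto_add_at_top[OF fst_coord_tendsto])
         (rule filterlim_compose[OF tort_at_top filterlim_compose[OF mirror_at_right rad_to_horizon[OF p]]])
    then have top: "filterlim (\<lambda>q. q$1 + tort (mirror (rad q))) at_top (at p within exterior_open M)" .
    show "(psi_i \<longlongrightarrow> 0) (at p within exterior_open M)"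
    proof (rule tendstoI)
      fix e :: real assume e: "0 < e"
      obtain K where f: "bcont K prof1" by (rule prof1_bcont)
      have e': "0 < e * M / 2" using e M_pos by simp
      from sol_small[OF f prof_tendsto(2) e'] obtain T where
        T: "\<forall>t\<ge>T. \<forall>r>M. \<bar>sol prof1 t r\<bar> \<le> e * M / 2 * (r / M) \<and> \<bar>solx prof1 t r\<bar> \<le> e * M / 2 * Dfun M r / (2 * M)" ..
      have "eventually (\<lambda>q. T \<le> q$1 + tort (mirror (rad q))) (at p within exterior_open M)"
        using top unfolding filterlim_at_top by simp
      moreover have "eventually (\<lambda>q. M < rad q) (at p within exterior_open M)"
        unfolding eventually_at_filter by (rule always_eventually) (auto simp: exterior_open_def)
      ultimately show "\<forall>\<^sub>F q in at p within exterior_open M. dist (psi_i q) 0 < e"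
      proof eventually_elim
        case (elim q)
        then have "\<bar>sol prof1 (q$1 - tort (rad q)) (rad q)\<bar> \<le> e * M / 2 * (rad q / M)"
          using T tort_mirror[of "rad q"] by simp
        also have "\<dots> = e / 2 * rad q" using M_pos by simp
        finally have "\<bar>psi_i q\<bar> \<le> e / 2" using elim M_pos by (simp add: psi_i_def field_simps)
        then show ?case using e by simp
      qed
    qed
  qed auto
qed

lemma psi_ii_wave: "wave_solution M psi_ii"
proof -
  from towers obtain fs where fs_all: "fs 0 = prof1 \<and> fs (Suc 0) = prof2 \<and>
    tower (\<lambda>k v r. sol (fs k) (v - tort r) r) (\<lambda>k v r. solx (fs k) (v - tort r) r) \<and>
    tower (\<lambda>k v r. sol (fs k) v (mirror r)) (\<lambda>k v r. sol (fs (Suc k)) v (mirror r) - solx (fs k) v (mirror r))" ..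
  then have fs: "fs 0 = prof1" "fs (Suc 0) = prof2" by simp_all
  note t = fs_all[THEN conjunct2, THEN conjunct2, THEN conjunct2]
  show ?thesis
  proof (rule tower_wave_solution[OF t, where \<eta> = "\<lambda>v. rad_field v / M"])
    show "psi_ii p = sol (fs 0) (p$1) (mirror (rad p)) / rad p" if "M < rad p" for p
      using that by (simp add: psi_ii_def fs)
    have "isCont rad_field v" for v by (rule DERIV_isCont[OF rad_field_deriv])
    then show "continuous_on UNIV (\<lambda>v. rad_field v / M)"
      using M_pos by (intro continuous_intros continuous_at_imp_continuous_on ballI) auto
    fix p :: "real^4" assume p: "rad p = M"
    show "psi_ii p = rad_field (p$1) / M" using p by (simp add: psi_ii_def)
    have "filterlim (\<lambda>q. (q$1, mirror (rad q))) (nhds (p$1) \<times>\<^sub>F at_top) (at p within exterior_open M)"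
      by (rule filterlim_Pair[OF fst_coord_tendsto filterlim_compose[OF mirror_at_right rad_to_horizon[OF p]]])
    from filterlim_compose[OF sol_far[OF prof_deriv_pair(1) prof_tendsto(1)] this]
    have "((\<lambda>q. sol prof1 (q$1) (mirror (rad q))) \<longlongrightarrow> rad_field (p$1)) (at p within exterior_open M)"
      by (simp add: rad_field_def)
    moreover have "(rad \<longlongrightarrow> M) (at p within exterior_open M)"
      using rad_to_horizon[OF p] by (rule filterlim_mono) (auto simp: at_within_def)
    ultimately have "((\<lambda>q. sol prof1 (q$1) (mirror (rad q)) / rad q) \<longlongrightarrow> rad_field (p$1) / M) (at p within exterior_open M)"
      using M_pos by (intro tendsto_divide) auto
    then show "(psi_ii \<longlongrightarrow> rad_field (p$1) / M) (at p within exterior_open M)"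
      by (rule Lim_transform_eventually)
         (auto simp: eventually_at_filter psi_ii_def exterior_open_def intro!: always_eventually)
  qed
qed

lemma psi_i_phi:
  assumes p: "M < rad p"
  shows "rad p * psi_i p = sol prof1 (p$1 - tort (rad p)) (rad p)"
    and "apply_vf (Lbar_vf M) (\<lambda>q. rad q * psi_i q) p = prof2 (p$1 - tort (rad p)) - pint prof1 (p$1 - tort (rad p)) (rad p)"
    and "rd psi_i (sol prof2 (p$1 - tort (rad p)) (rad p) / rad p)
      (dtort (rad p) * (pint prof1 (p$1 - tort (rad p)) (rad p) - prof2 (p$1 - tort (rad p))) / rad p
         - sol prof1 (p$1 - tort (rad p)) (rad p) / (rad p)\<^sup>2) p"
proof -
  from towers obtain fs where fs_all: "fs 0 = prof1 \<and> fs (Suc 0) = prof2 \<and>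
    tower (\<lambda>k v r. sol (fs k) (v - tort r) r) (\<lambda>k v r. solx (fs k) (v - tort r) r) \<and>
    tower (\<lambda>k v r. sol (fs k) v (mirror r)) (\<lambda>k v r. sol (fs (Suc k)) v (mirror r) - solx (fs k) v (mirror r))" ..
  then have fs: "fs 0 = prof1" "fs (Suc 0) = prof2" by simp_all
  note t = fs_all[THEN conjunct2, THEN conjunct2, THEN conjunct1]
  have fs1: "fs 1 = prof2" using fs(2) by simp
  have \<psi>: "psi_i q = sol (fs 0) (q$1 - tort (rad q)) (rad q) / rad q" if "M < rad q" for q
    using that by (simp add: psi_i_def fs)
  show "rad p * psi_i p = sol prof1 (p$1 - tort (rad p)) (rad p)" using p M_pos by (simp add: psi_i_def)
  note id = flux_identity[OF prof_deriv_pair(2) p, of "p$1 - tort (rad p)"]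
  show "apply_vf (Lbar_vf M) (\<lambda>q. rad q * psi_i q) p = prof2 (p$1 - tort (rad p)) - pint prof1 (p$1 - tort (rad p)) (rad p)"
    using tower_L(2)[OF t \<psi> p] id by (simp add: fs fs1)
  have "solx prof1 (p$1 - tort (rad p)) (rad p) - sol prof2 (p$1 - tort (rad p)) (rad p)
      = pint prof1 (p$1 - tort (rad p)) (rad p) - prof2 (p$1 - tort (rad p))" using id by simp
  then show "rd psi_i (sol prof2 (p$1 - tort (rad p)) (rad p) / rad p)
      (dtort (rad p) * (pint prof1 (p$1 - tort (rad p)) (rad p) - prof2 (p$1 - tort (rad p))) / rad p
         - sol prof1 (p$1 - tort (rad p)) (rad p) / (rad p)\<^sup>2) p"
    using tower_psi_rd[OF t \<psi> p] by (simp add: fs fs1)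
qed

lemma psi_ii_phi:
  assumes p: "M < rad p"
  shows "rad p * psi_ii p = sol prof1 (p$1) (mirror (rad p))"
    and "apply_vf (Lbar_vf M) (\<lambda>q. rad q * psi_ii q) p = solx prof1 (p$1) (mirror (rad p))"
    and "apply_vf (L_vf M) (\<lambda>q. rad q * psi_ii q) p = prof2 (p$1) - pint prof1 (p$1) (mirror (rad p))"
proof -
  from towers obtain fs where fs_all: "fs 0 = prof1 \<and> fs (Suc 0) = prof2 \<and>
    tower (\<lambda>k v r. sol (fs k) (v - tort r) r) (\<lambda>k v r. solx (fs k) (v - tort r) r) \<and>
    tower (\<lambda>k v r. sol (fs k) v (mirror r)) (\<lambda>k v r. sol (fs (Suc k)) v (mirror r) - solx (fs k) v (mirror r))" ..
  then have fs: "fs 0 = prof1" "fs (Suc 0) = prof2" by simp_all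
  note t = fs_all[THEN conjunct2, THEN conjunct2, THEN conjunct2]
  have fs1: "fs 1 = prof2" using fs(2) by simp
  have \<psi>: "psi_ii q = sol (fs 0) (q$1) (mirror (rad q)) / rad q" if "M < rad q" for q
    using that by (simp add: psi_ii_def fs)
  show "rad p * psi_ii p = sol prof1 (p$1) (mirror (rad p))" using p M_pos by (simp add: psi_ii_def)
  show "apply_vf (Lbar_vf M) (\<lambda>q. rad q * psi_ii q) p = solx prof1 (p$1) (mirror (rad p))"
    using tower_L(2)[OF t \<psi> p] by (simp add: fs fs1)
  show "apply_vf (L_vf M) (\<lambda>q. rad q * psi_ii q) p = prof2 (p$1) - pint prof1 (p$1) (mirror (rad p))"
    using tower_L(1)[OF t \<psi> p] flux_identity[OF prof_deriv_pair(2) mirror_gt[OF p], of "p$1"] by (simp add: fs fs1)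
qed

lemma psi_i_scri: "scri_trace M psi_i (\<lambda>u w. rad_field u) (\<lambda>u w. rad_field' u)"
  unfolding scri_trace_def restr_scri_def
proof (intro conjI allI ballI)
  fix u :: real and w :: "real^3" assume w: "w \<in> sphere 0 1"
  note p = pt_uv_props[OF w]
  have e1: "rad (pt_uv M u v w) * psi_i (pt_uv M u v w) = sol prof1 u (r_uv M u v)" for v
    unfolding psi_i_phi(1)[OF p(3)] by (simp add: p(1,2) tort_r_uv)
  have e2: "apply_vf (Lbar_vf M) (\<lambda>p. rad p * psi_i p) (pt_uv M u v w) = prof2 u - pint prof1 u (r_uv M u v)" for v
    unfolding psi_i_phi(2)[OF p(3)] by (simp add: p(1,2) tort_r_uv)
  have "filterlim (\<lambda>v. (u, r_uv M u v)) (nhds u \<times>\<^sub>F at_top) at_top"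
    by (rule filterlim_Pair[OF tendsto_const r_uv_at_top])
  from filterlim_compose[OF sol_far[OF prof_deriv_pair(1) prof_tendsto(1)] this]
  have "((\<lambda>v. sol prof1 u (r_uv M u v)) \<longlongrightarrow> rad_field u) at_top" by (simp add: rad_field_def)
  then show "((\<lambda>v. rad (pt_uv M u v w) * psi_i (pt_uv M u v w)) \<longlongrightarrow> rad_field u) at_top"
    unfolding e1 .
  obtain K where f: "bcont K prof1" by (rule prof1_bcont)
  have "((\<lambda>v. K * (1 - Dfun M (r_uv M u v)) / (2 * M)) \<longlongrightarrow> K * (1 - 1) / (2 * M)) at_top"
    using M_pos by (intro tendsto_intros filterlim_compose[OF Dfun_at_top r_uv_at_top]) auto
  then have z: "((\<lambda>v. K * (1 - Dfun M (r_uv M u v)) / (2 * M)) \<longlongrightarrow> 0) at_top" by simp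
  have "((\<lambda>v. pint prof1 u (r_uv M u v) - Gop prof1 u) \<longlongrightarrow> 0) at_top"
  proof (rule Lim_null_comparison[OF always_eventually z], rule allI)
    fix v show "norm (pint prof1 u (r_uv M u v) - Gop prof1 u) \<le> K * (1 - Dfun M (r_uv M u v)) / (2 * M)"
      using Gop_tail[OF f bcontD(2)[OF f] r_uv_gt, of u u v] by (simp add: abs_minus_commute)
  qed
  from tendsto_diff[OF tendsto_const[of "rad_field' u"] this]
  have "((\<lambda>v. prof2 u - pint prof1 u (r_uv M u v)) \<longlongrightarrow> rad_field' u) at_top"
    by (simp add: rad_field'_def)
  then show "((\<lambda>v. apply_vf (Lbar_vf M) (\<lambda>p. rad p * psi_i p) (pt_uv M u v w)) \<longlongrightarrow> rad_field' u) at_top"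
    unfolding e2 .
  show "(rad_field has_real_derivative rad_field' u) (at u)" by (rule rad_field_deriv)
qed

lemma psi_ii_scri: "scri_trace M psi_ii (\<lambda>u w. 0) (\<lambda>u w. 0)"
  unfolding scri_trace_def restr_scri_def
proof (intro conjI allI ballI)
  fix u :: real and w :: "real^3" assume w: "w \<in> sphere 0 1"
  note p = pt_uv_props[OF w]
  have e1: "rad (pt_uv M u v w) * psi_ii (pt_uv M u v w) = sol prof1 v (mirror (r_uv M u v))" for v
    unfolding psi_ii_phi(1)[OF p(3)] by (simp add: p(1,2))
  have e2: "apply_vf (Lbar_vf M) (\<lambda>p. rad p * psi_ii p) (pt_uv M u v w) = solx prof1 v (mirror (r_uv M u v))" for v
    unfolding psi_ii_phi(2)[OF p(3)] by (simp add: p(1,2))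
  obtain K where f: "bcont K prof1" by (rule prof1_bcont)
  have small: "eventually (\<lambda>v. \<bar>sol prof1 v (mirror (r_uv M u v))\<bar> < e \<and> \<bar>solx prof1 v (mirror (r_uv M u v))\<bar> < e) at_top" if e: "0 < e" for e
  proof -
    define e' where "e' = min (e / 3) (e * M / 2)"
    have e': "0 < e'" "e' \<le> e / 3" "e' \<le> e * M / 2" using e M_pos by (auto simp: e'_def)
    from sol_small[OF f prof_tendsto(2) e'(1)] obtain T where
      T: "\<forall>t\<ge>T. \<forall>r>M. \<bar>sol prof1 t r\<bar> \<le> e' * (r / M) \<and> \<bar>solx prof1 t r\<bar> \<le> e' * Dfun M r / (2 * M)" ..
    have "eventually (\<lambda>v. 2 * M \<le> r_uv M u v) at_top" using r_uv_at_top unfolding filterlim_at_top by simp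
    then show ?thesis using eventually_ge_at_top[of T]
    proof eventually_elim
      case (elim v)
      have g: "M < r_uv M u v" by (rule r_uv_gt)
      have "M\<^sup>2 / (r_uv M u v - M) \<le> M" using elim M_pos g by (simp add: field_simps power2_eq_square)
      then have m: "mirror (r_uv M u v) / M \<le> 2" using M_pos by (simp add: mirror_def field_simps)
      have b: "\<bar>sol prof1 v (mirror (r_uv M u v))\<bar> \<le> e' * (mirror (r_uv M u v) / M)"
        "\<bar>solx prof1 v (mirror (r_uv M u v))\<bar> \<le> e' * Dfun M (mirror (r_uv M u v)) / (2 * M)"
        using T elim(2) mirror_gt[OF g] by auto
      have "e' * (mirror (r_uv M u v) / M) \<le> e / 3 * 2"
        using e' m mirror_gt[OF g] M_pos by (intro mult_mono) auto
      moreover have "e' * Dfun M (mirror (r_uv M u v)) / (2 * M) \<le> (e * M / 2) * 1 / (2 * M)"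
        using e' M_pos mirror_gt[OF g] Dfun_le_one[of "mirror (r_uv M u v)"] Dfun_nonneg e
        by (intro divide_right_mono mult_mono) auto
      moreover have "(e * M / 2) * 1 / (2 * M) = e / 4" using M_pos by simp
      ultimately show ?case using b e by linarith
    qed
  qed
  show "((\<lambda>v. rad (pt_uv M u v w) * psi_ii (pt_uv M u v w)) \<longlongrightarrow> 0) at_top"
    unfolding e1
  proof (rule tendstoI)
    fix e :: real assume "0 < e"
    from small[OF this] show "\<forall>\<^sub>F v in at_top. dist (sol prof1 v (mirror (r_uv M u v))) 0 < e"
      by eventually_elim simp
  qed
  show "((\<lambda>v. apply_vf (Lbar_vf M) (\<lambda>p. rad p * psi_ii p) (pt_uv M u v w)) \<longlongrightarrow> 0) at_top"
    unfolding e2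
  proof (rule tendstoI)
    fix e :: real assume "0 < e"
    from small[OF this] show "\<forall>\<^sub>F v in at_top. dist (solx prof1 v (mirror (r_uv M u v))) 0 < e"
      by eventually_elim simp
  qed
qed simp

lemma psi_i_horizon:
  assumes "w \<in> sphere 0 1" shows "psi_i (pt v M w) = 0"
  using rad_pt[OF assms, of M v] M_pos by (simp add: psi_i_def)

lemma psi_i_horizon_trace: "horizon_trace M psi_i (\<lambda>v w. 0) (\<lambda>v w. 0)"
  by (simp add: horizon_trace_def psi_i_horizon)

lemma psi_ii_horizon_trace: "horizon_trace M psi_ii (\<lambda>v w. rad_field v) (\<lambda>v w. rad_field' v)"
  unfolding horizon_trace_def
proof (intro allI ballI conjI)
  fix v :: real and w :: "real^3" assume w: "w \<in> sphere 0 1"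
  show "rad_field v = M * psi_ii (pt v M w)"
    using rad_pt[OF w, of M v] M_pos by (simp add: psi_ii_def pt_coords)
qed (rule rad_field_deriv)

text \<open>On the outgoing null part of the hypersurface \<open>L(r\<psi>)\<close> is, by reflection, bounded below like
  \<open>v\<^sup>-\<^sup>3\<^sup>/\<^sup>2\<close> on the set of large sine, and the weight is \<open>r\<^sup>2 \<ge> (v / 12)\<^sup>2\<close>.\<close>

lemma psi_ii_weighted_infinite:
  assumes R0: "M < R0"
  shows "weighted_N_flux M rH rI v0 h N psi_ii R0 = \<infinity>"
proof -
  define u0 where "u0 = u_Sigma M rI v0 h"
  obtain s where s: "0 < s" "emeasure sphere_measure (space sphere_measure) = ennreal s"
    using sphere_measure_total by blast
  define T where "T = max (2 * \<bar>u0\<bar> + 1) (u0 + tort R0 + 1)"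
  let ?I = "\<lambda>v. \<integral>\<^sup>+w. (let p = pt_uv M u0 v w in ennreal ((rad p)\<^sup>2 * (apply_vf (L_vf M) (\<lambda>q. rad q * psi_ii q) p)\<^sup>2)) \<partial>sphere_measure"
  have "(\<integral>\<^sup>+v. ?I v * indicator {v. R0 \<le> r_uv M u0 v} v \<partial>lborel) = \<infinity>"
  \<comment> \<open>\<open>1152 = 8 * 12\<^sup>2\<close>: \<open>8\<close> from \<open>env_six_lower\<close>, \<open>12\<^sup>2\<close> from \<open>r \<ge> (1 + v) / 12\<close>.\<close>
  proof (rule osc_integral_infinite[of "s / 1152" T])
    show "0 < s / 1152" "0 \<le> T" using s by (auto simp: T_def)
    fix v assume v: "T \<le> v" "1 / 2 \<le> \<bar>sin (lam * v)\<bar>"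
    have v0: "0 \<le> v" "2 * \<bar>u0\<bar> + 1 \<le> v" "u0 + tort R0 < v" using v(1) by (auto simp: T_def)
    have "\<not> r_uv M u0 v \<le> R0" using r_uv_le_iff[OF R0, of u0 v] v0 by simp
    then have mem: "v \<in> {v. R0 \<le> r_uv M u0 v}" by simp
    have "2 * u0 + 1 \<le> v" using v0(2) abs_ge_self[of u0] by linarith
    then have "(1 + v) / 2 \<le> v - u0" by (simp add: field_simps)
    also have "v - u0 \<le> 6 * (r_uv M u0 v - M)"
      using tort_upper[OF r_uv_gt, of u0 v] by (simp add: tort_r_uv)
    finally have "(1 + v) / 12 \<le> r_uv M u0 v" using M_pos by simp
    then have r2: "((1 + v) / 12)\<^sup>2 \<le> (r_uv M u0 v)\<^sup>2" using v0 by (intro power_mono) auto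
    have low: "ennreal (1 / 1152 / (1 + v)) \<le> (let p = pt_uv M u0 v w in ennreal ((rad p)\<^sup>2 * (apply_vf (L_vf M) (\<lambda>q. rad q * psi_ii q) p)\<^sup>2))"
      if w: "w \<in> sphere 0 1" for w
    proof -
      note p = pt_uv_props[OF w, of u0 v]
      have L: "apply_vf (L_vf M) (\<lambda>q. rad q * psi_ii q) (pt_uv M u0 v w) = prof2 v - pint prof1 v (mirror (r_uv M u0 v))"
        unfolding psi_ii_phi(3)[OF p(3)] p(1) p(2) ..
      have "1 / (8 * (1 + v) ^ 3) \<le> (prof2 v - pint prof1 v (mirror (r_uv M u0 v)))\<^sup>2"
        by (rule order_trans[OF env_six_lower[OF v0(1)] rad_field'_lower(2)[OF v0(1) v(2) mirror_gt[OF r_uv_gt]]])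
      with r2 have "((1 + v) / 12)\<^sup>2 * (1 / (8 * (1 + v) ^ 3)) \<le> (r_uv M u0 v)\<^sup>2 * (prof2 v - pint prof1 v (mirror (r_uv M u0 v)))\<^sup>2"
        using v0 by (intro mult_mono) auto
      moreover have "((1 + v) / 12)\<^sup>2 * (1 / (8 * (1 + v) ^ 3)) = 1 / 1152 / (1 + v)"
        using v0 by (simp add: power_divide power2_eq_square power3_eq_cube)
      ultimately show ?thesis unfolding Let_def L p(1) by (intro ennreal_leI) simp
    qed
    have "ennreal (s / 1152 / (1 + v)) = ennreal (1 / 1152 / (1 + v)) * ennreal s"
      using s v0 by (simp add: ennreal_mult'[symmetric])
    also have "\<dots> \<le> ?I v"
      using nn_integral_sphere_lower[OF low] by (simp add: s(2))
    finally show "ennreal (s / 1152 / (1 + v)) \<le> ?I v * indicator {v. R0 \<le> r_uv M u0 v} v" using mem by simp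
  qed
  then show ?thesis unfolding weighted_N_flux_def u0_def by simp
qed

end

section \<open>The energy flux through the ingoing cone\<close>

text \<open>\<open>Lbar\<close> is null, so the \<open>v\<close>-derivative \<open>a\<close> drops out of the flux through an ingoing cone. The
  remaining factor depends on the vector field alone.\<close>

lemma J_current_Lbar:
  assumes r: "rd \<psi> a b p"
  shows "J_current M N \<psi> p \<bullet> Lbar_vf M p = Dfun M (rad p) / 2 * b\<^sup>2 *
    (Dfun M (rad p) / 2 * N p $ 1 - (p$2 * N p $ 2 + p$3 * N p $ 3 + p$4 * N p $ 4) / rad p)"
proof -
  have p: "0 < rad p" using r by (simp add: rd_def)
  define x y z d where "x = p$2 / rad p" and "y = p$3 / rad p" and "z = p$4 / rad p" and "d = Dfun M (rad p)"
  have u: "x\<^sup>2 + y\<^sup>2 + z\<^sup>2 = 1" using rad_unit[OF p] by (simp add: x_def y_def z_def)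
  define n1 n2 n3 n4 where "n1 = N p $ 1" and "n2 = N p $ 2" and "n3 = N p $ 3" and "n4 = N p $ 4"
  have pdv: "pd 1 \<psi> p = a" "pd 2 \<psi> p = b * x" "pd 3 \<psi> p = b * y" "pd 4 \<psi> p = b * z"
    by (simp_all add: pd_rd[OF r] x_def y_def z_def)
  define G where "G = (\<Sum>k\<in>UNIV. \<Sum>l\<in>UNIV. inv_metric M p $ k $ l * pd k \<psi> p * pd l \<psi> p)"
  have G: "G = 2 * a * b + d * b\<^sup>2"
  proof -
    have "G = 2 * (a * b) * (x\<^sup>2 + y\<^sup>2 + z\<^sup>2) + b\<^sup>2 * (x\<^sup>2 + y\<^sup>2 + z\<^sup>2) + (d - 1) * b\<^sup>2 * (x\<^sup>2 + y\<^sup>2 + z\<^sup>2)\<^sup>2"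
      unfolding G_def sum_4
      by (simp add: inv_metric_entry[OF p] pdv x_def[symmetric] y_def[symmetric] z_def[symmetric] d_def[symmetric]
          power2_eq_square algebra_simps)
    then show ?thesis unfolding u by (simp add: algebra_simps)
  qed
  define Nr where "Nr = x * n2 + y * n3 + z * n4"
  have Q: "Q_tensor M \<psi> p i j = pd i \<psi> p * pd j \<psi> p - 1/2 * metric M p $ i $ j * G" for i j
    by (simp add: Q_tensor_def G_def)
  have J: "J_current M N \<psi> p $ i = pd i \<psi> p * (a * n1 + b * Nr)
      - 1/2 * G * (\<Sum>j\<in>UNIV. metric M p $ i $ j * N p $ j)" for i
    unfolding J_current_def sum_4 by (simp add: Q pdv n1_def n2_def n3_def n4_def Nr_def algebra_simps)
  have gN: "(\<Sum>j\<in>UNIV. metric M p $ 2 $ j * N p $ j) = x * n1 + n2 - x * Nr"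
    "(\<Sum>j\<in>UNIV. metric M p $ 3 $ j * N p $ j) = y * n1 + n3 - y * Nr"
    "(\<Sum>j\<in>UNIV. metric M p $ 4 $ j * N p $ j) = z * n1 + n4 - z * Nr"
    unfolding sum_4 metric_entry
    by (simp_all add: x_def[symmetric] y_def[symmetric] z_def[symmetric] n1_def n2_def n3_def n4_def Nr_def algebra_simps)
  have Lb: "Lbar_vf M p $ 1 = 0" "Lbar_vf M p $ 2 = - (d / 2) * x" "Lbar_vf M p $ 3 = - (d / 2) * y" "Lbar_vf M p $ 4 = - (d / 2) * z"
    by (simp_all add: Lbar_vf_def R_vf_def d_def x_def y_def z_def)
  have e: "J_current M N \<psi> p \<bullet> Lbar_vf M p = J_current M N \<psi> p $ 1 * Lbar_vf M p $ 1
      + J_current M N \<psi> p $ 2 * Lbar_vf M p $ 2 + J_current M N \<psi> p $ 3 * Lbar_vf M p $ 3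
      + J_current M N \<psi> p $ 4 * Lbar_vf M p $ 4"
    by (simp add: inner_vec_def sum_4)
  have "J_current M N \<psi> p \<bullet> Lbar_vf M p = - (d / 2) * (
      b * (a * n1 + b * Nr) * (x\<^sup>2 + y\<^sup>2 + z\<^sup>2)
      - 1/2 * G * (n1 * (x\<^sup>2 + y\<^sup>2 + z\<^sup>2) + Nr - Nr * (x\<^sup>2 + y\<^sup>2 + z\<^sup>2)))"
    unfolding e Lb J gN pdv
    by (simp add: Nr_def power2_eq_square algebra_simps add_divide_distrib diff_divide_distrib)
  also have "\<dots> = d / 2 * b\<^sup>2 * (d / 2 * n1 - Nr)"
    unfolding u G by (simp add: power2_eq_square algebra_simps)
  finally show ?thesis
    by (simp add: d_def n1_def Nr_def n2_def n3_def n4_def x_def y_def z_def add_divide_distrib)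
qed

text \<open>The last two terms are the squared length of the part of \<open>X\<close> tangent to the spheres.\<close>

lemma gprod_self:
  assumes p: "0 < rad p"
  shows "gprod M p X X = - Dfun M (rad p) * (X$1)\<^sup>2 + 2 * X$1 * ((p$2 * X$2 + p$3 * X$3 + p$4 * X$4) / rad p)
     + ((X$2)\<^sup>2 + (X$3)\<^sup>2 + (X$4)\<^sup>2) - ((p$2 * X$2 + p$3 * X$3 + p$4 * X$4) / rad p)\<^sup>2"
proof -
  define x y z d where "x = p$2 / rad p" and "y = p$3 / rad p" and "z = p$4 / rad p" and "d = Dfun M (rad p)"
  have "(p$2 * X$2 + p$3 * X$3 + p$4 * X$4) / rad p = x * X$2 + y * X$3 + z * X$4"
    by (simp add: x_def y_def z_def add_divide_distrib)
  then show ?thesis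
    unfolding gprod_def inner_vec_def matrix_vector_mult_def sum_4
    by (simp add: metric_entry sum_4 x_def[symmetric] y_def[symmetric] z_def[symmetric] d_def[symmetric]
        power2_eq_square algebra_simps)
qed

text \<open>By the Lagrange identity the part tangent to the spheres contributes nonnegatively, so a timelike
  vector has \<open>D (X\<^sup>v)\<^sup>2 > 2 X\<^sup>v X\<^sup>r\<close>.\<close>

lemma timelike_radial:
  assumes p: "0 < rad p" and neg: "gprod M p X X < 0"
  shows "X$1 \<noteq> 0" and "0 < X$1 \<Longrightarrow> (p$2 * X$2 + p$3 * X$3 + p$4 * X$4) / rad p < Dfun M (rad p) / 2 * X$1"
proof -
  define x y z where "x = p$2 / rad p" and "y = p$3 / rad p" and "z = p$4 / rad p"
  define R where "R = (p$2 * X$2 + p$3 * X$3 + p$4 * X$4) / rad p"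
  have u: "x\<^sup>2 + y\<^sup>2 + z\<^sup>2 = 1" using rad_unit[OF p] by (simp add: x_def y_def z_def)
  have R: "R = x * X$2 + y * X$3 + z * X$4" by (simp add: R_def x_def y_def z_def add_divide_distrib)
  have "(X$2)\<^sup>2 + (X$3)\<^sup>2 + (X$4)\<^sup>2 - R\<^sup>2
      = (x * X$3 - y * X$2)\<^sup>2 + (x * X$4 - z * X$2)\<^sup>2 + (y * X$4 - z * X$3)\<^sup>2"
    using u unfolding R by algebra
  then have "0 \<le> (X$2)\<^sup>2 + (X$3)\<^sup>2 + (X$4)\<^sup>2 - R\<^sup>2" by simp
  then have neg': "- Dfun M (rad p) * (X$1)\<^sup>2 + 2 * X$1 * R < 0"
    using neg unfolding gprod_self[OF p] R_def[symmetric] by linarith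
  then show "X$1 \<noteq> 0" by auto
  show "R < Dfun M (rad p) / 2 * X$1" if "0 < X$1"
  proof -
    have "X$1 * (2 * R) < X$1 * (Dfun M (rad p) * X$1)" using neg' by (simp add: power2_eq_square algebra_simps)
    then show ?thesis using that by (simp add: mult_less_cancel_left_pos)
  qed
qed

lemma smooth_on_continuous: "smooth_on S f \<Longrightarrow> continuous_on S f"
proof -
  assume "smooth_on S f"
  then obtain U F where "S \<subseteq> U" "C_on 0 F U" "\<forall>x\<in>S. f x = F x" unfolding smooth_on_def by blast
  then show ?thesis using continuous_on_subset[of U F S] continuous_on_cong[of S S f F] by simp
qed

context ern begin

text \<open>\<open>N\<close> equals \<open>T\<close> far out, and its \<open>v\<close>-component cannot vanish on the way inwards along a ray.\<close>

lemma N_future: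
  assumes N: "N_field M N" and p: "p \<in> exterior M"
  shows "0 < N p $ 1"
proof (rule ccontr)
  assume neg: "\<not> 0 < N p $ 1"
  define q where "q t = (\<chi> i. if i = 1 then p$1 else t * p$i)" for t :: real
  have rp: "M \<le> rad p" "0 < rad p" using p M_pos by (auto simp: exterior_def)
  have q: "rad (q t) = t * rad p" if "0 \<le> t" for t
  proof -
    have "(t * p$2)\<^sup>2 + (t * p$3)\<^sup>2 + (t * p$4)\<^sup>2 = t\<^sup>2 * ((p$2)\<^sup>2 + (p$3)\<^sup>2 + (p$4)\<^sup>2)"
      by (simp add: power_mult_distrib distrib_left)
    then show ?thesis using that by (simp add: rad_def q_def real_sqrt_mult)
  qed
  have qe: "q t \<in> exterior M" if "1 \<le> t" for t
  proof -
    have "1 * rad p \<le> t * rad p" using that rp by (intro mult_right_mono) auto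
    then have "M \<le> t * rad p" using rp by linarith
    then show ?thesis using that by (simp add: exterior_def q)
  qed
  have q1: "q 1 = p" by (simp add: q_def vec_eq_iff)
  obtain R where R: "\<forall>p\<in>exterior M. R \<le> rad p \<longrightarrow> N p = T_vf p" using N by (auto simp: N_field_def)
  define t where "t = max 1 (R / rad p)"
  have t: "1 \<le> t" "R \<le> rad (q t)" using rp by (auto simp: t_def q field_simps max_def)
  then have "N (q t) = T_vf (q t)" using R qe by blast
  then have end1: "N (q t) $ 1 = 1" by (simp add: T_vf_def axis_def)
  have c: "continuous_on {1..t} (\<lambda>s. N (q s) $ 1)"
  proof (rule continuous_on_compose2[of "exterior M" "\<lambda>p. N p $ 1"])
    show "continuous_on (exterior M) (\<lambda>p. N p $ 1)" using N by (intro smooth_on_continuous) (simp add: N_field_def)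
    have "continuous_on {1..t} (\<lambda>s. if i = 1 then p$1 else s * p$i)" for i :: 4
      by (cases "i = 1") (auto intro!: continuous_intros)
    then show "continuous_on {1..t} q" unfolding q_def[abs_def] by (rule continuous_on_vec_lambda)
  qed (use qe in auto)
  have "\<exists>s\<ge>1. s \<le> t \<and> N (q s) $ 1 = 0"
    by (rule IVT'[of "\<lambda>s. N (q s) $ 1"]) (use neg q1 end1 t c in auto)
  then obtain s where s: "1 \<le> s" "N (q s) $ 1 = 0" by blast
  have "0 < rad (q s)" using s rp by (simp add: q)
  moreover have "gprod M (q s) (N (q s)) (N (q s)) < 0" using N qe[OF s(1)] by (simp add: N_field_def)
  ultimately show False using timelike_radial(1) s(2) by blast
qed

definition N_coeff :: "(real^4 \<Rightarrow> real^4) \<Rightarrow> real^4 \<Rightarrow> real" where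
  "N_coeff N p = Dfun M (rad p) / 2 * N p $ 1 - (p$2 * N p $ 2 + p$3 * N p $ 3 + p$4 * N p $ 4) / rad p"

text \<open>The coefficient of \<open>J_current_Lbar\<close> is positive up to and including the horizon, hence bounded
  below on a compact part of the cone. This is where \<open>N\<close> differs from \<open>T\<close>, whose coefficient
  \<open>D / 2\<close> degenerates.\<close>

lemma N_coeff_lower:
  assumes N: "N_field M N"
  shows "\<exists>c>0. \<forall>p\<in>exterior M. p$1 = v \<and> rad p \<le> R \<longrightarrow> c \<le> N_coeff N p"
proof -
  define K where "K = {p \<in> exterior M. p$1 = v \<and> rad p \<le> R}"
  have pos: "0 < N_coeff N p" if p: "p \<in> exterior M" for p
    using timelike_radial(2)[of p M "N p"] N_future[OF N p] N p M_pos
    by (auto simp: N_coeff_def N_field_def exterior_def)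
  have Nc: "continuous_on (exterior M) (\<lambda>p. N p $ i)" for i
    using N by (intro smooth_on_continuous) (simp add: N_field_def)
  have rc: "continuous_on (exterior M) rad" by (rule continuous_on_subset[OF continuous_rad]) simp
  have "continuous_on (exterior M) (N_coeff N)"
    unfolding N_coeff_def[abs_def] Dfun_def using M_pos
    by (intro continuous_intros Nc rc) (auto simp: exterior_def)
  then have c: "continuous_on K (N_coeff N)" by (rule continuous_on_subset) (auto simp: K_def)
  have "closed K"
  proof -
    have "closed {p. M \<le> rad p \<and> p$1 = v \<and> rad p \<le> R}"
      by (intro closed_Collect_conj closed_Collect_le closed_Collect_eq continuous_on_const continuous_rad continuous_intros)
    moreover have "K = {p. M \<le> rad p \<and> p$1 = v \<and> rad p \<le> R}" by (auto simp: K_def exterior_def)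
    ultimately show ?thesis by simp
  qed
  moreover have "bounded K"
  proof (rule boundedI)
    fix p assume p: "p \<in> K"
    have "(norm p)\<^sup>2 = p \<bullet> p" by (rule power2_norm_eq_inner)
    also have "\<dots> = (p$1)\<^sup>2 + (rad p)\<^sup>2"
      by (simp add: inner_vec_def sum_4 rad_def) (simp add: power2_eq_square)
    also have "\<dots> \<le> v\<^sup>2 + R\<^sup>2"
      using p M_pos by (auto simp: K_def exterior_def intro!: power_mono)
    finally show "norm p \<le> sqrt (v\<^sup>2 + R\<^sup>2)" by (rule real_le_rsqrt)
  qed
  ultimately have K: "compact K" by (simp add: compact_eq_bounded_closed)
  show ?thesis
  proof (cases "K = {}")
    case True then show ?thesis by (intro exI[of _ 1]) (auto simp: K_def)
  next
    case False
    from continuous_attains_inf[OF K False c] obtain p where p: "p \<in> K" "\<forall>q\<in>K. N_coeff N p \<le> N_coeff N q" by blast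
    then show ?thesis using pos[of p] by (intro exI[of _ "N_coeff N p"]) (auto simp: K_def)
  qed
qed

text \<open>Along the ingoing cone \<open>dtort\<close> grows like \<open>u\<^sup>2\<close>: this is the weight of the nondegenerate
  energy.\<close>

lemma dtort_near_horizon:
  assumes r: "M < r" and t: "0 \<le> - tort r"
  shows "(tort r)\<^sup>2 / (18 * M\<^sup>2) \<le> dtort r"
proof -
  define y where "y = r - M"
  have y: "0 < y" using r by (simp add: y_def)
  have "- tort r \<le> 6 * M\<^sup>2 / y" using tort_lower[OF r] by (simp add: y_def)
  then have "(- tort r)\<^sup>2 \<le> (6 * M\<^sup>2 / y)\<^sup>2" using t by (intro power_mono) auto
  then have "(tort r)\<^sup>2 / (18 * M\<^sup>2) \<le> (6 * M\<^sup>2 / y)\<^sup>2 / (18 * M\<^sup>2)"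
    using M_pos by (intro divide_right_mono) auto
  also have "\<dots> = 2 * M\<^sup>2 / y\<^sup>2" using M_pos y by (simp add: power_divide power2_eq_square)
  also have "\<dots> \<le> 2 * r\<^sup>2 / y\<^sup>2" using M_pos r by (intro divide_right_mono mult_left_mono power_mono) auto
  also have "\<dots> = dtort r" using dtort_alt[OF r] by (simp add: y_def)
  finally show ?thesis .
qed

text \<open>Up to the positive coefficient the flux density is \<open>D (r\<^sup>2 (\<partial>\<^sub>r\<psi>)\<^sup>2) / 2\<close>, and
  \<open>r \<partial>\<^sub>r\<psi> = - dtort \<partial>\<^sub>u\<phi> - \<phi> / r\<close>. The square of the first term carries the weight
  \<open>D dtort\<^sup>2 = 2 dtort\<close>; the second one is bounded by the same envelope without the weight.\<close>

lemma psi_i_integrand_lower: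
  assumes u: "0 \<le> u" "1 / 2 \<le> \<bar>sin (lam * u)\<bar>" and r: "M < r" and w: "w \<in> sphere 0 1"
    and p: "p = pt_uv M u v w" and r': "r = rad p" and c: "0 < c" "c \<le> N_coeff N p"
  shows "c / 2 * (dtort r - ((lam + 2) / M)\<^sup>2) * (env u ^ 3)\<^sup>2 \<le> J_current M N psi_i p \<bullet> Lbar_vf M p * (rad p)\<^sup>2"
proof -
  have pu: "p$1 - tort (rad p) = u" unfolding p by (rule pt_uv_props(4)[OF w])
  define a0 where "a0 = sol prof1 u r"
  define k where "k = pint prof1 u r - prof2 u"
  define b where "b = dtort r * k / r - a0 / r\<^sup>2"
  define E where "E = (env u ^ 3)\<^sup>2"
  have r0: "0 < r" using r M_pos by simp
  have rdp: "rd psi_i (sol prof2 u r / r) b p"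
    using psi_i_phi(3)[of p] r unfolding pu b_def a0_def k_def r' by simp
  obtain K where f: "bcont K prof1" by (rule prof1_bcont)
  have "\<bar>a0\<bar> \<le> (lam + 2) * env u ^ 3 * (r / M)"
    unfolding a0_def by (rule sol_bound[OF f prof1_decay order_refl r])
  then have "\<bar>a0 / r\<bar> \<le> (lam + 2) / M * env u ^ 3" using r0 M_pos by (simp add: field_simps)
  from power_mono[OF this, of 2] have a0: "(a0 / r)\<^sup>2 \<le> ((lam + 2) / M)\<^sup>2 * E"
    unfolding E_def by (simp only: power2_abs power_mult_distrib)
  have k: "E \<le> k\<^sup>2" using rad_field'_lower(2)[OF u r] by (simp add: E_def k_def power2_commute)
  have D: "0 < Dfun M r" "Dfun M r \<le> 1" "Dfun M r * dtort r = 2" "0 < dtort r"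
    using Dfun_pos[OF r] Dfun_le_one[of r] Dfun_dtort[OF r] dtort_pos[OF r] r by auto
  have sq: "Dfun M r * (r * b)\<^sup>2 \<ge> dtort r * k\<^sup>2 - Dfun M r * (a0 / r)\<^sup>2"
  proof -
    have rb: "r * b = dtort r * k - a0 / r" using r0 by (simp add: b_def right_diff_distrib power2_eq_square)
    have "(X - Y)\<^sup>2 \<ge> X\<^sup>2 / 2 - Y\<^sup>2" for X Y :: real
      using zero_le_power2[of "X - 2 * Y"] by (simp add: power2_eq_square algebra_simps)
    from mult_left_mono[OF this less_imp_le[OF D(1)], of "dtort r * k" "a0 / r"]
    have "Dfun M r * ((dtort r * k)\<^sup>2 / 2 - (a0 / r)\<^sup>2) \<le> Dfun M r * (r * b)\<^sup>2" unfolding rb .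
    moreover have "Dfun M r * ((dtort r * k)\<^sup>2 / 2 - (a0 / r)\<^sup>2)
        = (Dfun M r * dtort r) * dtort r * k\<^sup>2 / 2 - Dfun M r * (a0 / r)\<^sup>2"
      by (simp add: power2_eq_square algebra_simps)
    ultimately show ?thesis unfolding D(3) by simp
  qed
  have "(dtort r - ((lam + 2) / M)\<^sup>2) * E \<le> dtort r * k\<^sup>2 - Dfun M r * (a0 / r)\<^sup>2"
  proof -
    have "dtort r * E \<le> dtort r * k\<^sup>2" using k D by (intro mult_left_mono) auto
    moreover have "Dfun M r * (a0 / r)\<^sup>2 \<le> 1 * (((lam + 2) / M)\<^sup>2 * E)"
      using a0 D by (intro mult_mono) auto
    ultimately show ?thesis by (simp add: left_diff_distrib)
  qed
  with sq have low: "(dtort r - ((lam + 2) / M)\<^sup>2) * E \<le> Dfun M r * (r * b)\<^sup>2" by linarith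
  have J: "J_current M N psi_i p \<bullet> Lbar_vf M p * (rad p)\<^sup>2 = (Dfun M r * (r * b)\<^sup>2) / 2 * N_coeff N p"
    unfolding J_current_Lbar[OF rdp] N_coeff_def r'[symmetric] by (simp add: power_mult_distrib)
  have nn: "0 \<le> Dfun M r * (r * b)\<^sup>2" using D by simp
  have "c / 2 * (dtort r - ((lam + 2) / M)\<^sup>2) * E = (dtort r - ((lam + 2) / M)\<^sup>2) * E / 2 * c" by simp
  also have "\<dots> \<le> (Dfun M r * (r * b)\<^sup>2) / 2 * c"
    using low c by (intro mult_right_mono divide_right_mono) auto
  also have "\<dots> \<le> (Dfun M r * (r * b)\<^sup>2) / 2 * N_coeff N p"
    using nn c by (intro mult_left_mono) auto
  finally show ?thesis unfolding J E_def .
qed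

lemma psi_i_flux_infinite:
  assumes N: "N_field M N" and rH: "M < rH" and r0: "M < r0"
  shows "N_flux M rH rI v0 h N psi_i {M..r0} = \<infinity>"
proof -
  obtain s where s: "0 < s" "emeasure sphere_measure (space sphere_measure) = ennreal s"
    using sphere_measure_total by blast
  obtain c where c: "0 < c" "\<forall>p\<in>exterior M. p$1 = v0 \<and> rad p \<le> r0 \<longrightarrow> c \<le> N_coeff N p"
    using N_coeff_lower[OF N] by blast
  define r1 where "r1 = min rH r0"
  have r1: "M < r1" "r1 \<le> rH" "r1 \<le> r0" using rH r0 by (auto simp: r1_def)
  \<comment> \<open>Beyond \<open>T\<close>: \<open>u - v0 \<ge> (1 + u) / 2\<close>, the cone has \<open>r \<le> r1\<close>, and half of \<open>dtort\<close> absorbs \<open>((lam + 2) / M)\<^sup>2\<close>.\<close>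
  define T where "T = max (max (2 * \<bar>v0\<bar> + 1) (v0 - tort r1)) (12 * (lam + 2))"
  let ?I = "\<lambda>u. \<integral>\<^sup>+w. (let p = pt_uv M u v0 w in ennreal (J_current M N psi_i p \<bullet> Lbar_vf M p * (rad p)\<^sup>2)) \<partial>sphere_measure"
  define C where "C = c / 2 / (144 * M\<^sup>2) / 8"
  have C: "0 < C" using c M_pos by (simp add: C_def)
  have "(\<integral>\<^sup>+u. ?I u * indicator {u. r_uv M u v0 \<le> rH \<and> r_uv M u v0 \<in> {M..r0}} u \<partial>lborel) = \<infinity>"
  proof (rule osc_integral_infinite[of "C * s" T])
    show "0 < C * s" "0 \<le> T" using s C by (auto simp: T_def)
    fix u assume u: "T \<le> u" "1 / 2 \<le> \<bar>sin (lam * u)\<bar>"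
    have uT: "2 * \<bar>v0\<bar> + 1 \<le> u" "v0 - tort r1 \<le> u" "12 * (lam + 2) \<le> u" using u(1) by (auto simp: T_def)
    have u0: "0 \<le> u" using uT(1) abs_ge_zero[of v0] by linarith
    let ?r = "r_uv M u v0"
    have g: "M < ?r" by (rule r_uv_gt)
    have le: "?r \<le> r1" using r_uv_le_iff[OF r1(1), of u v0] uT by simp
    have mem: "u \<in> {u. r_uv M u v0 \<le> rH \<and> r_uv M u v0 \<in> {M..r0}}" using le g r1 by simp
    have "2 * v0 + 1 \<le> u" using uT(1) abs_ge_self[of v0] by linarith
    then have uv: "(1 + u) / 2 \<le> u - v0" by (simp add: field_simps)
    have tr: "- tort ?r = u - v0" by (simp add: tort_r_uv)
    have dt: "2 * ((1 + u)\<^sup>2 / (144 * M\<^sup>2)) \<le> dtort ?r"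
    proof -
      have "((1 + u) / 2)\<^sup>2 \<le> (u - v0)\<^sup>2" using uv u0 by (intro power_mono) auto
      then have "((1 + u) / 2)\<^sup>2 / (18 * M\<^sup>2) \<le> (tort ?r)\<^sup>2 / (18 * M\<^sup>2)"
        using M_pos tr by (intro divide_right_mono) (auto simp: tort_r_uv power2_commute)
      also have "\<dots> \<le> dtort ?r"
      proof (rule dtort_near_horizon[OF g])
        have "0 \<le> (1 + u) / 2" using u0 by simp
        then show "0 \<le> - tort ?r" unfolding tr using uv by (rule order_trans)
      qed
      finally show ?thesis by (simp add: power_divide)
    qed
    have "(12 * (lam + 2))\<^sup>2 \<le> (1 + u)\<^sup>2" using uT(3) lam_pos by (intro power_mono) auto
    then have "(12 * (lam + 2))\<^sup>2 / (144 * M\<^sup>2) \<le> (1 + u)\<^sup>2 / (144 * M\<^sup>2)" by (intro divide_right_mono) auto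
    moreover have "(12 * (lam + 2))\<^sup>2 / (144 * M\<^sup>2) = ((lam + 2) / M)\<^sup>2" unfolding power_mult_distrib power_divide by simp
    ultimately have d: "(1 + u)\<^sup>2 / (144 * M\<^sup>2) \<le> dtort ?r - ((lam + 2) / M)\<^sup>2" using dt by linarith
    have low: "ennreal (C / (1 + u)) \<le> (let p = pt_uv M u v0 w in ennreal (J_current M N psi_i p \<bullet> Lbar_vf M p * (rad p)\<^sup>2))"
      if w: "w \<in> sphere 0 1" for w
    proof -
      define p where "p = pt_uv M u v0 w"
      note pp = pt_uv_props[OF w, of u v0, folded p_def]
      have cp: "c \<le> N_coeff N p" using c(2) pp le r1 by (simp add: exterior_def)
      have "C / (1 + u) = c / 2 * ((1 + u)\<^sup>2 / (144 * M\<^sup>2)) * (1 / (8 * (1 + u) ^ 3))"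
        using u0 by (simp add: C_def power2_eq_square power3_eq_cube)
      also have "\<dots> \<le> c / 2 * (dtort ?r - ((lam + 2) / M)\<^sup>2) * (env u ^ 3)\<^sup>2"
      proof (rule mult_mono)
        show "c / 2 * ((1 + u)\<^sup>2 / (144 * M\<^sup>2)) \<le> c / 2 * (dtort ?r - ((lam + 2) / M)\<^sup>2)"
          using d c by (intro mult_left_mono) auto
        have "0 \<le> (1 + u)\<^sup>2 / (144 * M\<^sup>2)" by simp
        then have "0 \<le> dtort ?r - ((lam + 2) / M)\<^sup>2" using d by linarith
        then show "0 \<le> c / 2 * (dtort ?r - ((lam + 2) / M)\<^sup>2)" using c by simp
      qed (use env_six_lower[OF u0] u0 in auto)
      also have "\<dots> \<le> J_current M N psi_i p \<bullet> Lbar_vf M p * (rad p)\<^sup>2"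
        by (rule psi_i_integrand_lower[OF u0 u(2) g w p_def pp(1)[symmetric] c(1) cp])
      finally show ?thesis unfolding Let_def p_def by (rule ennreal_leI)
    qed
    have "ennreal (C * s / (1 + u)) = ennreal (C / (1 + u)) * ennreal s"
      using s u0 C by (simp add: ennreal_mult'[symmetric])
    also have "\<dots> \<le> ?I u"
      using nn_integral_sphere_lower[OF low] by (simp add: s(2))
    finally show "ennreal (C * s / (1 + u)) \<le> ?I u * indicator {u. r_uv M u v0 \<le> rH \<and> r_uv M u v0 \<in> {M..r0}} u"
      using mem by simp
  qed
  then show ?thesis unfolding N_flux_def by simp
qed

end

theorem theoremB:
  fixes M rH rI v0 :: real and h :: "real \<Rightarrow> real" and N :: "real^4 \<Rightarrow> real^4"
  assumes "0 < M" and "M < rH" and "rH < 2 * M" and "2 * M < rI" and "0 < v0"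
    and "slope_function M rH rI h"
    and "N_field M N"
  shows
    "(\<exists>\<psi> \<Theta> \<Theta>' \<Phi> \<Phi>'.
        wave_solution M \<psi> \<and> horizon_trace M \<psi> \<Theta> \<Theta>' \<and> scri_trace M \<psi> \<Phi> \<Phi>' \<and>
        boundary_flux \<Theta>' < \<infinity> \<and> boundary_flux \<Phi>' < \<infinity> \<and>
        (\<forall>v. \<forall>w\<in>sphere 0 1. \<psi> (pt v M w) = 0) \<and>
        (\<forall>p::real. weighted_boundary_flux p \<Phi>' = \<infinity> \<longleftrightarrow> p \<ge> 2) \<and>
        (\<forall>r0>M. N_flux M rH rI v0 h N \<psi> {M..r0} = \<infinity>))
   \<and> (\<exists>\<psi> \<Theta> \<Theta>' \<Phi> \<Phi>'.
        wave_solution M \<psi> \<and> horizon_trace M \<psi> \<Theta> \<Theta>' \<and> scri_trace M \<psi> \<Phi> \<Phi>' \<and>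
        boundary_flux \<Theta>' < \<infinity> \<and> boundary_flux \<Phi>' < \<infinity> \<and>
        (\<forall>u. \<forall>w\<in>sphere 0 1. \<Phi> u w = 0) \<and>
        (\<forall>p::real. weighted_boundary_flux p \<Theta>' = \<infinity> \<longleftrightarrow> p \<ge> 2) \<and>
        (\<forall>R0\<ge>rI. weighted_N_flux M rH rI v0 h N \<psi> R0 = \<infinity>))"
proof -
  interpret ern M by unfold_locales (rule assms(1))
  show ?thesis
  proof (intro conjI)
    show "\<exists>\<psi> \<Theta> \<Theta>' \<Phi> \<Phi>'.
        wave_solution M \<psi> \<and> horizon_trace M \<psi> \<Theta> \<Theta>' \<and> scri_trace M \<psi> \<Phi> \<Phi>' \<and>
        boundary_flux \<Theta>' < \<infinity> \<and> boundary_flux \<Phi>' < \<infinity> \<and>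
        (\<forall>v. \<forall>w\<in>sphere 0 1. \<psi> (pt v M w) = 0) \<and>
        (\<forall>p::real. weighted_boundary_flux p \<Phi>' = \<infinity> \<longleftrightarrow> p \<ge> 2) \<and>
        (\<forall>r0>M. N_flux M rH rI v0 h N \<psi> {M..r0} = \<infinity>)"
      using psi_i_wave psi_i_horizon_trace psi_i_scri boundary_flux_zero rad_field'_fluxes psi_i_horizon
        psi_i_flux_infinite[OF assms(7) assms(2)]
      by (intro exI[of _ psi_i] exI[of _ "\<lambda>v w. 0"] exI[of _ "\<lambda>v w. 0"]
          exI[of _ "\<lambda>u w. rad_field u"] exI[of _ "\<lambda>u w. rad_field' u"]) simp
    show "\<exists>\<psi> \<Theta> \<Theta>' \<Phi> \<Phi>'.
        wave_solution M \<psi> \<and> horizon_trace M \<psi> \<Theta> \<Theta>' \<and> scri_trace M \<psi> \<Phi> \<Phi>' \<and>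
        boundary_flux \<Theta>' < \<infinity> \<and> boundary_flux \<Phi>' < \<infinity> \<and>
        (\<forall>u. \<forall>w\<in>sphere 0 1. \<Phi> u w = 0) \<and>
        (\<forall>p::real. weighted_boundary_flux p \<Theta>' = \<infinity> \<longleftrightarrow> p \<ge> 2) \<and>
        (\<forall>R0\<ge>rI. weighted_N_flux M rH rI v0 h N \<psi> R0 = \<infinity>)"
      using psi_ii_wave psi_ii_horizon_trace psi_ii_scri boundary_flux_zero rad_field'_fluxes
        psi_ii_weighted_infinite assms(1,4)
      by (intro exI[of _ psi_ii] exI[of _ "\<lambda>v w. rad_field v"] exI[of _ "\<lambda>v w. rad_field' v"]
          exI[of _ "\<lambda>u w. 0"] exI[of _ "\<lambda>u w. 0"]) simp
  qed
qed

end
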